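(* Let $(G,\mu)$ be an ergodic countable measured groupoid such that $(G^{(0)},\mu)$ is a diffuse standard probability space. Then $(G,\mu)$ cannot have simultaneously properties (T) and (H).
   Context: **Groupoids.** A Borel groupoid is a groupoid $G$ with a standard Borel structure such that range $r$, source $s$, inverse and product are Borel; $X=G^{(0)}$ is its unit space, $G^x=r^{-1}(x)$, $G_x=s^{-1}(x)$. It is countable if all $G^x$ are countable. Given a probability measure $\mu$ on $X$, the $\sigma$-finite measure $\nu$ on $G$ is $\int_G F\,d\nu=\int_X\sum_{s(\gamma)=x}F(\gamma)\,d\mu(x)$; $\mu$ is quasi-invariant if $\nu$ is equivalent to its image under $\gamma\mapsto\gamma^{-1}$. A countable measured groupoid $(G,\mu)$ is a countable Borel groupoid with a quasi-invariant probability measure $\mu$ on $X$. It is ergodic if every Borel $E\subset X$ with $s(r^{-1}(E))=E$ is $\mu$-null or conull. Diffuse means without atoms. An inessential reduction is $G_{|U}=\{\gamma:r(\gamma),s(\gamma)\in U\}$ with $U\subset X$ Borel conull. **Property (H).** A Borel function $F:G\to\mathbb{C}$ is positive definite if there is a $\mu$-null set $N\subset X$ such that for all $x\notin N$ and $\gamma_1,\dots,\gamma_k\in G^x$ the matrix $[F(\gamma_i^{-1}\gamma_j)]$ is positive (semi-definite). $(G,\mu)$ has property (H) if there is a sequence $(F_n)$ of positive definite functions on $G$ with (i) $(F_n)_{|X}=1$ a.e.; (ii) $\nu(\{|F_n|>\varepsilon\})<+\infty$ for every $\varepsilon>0$; (iii) $\lim_nF_n=1$ a.e. **Property (T).** A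 representation $\pi$ of $(G,\mu)$ consists, on some inessential reduction, of a measurable field $\{\mathcal H(x)\}_{x\in X}$ of Hilbert spaces and unitaries $\pi(\gamma):\mathcal H(s(\gamma))\to\mathcal H(r(\gamma))$, with $\pi(\gamma_1\gamma_2)=\pi(\gamma_1)\pi(\gamma_2)$ for composable pairs, depending on $\gamma$ in a Borel way (i.e. $\gamma\mapsto\langle\pi(\gamma)\xi(s(\gamma)),\eta(r(\gamma))\rangle$ is Borel for all Borel sections $\xi,\eta$). A unit section is a measurable section $\xi$ with $\|\xi(x)\|=1$ a.e.; it is invariant if $\pi(\gamma)\xi(s(\gamma))=\xi(r(\gamma))$ for a.e. $\gamma$. $\pi$ almost has unit invariant sections if there is a sequence $(\xi_n)$ of unit sections with $\lim_n\|\pi(\gamma)\xi_n(s(\gamma))-\xi_n(r(\gamma))\|=0$ for a.e. $\gamma\in G$. $(G,\mu)$ has property (T) if every representation that almost has unit invariant sections has a unit invariant section. *)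

theory Defs
  imports
    "HOL-Probability.Probability"
    "HOL-Algebra.Module"
    "HOL-Algebra.Algebraic_Closure_Type"
begin

section \<open>Countable measured groupoids\<close>

text \<open>The topology is existentially quantified: only the Borel structure is part of the data.\<close>

definition standard_borel :: "'a measure \<Rightarrow> bool" where
  "standard_borel M \<longleftrightarrow>
     (\<exists>T. completely_metrizable_space T \<and> second_countable T \<and> topspace T = space M \<and>
          sets M = sigma_sets (topspace T) {U. openin T U})"

text \<open>Only \<open>space\<close> and \<open>sets\<close> of the field \<open>borel_str\<close> are used; its values as a measure are
  irrelevant. The unit space is a subset of the groupoid, and \<open>gmult G a b\<close> is meaningful when
  \<open>src G a = rng G b\<close>.\<close>

record 'g groupoid =
  borel_str :: "'g measure"
  unit_space :: "'g set"
  rng :: "'g \<Rightarrow> 'g"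
  src :: "'g \<Rightarrow> 'g"
  ginv :: "'g \<Rightarrow> 'g"
  gmult :: "'g \<Rightarrow> 'g \<Rightarrow> 'g"

abbreviation arrows :: "'g groupoid \<Rightarrow> 'g set" where
  "arrows G \<equiv> space (borel_str G)"

definition composable :: "'g groupoid \<Rightarrow> ('g \<times> 'g) set" where
  "composable G = {(a, b). a \<in> arrows G \<and> b \<in> arrows G \<and> src G a = rng G b}"

definition rng_fibre :: "'g groupoid \<Rightarrow> 'g \<Rightarrow> 'g set" where
  "rng_fibre G x = {a \<in> arrows G. rng G a = x}"

definition src_fibre :: "'g groupoid \<Rightarrow> 'g \<Rightarrow> 'g set" where
  "src_fibre G x = {a \<in> arrows G. src G a = x}"

definition reduction :: "'g groupoid \<Rightarrow> 'g set \<Rightarrow> 'g set" where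
  "reduction G U = {a \<in> arrows G. rng G a \<in> U \<and> src G a \<in> U}"

locale groupoid =
  fixes G :: "'g groupoid"
  assumes units_subset: "unit_space G \<subseteq> arrows G"
    and rng_unit: "a \<in> arrows G \<Longrightarrow> rng G a \<in> unit_space G"
    and src_unit: "a \<in> arrows G \<Longrightarrow> src G a \<in> unit_space G"
    and rng_of_unit: "x \<in> unit_space G \<Longrightarrow> rng G x = x"
    and src_of_unit: "x \<in> unit_space G \<Longrightarrow> src G x = x"
    and mult_closed: "(a, b) \<in> composable G \<Longrightarrow> gmult G a b \<in> arrows G"
    and rng_mult: "(a, b) \<in> composable G \<Longrightarrow> rng G (gmult G a b) = rng G a"
    and src_mult: "(a, b) \<in> composable G \<Longrightarrow> src G (gmult G a b) = src G b"
    and mult_assoc: "(a, b) \<in> composable G \<Longrightarrow> (b, c) \<in> composable G \<Longrightarrow>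
           gmult G (gmult G a b) c = gmult G a (gmult G b c)"
    and mult_rng: "a \<in> arrows G \<Longrightarrow> gmult G (rng G a) a = a"
    and mult_src: "a \<in> arrows G \<Longrightarrow> gmult G a (src G a) = a"
    and inv_closed: "a \<in> arrows G \<Longrightarrow> ginv G a \<in> arrows G"
    and rng_inv: "a \<in> arrows G \<Longrightarrow> rng G (ginv G a) = src G a"
    and src_inv: "a \<in> arrows G \<Longrightarrow> src G (ginv G a) = rng G a"
    and mult_inv: "a \<in> arrows G \<Longrightarrow> gmult G a (ginv G a) = rng G a"
    and inv_mult: "a \<in> arrows G \<Longrightarrow> gmult G (ginv G a) a = src G a"

locale borel_groupoid = groupoid +
  assumes standard: "standard_borel (borel_str G)"
    and rng_measurable: "rng G \<in> borel_str G \<rightarrow>\<^sub>M borel_str G"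
    and src_measurable: "src G \<in> borel_str G \<rightarrow>\<^sub>M borel_str G"
    and inv_measurable: "ginv G \<in> borel_str G \<rightarrow>\<^sub>M borel_str G"
    and mult_measurable: "(\<lambda>(a, b). gmult G a b) \<in>
           restrict_space (borel_str G \<Otimes>\<^sub>M borel_str G) (composable G) \<rightarrow>\<^sub>M borel_str G"

text \<open>The measure \<open>\<nu>\<close>. The set function below is countably additive for a countable Borel groupoid,
  since \<open>x \<mapsto> card (A \<inter> src_fibre G x)\<close> is then Borel by the Lusin--Novikov theorem, so
  \<open>measure_of\<close> does not fall back to its default value.\<close>

definition src_measure :: "'g groupoid \<Rightarrow> 'g measure \<Rightarrow> 'g measure" where
  "src_measure G \<mu> = measure_of (arrows G) (sets (borel_str G))
     (\<lambda>A. \<integral>\<^sup>+ x. (\<integral>\<^sup>+ a. indicator A a \<partial>count_space (src_fibre G x)) \<partial>\<mu>)"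

definition quasi_invariant :: "'g groupoid \<Rightarrow> 'g measure \<Rightarrow> bool" where
  "quasi_invariant G \<mu> \<longleftrightarrow>
     (let \<nu> = src_measure G \<mu>; \<nu>' = distr \<nu> (borel_str G) (ginv G)
      in absolutely_continuous \<nu> \<nu>' \<and> absolutely_continuous \<nu>' \<nu>)"

locale countable_measured_groupoid = borel_groupoid G + prob_space \<mu>
  for G :: "'g groupoid" and \<mu> :: "'g measure" +
  assumes countable_fibres: "x \<in> unit_space G \<Longrightarrow> countable (rng_fibre G x)"
    and sets_base: "sets \<mu> = sets (restrict_space (borel_str G) (unit_space G))"
    and quasi_inv: "quasi_invariant G \<mu>"

definition ergodic :: "'g groupoid \<Rightarrow> 'g measure \<Rightarrow> bool" where
  "ergodic G \<mu> \<longleftrightarrow>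
     (\<forall>E\<in>sets \<mu>. src G ` {a \<in> arrows G. rng G a \<in> E} = E \<longrightarrow>
        E \<in> null_sets \<mu> \<or> space \<mu> - E \<in> null_sets \<mu>)"

definition diffuse :: "'a measure \<Rightarrow> bool" where
  "diffuse \<mu> \<longleftrightarrow> (\<forall>x\<in>space \<mu>. emeasure \<mu> {x} = 0)"

section \<open>Property (H)\<close>

definition psd_matrix :: "nat \<Rightarrow> (nat \<Rightarrow> nat \<Rightarrow> complex) \<Rightarrow> bool" where
  "psd_matrix k A \<longleftrightarrow>
     (\<forall>c :: nat \<Rightarrow> complex.
        let q = (\<Sum>i<k. \<Sum>j<k. cnj (c i) * A i j * c j) in Im q = 0 \<and> 0 \<le> Re q)"

definition positive_definite_on :: "'g groupoid \<Rightarrow> 'g measure \<Rightarrow> ('g \<Rightarrow> complex) \<Rightarrow> bool" where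
  "positive_definite_on G \<mu> F \<longleftrightarrow>
     F \<in> borel_measurable (borel_str G) \<and>
     (AE x in \<mu>. \<forall>k (a :: nat \<Rightarrow> 'g). (\<forall>i<k. a i \<in> rng_fibre G x) \<longrightarrow>
        psd_matrix k (\<lambda>i j. F (gmult G (ginv G (a i)) (a j))))"

definition property_H :: "'g groupoid \<Rightarrow> 'g measure \<Rightarrow> bool" where
  "property_H G \<mu> \<longleftrightarrow>
     (\<exists>F :: nat \<Rightarrow> 'g \<Rightarrow> complex.
        (\<forall>n. positive_definite_on G \<mu> (F n)) \<and>
        (\<forall>n. AE x in \<mu>. F n x = 1) \<and>
        (\<forall>n. \<forall>\<epsilon>>0. emeasure (src_measure G \<mu>) {a \<in> arrows G. cmod (F n a) > \<epsilon>} < \<infinity>) \<and>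
        (AE a in src_measure G \<mu>. (\<lambda>n. F n a) \<longlonglongrightarrow> 1))"

section \<open>Complex Hilbert spaces with explicit carriers\<close>

text \<open>The multiplicative fields \<open>mult\<close> and \<open>one\<close> that module records inherit from rings are unused.
  The inner product is linear in its first argument.\<close>

record 'h hilbert = "(complex, 'h) module" +
  cinner :: "'h \<Rightarrow> 'h \<Rightarrow> complex"

definition hnorm :: "'h hilbert \<Rightarrow> 'h \<Rightarrow> real" where
  "hnorm V v = sqrt (Re (cinner V v v))"

locale complex_hilbert_space = Module.module "ring_of_type_algebra :: complex ring" V
  for V :: "'h hilbert" +
  assumes cinner_add: "u \<in> carrier V \<Longrightarrow> v \<in> carrier V \<Longrightarrow> w \<in> carrier V \<Longrightarrow>
           cinner V (u \<oplus>\<^bsub>V\<^esub> v) w = cinner V u w + cinner V v w"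
    and cinner_smult: "u \<in> carrier V \<Longrightarrow> v \<in> carrier V \<Longrightarrow>
           cinner V (c \<odot>\<^bsub>V\<^esub> u) v = c * cinner V u v"
    and cinner_cnj: "u \<in> carrier V \<Longrightarrow> v \<in> carrier V \<Longrightarrow> cinner V v u = cnj (cinner V u v)"
    and cinner_nonneg: "u \<in> carrier V \<Longrightarrow> 0 \<le> Re (cinner V u u)"
    and cinner_definite: "u \<in> carrier V \<Longrightarrow> cinner V u u = 0 \<Longrightarrow> u = \<zero>\<^bsub>V\<^esub>"
    and complete: "range f \<subseteq> carrier V \<Longrightarrow>
           (\<And>\<epsilon>. 0 < \<epsilon> \<Longrightarrow> \<exists>N. \<forall>m\<ge>N. \<forall>n\<ge>N. hnorm V (f m \<ominus>\<^bsub>V\<^esub> f n) < \<epsilon>) \<Longrightarrow>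
           \<exists>l\<in>carrier V. (\<lambda>n. hnorm V (f n \<ominus>\<^bsub>V\<^esub> l)) \<longlonglongrightarrow> 0"

definition unitary :: "'h hilbert \<Rightarrow> 'h hilbert \<Rightarrow> ('h \<Rightarrow> 'h) \<Rightarrow> bool" where
  "unitary V W f \<longleftrightarrow>
     bij_betw f (carrier V) (carrier W) \<and>
     (\<forall>u\<in>carrier V. \<forall>v\<in>carrier V. f (u \<oplus>\<^bsub>V\<^esub> v) = f u \<oplus>\<^bsub>W\<^esub> f v) \<and>
     (\<forall>c. \<forall>u\<in>carrier V. f (c \<odot>\<^bsub>V\<^esub> u) = c \<odot>\<^bsub>W\<^esub> f u) \<and>
     (\<forall>u\<in>carrier V. \<forall>v\<in>carrier V. cinner W (f u) (f v) = cinner V u v)"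

definition total_sequence :: "'h hilbert \<Rightarrow> (nat \<Rightarrow> 'h) \<Rightarrow> bool" where
  "total_sequence V f \<longleftrightarrow>
     (\<forall>v\<in>carrier V. \<forall>\<epsilon>>0. \<exists>k (c :: nat \<Rightarrow> complex).
        hnorm V (v \<ominus>\<^bsub>V\<^esub> (\<Oplus>\<^bsub>V\<^esub>i\<in>{..<k}. c i \<odot>\<^bsub>V\<^esub> f i)) < \<epsilon>)"

section \<open>Measurable fields and representations\<close>

text \<open>Dixmier's definition: \<open>S\<close> is the space of Borel sections of the field \<open>H\<close> over \<open>M\<close>. A section
  is only constrained on \<open>space M\<close>; its values elsewhere are arbitrary.\<close>

definition measurable_field :: "'x measure \<Rightarrow> ('x \<Rightarrow> 'h hilbert) \<Rightarrow> ('x \<Rightarrow> 'h) set \<Rightarrow> bool" where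
  "measurable_field M H S \<longleftrightarrow>
     (\<forall>x\<in>space M. complex_hilbert_space (H x)) \<and>
     S \<subseteq> (\<Pi> x\<in>space M. carrier (H x)) \<and>
     (\<lambda>x. \<zero>\<^bsub>H x\<^esub>) \<in> S \<and>
     (\<forall>\<xi>\<in>S. \<forall>\<eta>\<in>S. (\<lambda>x. \<xi> x \<oplus>\<^bsub>H x\<^esub> \<eta> x) \<in> S) \<and>
     (\<forall>c. \<forall>\<xi>\<in>S. (\<lambda>x. c \<odot>\<^bsub>H x\<^esub> \<xi> x) \<in> S) \<and>
     (\<forall>\<xi>\<in>S. (\<lambda>x. hnorm (H x) (\<xi> x)) \<in> borel_measurable M) \<and>
     (\<forall>\<eta>\<in>(\<Pi> x\<in>space M. carrier (H x)).
        (\<forall>\<xi>\<in>S. (\<lambda>x. cinner (H x) (\<xi> x) (\<eta> x)) \<in> borel_measurable M) \<longrightarrow> \<eta> \<in> S) \<and>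
     (\<exists>f :: nat \<Rightarrow> 'x \<Rightarrow> 'h. (\<forall>n. f n \<in> S) \<and>
        (\<forall>x\<in>space M. total_sequence (H x) (\<lambda>n. f n x)))"

record ('g, 'h) groupoid_rep =
  base :: "'g set"
  fibre :: "'g \<Rightarrow> 'h hilbert"
  sections :: "('g \<Rightarrow> 'h) set"
  act :: "'g \<Rightarrow> 'h \<Rightarrow> 'h"

text \<open>\<open>base R\<close> is the conull set defining the inessential reduction carrying the representation.\<close>

definition representation :: "'g groupoid \<Rightarrow> 'g measure \<Rightarrow> ('g, 'h) groupoid_rep \<Rightarrow> bool" where
  "representation G \<mu> R \<longleftrightarrow>
     base R \<in> sets \<mu> \<and> space \<mu> - base R \<in> null_sets \<mu> \<and>
     measurable_field (restrict_space (borel_str G) (base R)) (fibre R) (sections R) \<and>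
     (\<forall>a\<in>reduction G (base R). unitary (fibre R (src G a)) (fibre R (rng G a)) (act R a)) \<and>
     (\<forall>a\<in>reduction G (base R). \<forall>b\<in>reduction G (base R). src G a = rng G b \<longrightarrow>
        (\<forall>v\<in>carrier (fibre R (src G b)). act R (gmult G a b) v = act R a (act R b v))) \<and>
     (\<forall>\<xi>\<in>sections R. \<forall>\<eta>\<in>sections R.
        (\<lambda>a. cinner (fibre R (rng G a)) (act R a (\<xi> (src G a))) (\<eta> (rng G a)))
          \<in> borel_measurable (restrict_space (borel_str G) (reduction G (base R))))"

definition unit_section :: "'g measure \<Rightarrow> ('g, 'h) groupoid_rep \<Rightarrow> ('g \<Rightarrow> 'h) \<Rightarrow> bool" where
  "unit_section \<mu> R \<xi> \<longleftrightarrow> \<xi> \<in> sections R \<and> (AE x in \<mu>. x \<in> base R \<longrightarrow> hnorm (fibre R x) (\<xi> x) = 1)"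

definition invariant_section ::
    "'g groupoid \<Rightarrow> 'g measure \<Rightarrow> ('g, 'h) groupoid_rep \<Rightarrow> ('g \<Rightarrow> 'h) \<Rightarrow> bool" where
  "invariant_section G \<mu> R \<xi> \<longleftrightarrow>
     (AE a in src_measure G \<mu>. a \<in> reduction G (base R) \<longrightarrow>
        act R a (\<xi> (src G a)) = \<xi> (rng G a))"

definition almost_unit_invariant ::
    "'g groupoid \<Rightarrow> 'g measure \<Rightarrow> ('g, 'h) groupoid_rep \<Rightarrow> bool" where
  "almost_unit_invariant G \<mu> R \<longleftrightarrow>
     (\<exists>\<xi> :: nat \<Rightarrow> 'g \<Rightarrow> 'h. (\<forall>n. unit_section \<mu> R (\<xi> n)) \<and>
        (AE a in src_measure G \<mu>. a \<in> reduction G (base R) \<longrightarrow>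
           (\<lambda>n. hnorm (fibre R (rng G a))
                  (act R a (\<xi> n (src G a)) \<ominus>\<^bsub>fibre R (rng G a)\<^esub> \<xi> n (rng G a)))
             \<longlonglongrightarrow> 0))"

text \<open>All fibres of a measurable field are separable, hence have at most the cardinality of
  \<^typ>\<open>nat \<Rightarrow> complex\<close>. Every representation on a measurable field is therefore isomorphic to one
  whose fibres have carriers in this type, so fixing it loses no representation.\<close>

definition property_T :: "'g groupoid \<Rightarrow> 'g measure \<Rightarrow> bool" where
  "property_T G \<mu> \<longleftrightarrow>
     (\<forall>R :: ('g, nat \<Rightarrow> complex) groupoid_rep.
        representation G \<mu> R \<and> almost_unit_invariant G \<mu> R \<longrightarrow>
        (\<exists>\<xi>. unit_section \<mu> R \<xi> \<and> invariant_section G \<mu> R \<xi>))"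

end

theory Submission
  imports Defs
begin

text \<open>From property (H) one gets positive definite functions \<open>F\<^sub>n\<close> tending to \<open>1\<close>. In the direct sum
  \<open>\<pi>\<close> of their GNS representations the cyclic sections \<open>\<xi>\<^sub>n\<close> are almost invariant, so (T) provides an
  invariant unit section \<open>\<eta>\<close>. For \<open>\<gamma>\<close> with range \<open>x\<close> the coefficient
  \<open>\<langle>\<eta>(x), \<pi>(\<gamma>) \<xi>\<^sub>n(s(\<gamma>))\<rangle> = \<langle>\<eta>(s(\<gamma>)), \<xi>\<^sub>n(s(\<gamma>))\<rangle>\<close> depends on \<open>s(\<gamma>)\<close> only, and it vanishes at infinity on
  the fibre over \<open>x\<close>, because \<open>F\<^sub>n\<close> does. Hence almost every orbit returns finitely often to the set
  \<open>{|\<langle>\<eta>, \<xi>\<^sub>n\<rangle>| \<ge> \<delta>}\<close>, which is non-null for some \<open>n\<close> and \<open>\<delta>\<close>; this is impossible in an ergodic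
  groupoid over a diffuse space.

  The theorem of Lusin and Novikov is replaced by two weaker facts. Images of Borel sets are Souslin
  sets, hence measurable for the completion of \<open>\<mu>\<close>. Moreover the sets \<open>{|F\<^sub>n| > 1/2}\<close> cover almost
  every fibre and meet it in a finite set, which yields Borel sections enumerating the fibres over
  an invariant conull set.\<close>

section \<open>Measurability of the Souslin operation\<close>

text \<open>Property (T) quantifies over fibres consisting of functions on \<open>nat\<close>, and
  Borel sections must be recognisable there. So the GNS spaces are realised as reproducing kernel
  spaces: a natural number codes a pair of \<open>n\<close> and an arrow \<gamma> with range
  \<open>x\<close>, and a vector over \<open>x\<close> is the function of its inner products with
  the vectors \<open>\<pi>(\<gamma>) \<xi>\<^sub>n(s(\<gamma>))\<close>. A section is then Borel iff
  its value at each code is, the coefficient of the overview is such a value, and \<pi> translates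
  codes. An arrow may have several codes, but functions in the space cannot tell them apart. The
  coefficient decays because it does so for the generating vectors, where it is 0 or a value of
  \<open>F\<^sub>n\<close>, and because the kernel has diagonal 1, so that norm convergence is
  uniform. Some \<open>n\<close> and \<delta> give a non-null set because the translates of the
  \<open>\<xi>\<^sub>n\<close> are total: otherwise \<eta> would vanish almost everywhere.
  Measurability for the completion is enough, since the exceptional null sets can be kept outside an
  invariant conull Borel set. The constant 1/2 stands for any number strictly between 0 and
  1.\<close>

lemma list_chain:
  assumes "good []" "\<And>p. good p \<Longrightarrow> \<exists>k. good (p @ [k])"
  shows "\<exists>t :: nat \<Rightarrow> 'k. \<forall>n. good (map t [0..<n])"
proof -
  have "\<exists>f. \<forall>n. (good (f n) \<and> length (f n) = n) \<and> (\<exists>k. f (Suc n) = f n @ [k])"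
  proof (rule dependent_nat_choice)
    show "\<exists>p. good p \<and> length p = 0" using assms(1) by auto
    show "\<exists>q. (good q \<and> length q = Suc n) \<and> (\<exists>k. q = p @ [k])" if "good p \<and> length p = n" for p n
      using assms(2)[of p] that by force
  qed
  then obtain f where f: "\<And>n. good (f n)" "\<And>n. length (f n) = n" "\<And>n. \<exists>k. f (Suc n) = f n @ [k]"
    by blast
  \<comment> \<open>Entry \<open>i\<close> no longer changes once the prefix has length
    \<open>Suc i\<close>, so it is read off there.\<close>
  have "f n = map (\<lambda>i. f (Suc i) ! i) [0..<n]" for n
  proof (induction n)
    case (Suc n)
    obtain k where k: "f (Suc n) = f n @ [k]" using f(3) by blast
    then have "k = f (Suc n) ! n" using f(2)[of n] by (simp add: nth_append)
    with k Suc show ?case by simp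
  qed (use f(2)[of 0] in simp)
  then show ?thesis using f(1) by (metis (no_types, lifting))
qed

text \<open>Koenig's lemma for a tree with branching bounded by \<open>u\<close>. A prefix is
  \<open>good\<close> if it extends to bounded solutions of every level. If all its one-step
  extensions were bad, a solution at a level beyond the finitely many relevant \<open>N k\<close>
  would contradict one of them.\<close>

lemma konig_bounded:
  fixes u :: "nat \<Rightarrow> nat" and Q :: "nat \<Rightarrow> (nat \<Rightarrow> nat) \<Rightarrow> bool"
  assumes ex: "\<And>n. \<exists>t. (\<forall>i<n. t i \<le> u i) \<and> Q n t"
    and dep: "\<And>n t t'. (\<forall>i<n. t i = t' i) \<Longrightarrow> Q n t = Q n t'"
    and dec: "\<And>n t. Q (Suc n) t \<Longrightarrow> Q n t"
  shows "\<exists>t. \<forall>n. Q n t"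
proof -
  have dec': "Q m t \<Longrightarrow> n \<le> m \<Longrightarrow> Q n t" for n m t
    by (induction m) (auto simp: le_Suc_eq dest: dec)
  define good where "good p \<longleftrightarrow> (\<forall>n. \<exists>t. (\<forall>i<n. t i \<le> u i) \<and> (\<forall>i<length p. t i = p ! i) \<and> Q n t)" for p
  have step: "\<exists>k. good (p @ [k])" if gp: "good p" for p
  proof (rule ccontr)
    assume "\<not> ?thesis"
    then have "\<forall>k. \<not> good (p @ [k])" by blast
    then have "\<forall>k. \<exists>n. \<not> (\<exists>t. (\<forall>i<n. t i \<le> u i) \<and> (\<forall>i<length (p@[k]). t i = (p@[k]) ! i) \<and> Q n t)"
      unfolding good_def not_all .
    from choice[OF this] obtain N where N:
      "\<forall>k. \<not> (\<exists>t. (\<forall>i<N k. t i \<le> u i) \<and> (\<forall>i<length (p@[k]). t i = (p@[k]) ! i) \<and> Q (N k) t)"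
      ..
    \<comment> \<open>The sum is at least every \<open>N k\<close> with
      \<open>k \<le> u (length p)\<close>; the summand \<open>Suc (length p)\<close> makes the bound
      on \<open>t\<close> reach the entry \<open>t (length p)\<close>.\<close>
    define m where "m = Suc (length p) + (\<Sum>k\<le>u (length p). N k)"
    obtain t where t: "\<forall>i<m. t i \<le> u i" "\<forall>i<length p. t i = p ! i" "Q m t"
      using gp[unfolded good_def, rule_format, of m] by auto
    let ?k = "t (length p)"
    have "?k \<le> u (length p)" using t(1) by (simp add: m_def)
    then have "N ?k \<le> m"
      unfolding m_def using member_le_sum[of ?k "{..u (length p)}" N] by simp
    then have "Q (N ?k) t" "\<forall>i<N ?k. t i \<le> u i" using t dec' by auto
    moreover have "\<forall>i<length (p@[?k]). t i = (p@[?k]) ! i"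
      using t(2) by (auto simp: nth_append less_Suc_eq)
    ultimately show False using N by blast
  qed
  have g0: "good []" using ex unfolding good_def by simp
  obtain t where t: "\<And>n. good (map t [0..<n])"
    using list_chain[of good, OF g0 step] by blast
  have "Q n t" for n
  proof -
    obtain t' where "\<forall>i<n. t' i = t i" "Q n t'"
      using t[of n, unfolded good_def, rule_format, of n] by auto
    then show ?thesis using dep[of n t t'] by auto
  qed
  then show ?thesis by blast
qed

text \<open>Outer measure is continuous along increasing unions even of non-measurable sets. This
  yields bounds \<open>u\<close> such that the branches below \<open>u\<close> still carry outer
  measure above \<open>a\<close>. Cut off at a finite level they give measurable sets, and by
  compactness the intersection of these stays inside the Souslin set, which thus has inner and outer
  approximations of equal measure.\<close>

lemma (in finite_measure) souslin_operation_completion: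
  fixes B :: "nat \<Rightarrow> (nat \<Rightarrow> nat) \<Rightarrow> 'a set"
  assumes B: "\<And>n t. B n t \<in> sets M"
    and dep: "\<And>n t t'. (\<forall>i<n. t i = t' i) \<Longrightarrow> B n t = B n t'"
    and dec: "\<And>n t. B (Suc n) t \<subseteq> B n t"
  shows "{x. \<exists>t. \<forall>n. x \<in> B n t} \<in> sets (completion M)"
proof -
  \<comment> \<open>The first entries are bounded by \<open>l\<close> rather than prescribed, so
    that \<open>P (l @ [k])\<close> increases with \<open>k\<close>.\<close>
  define P where "P l = {x. \<exists>t. (\<forall>i<length l. t i \<le> l ! i) \<and> (\<forall>n. x \<in> B n t)}" for l
  let ?om = "outer_measure_of M"
  have P0: "P [] = {x. \<exists>t. \<forall>n. x \<in> B n t}" by (simp add: P_def)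
  have PsubM: "P l \<subseteq> space M" for l using sets.sets_into_space[OF B] unfolding P_def by blast
  have Pun: "P l = (\<Union>k. P (l @ [k]))" for l
  proof (intro Set.set_eqI iffI)
    fix x assume "x \<in> P l"
    then obtain t where t: "\<forall>i<length l. t i \<le> l ! i" "\<forall>n. x \<in> B n t" by (auto simp: P_def)
    then have "x \<in> P (l @ [t (length l)])"
      by (auto simp: P_def nth_append less_Suc_eq intro!: exI[of _ t])
    then show "x \<in> (\<Union>k. P (l @ [k]))" by blast
  next
    fix x assume "x \<in> (\<Union>k. P (l @ [k]))"
    then obtain k t where t: "\<forall>i<length (l@[k]). t i \<le> (l@[k]) ! i" "\<forall>n. x \<in> B n t" by (auto simp: P_def)
    then have "\<forall>i<length l. t i \<le> l ! i" by (metis length_append_singleton less_SucI nth_append)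
    with t show "x \<in> P l" by (auto simp: P_def)
  qed
  have Pinc: "incseq (\<lambda>k. P (l @ [k]))" for l
    by (auto simp: incseq_def P_def nth_append) (metis (no_types, lifting) le_trans)
  have inner: "\<exists>Q\<in>sets M. Q \<subseteq> P [] \<and> a \<le> emeasure M Q" if a: "a < ?om (P [])" for a
  proof -
    have step: "\<exists>k. a < ?om (P (l @ [k]))" if "a < ?om (P l)" for l
    proof -
      have "(SUP k. ?om (P (l @ [k]))) = ?om (P l)"
        unfolding Pun[of l] by (rule SUP_outer_measure_of_incseq[OF PsubM Pinc])
      with that have "a < (SUP k. ?om (P (l @ [k])))" by simp
      then show ?thesis unfolding less_SUP_iff by blast
    qed
    obtain u where u: "\<And>n. a < ?om (P (map u [0..<n]))"
      using list_chain[of "\<lambda>l. a < ?om (P l)", OF a step] by blast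
    \<comment> \<open>By \<open>dep\<close>, the finitely many prefixes below \<open>u\<close>
      account for all branches at level \<open>n\<close>, so this finite union is measurable
      although \<open>P\<close> is not known to be.\<close>
    define Q where "Q n = (\<Union>t\<in>PiE {..<n} (\<lambda>i. {..u i}). B n t)" for n
    have Q: "Q n \<in> sets M" for n
      unfolding Q_def using B by (intro sets.finite_UN finite_PiE) auto
    have Qalt: "x \<in> Q n \<longleftrightarrow> (\<exists>t. (\<forall>i<n. t i \<le> u i) \<and> x \<in> B n t)" for x n
    proof
      assume "\<exists>t. (\<forall>i<n. t i \<le> u i) \<and> x \<in> B n t"
      then obtain t where t: "\<forall>i<n. t i \<le> u i" "x \<in> B n t" by blast
      have "x \<in> B n (restrict t {..<n})" using t(2) dep[of n t "restrict t {..<n}"] by simp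
      moreover have "restrict t {..<n} \<in> PiE {..<n} (\<lambda>i. {..u i})" using t(1) by auto
      ultimately show "x \<in> Q n" unfolding Q_def by blast
    qed (auto simp: Q_def PiE_def Pi_def)
    have Qdec: "decseq Q"
    proof (rule decseq_SucI)
      show "Q (Suc n) \<subseteq> Q n" for n
        unfolding subset_iff Qalt using dec[of n] by (meson less_SucI subsetD)
    qed
    have PQ: "P (map u [0..<n]) \<subseteq> Q n" for n
      unfolding subset_iff Qalt P_def by auto
    have aQ: "a \<le> emeasure M (Q n)" for n
    proof -
      have "a \<le> ?om (P (map u [0..<n]))" using u by (rule less_imp_le)
      also have "\<dots> \<le> ?om (Q n)" using PQ by (rule outer_measure_of_mono)
      also have "\<dots> = emeasure M (Q n)" using Q by (rule outer_measure_of_eq)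
      finally show ?thesis .
    qed
    have "(INF n. emeasure M (Q n)) = emeasure M (\<Inter>n. Q n)"
      using Q Qdec by (intro INF_emeasure_decseq) auto
    then have "a \<le> emeasure M (\<Inter>n. Q n)" using aQ by (metis INF_greatest)
    moreover have "(\<Inter>n. Q n) \<subseteq> P []"
    proof
      fix x assume "x \<in> (\<Inter>n. Q n)"
      then have "\<And>n. \<exists>t. (\<forall>i<n. t i \<le> u i) \<and> x \<in> B n t" using Qalt by blast
      then have "\<exists>t. \<forall>n. x \<in> B n t"
        by (rule konig_bounded) (use dep dec in blast)+
      then show "x \<in> P []" by (simp add: P0)
    qed
    ultimately show ?thesis using Q by (intro bexI[of _ "\<Inter>n. Q n"]) auto
  qed
  obtain E where E: "E \<in> sets M" "P [] \<subseteq> E" "?om (P []) = emeasure M E"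
    using outer_measure_of_attain[OF PsubM] by blast
  have "\<exists>Q\<in>sets M. Q \<subseteq> P [] \<and> ?om (P []) \<le> emeasure M Q"
  proof (cases "?om (P []) = 0")
    case True
    then show ?thesis by (intro bexI[of _ "{}"]) auto
  next
    case False
    then obtain f where f: "\<And>n::nat. f n < ?om (P [])" "f \<longlonglongrightarrow> ?om (P [])"
      using ennreal_approx_unit by (metis E(3) approx_from_below_dense_linorder not_gr_zero)
    obtain Q where Q: "\<And>n. Q n \<in> sets M" "\<And>n. Q n \<subseteq> P []" "\<And>n. f n \<le> emeasure M (Q n)"
      using inner[OF f(1)] by metis
    have "f n \<le> emeasure M (\<Union>n. Q n)" for n
      using Q(1,3)[of n] emeasure_mono[of "Q n" "\<Union>n. Q n" M] Q(1) by (meson UN_upper UNIV_I order_trans sets.countable_UN' sets.countable_UN image_subsetI)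
    then have "?om (P []) \<le> emeasure M (\<Union>n. Q n)"
      using f(2) by (meson LIMSEQ_le_const2)
    then show ?thesis using Q by (intro bexI[of _ "\<Union>n. Q n"]) auto
  qed
  then obtain Q where Q: "Q \<in> sets M" "Q \<subseteq> P []" "emeasure M E \<le> emeasure M Q" using E by auto
  have "E - Q \<in> null_sets M"
  proof -
    have "measure M E \<le> measure M Q" using Q(3) by (simp add: emeasure_eq_measure)
    then have "measure M (E - Q) = 0"
      using finite_measure_Diff[of E Q] Q E measure_nonneg[of M "E - Q"] by simp
    then show ?thesis using Q(1) E(1) by (auto simp: null_sets_def emeasure_eq_measure)
  qed
  then have "P [] - Q \<in> null_sets (completion M)"
    using E(2) by (meson Diff_mono order_refl null_sets_completion_subset null_sets_completionI)
  then have "Q \<union> (P [] - Q) \<in> sets (completion M)"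
    using Q(1) by (intro sets.Un) auto
  then show ?thesis using Q(2) by (simp add: P0 Un_absorb1)
qed

section \<open>Souslin sets over the closed sets, and images of Borel sets\<close>

definition souslin_scheme :: "'y set set \<Rightarrow> (nat \<Rightarrow> (nat \<Rightarrow> nat) \<Rightarrow> 'y set) \<Rightarrow> 'y set \<Rightarrow> bool" where
  "souslin_scheme \<C> C E \<longleftrightarrow> (\<forall>n t. C n t \<in> \<C>) \<and>
     (\<forall>n t t'. (\<forall>i<n. t i = t' i) \<longrightarrow> C n t = C n t') \<and> E = {y. \<exists>t. \<forall>n. y \<in> C n t}"

text \<open>Finite sequences are represented by infinite ones of which level \<open>n\<close> sees
  the first \<open>n\<close> entries. The levels of a scheme need not decrease.\<close>

definition souslin :: "'y set set \<Rightarrow> 'y set \<Rightarrow> bool" where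
  "souslin \<C> E \<longleftrightarrow> (\<exists>C. souslin_scheme \<C> C E)"

lemma souslin_schemeD:
  assumes "souslin_scheme \<C> C E"
  shows "C n t \<in> \<C>" "(\<And>i. i < n \<Longrightarrow> t i = t' i) \<Longrightarrow> C n t = C n t'"
    "y \<in> E \<longleftrightarrow> (\<exists>t. \<forall>n. y \<in> C n t)"
  using assms unfolding souslin_scheme_def by simp_all

lemma souslin_choice:
  assumes "\<And>i. souslin \<C> (E i)"
  shows "\<exists>C. \<forall>i. souslin_scheme \<C> (C i) (E i)"
  using assms unfolding souslin_def by metis

lemma souslin_base: "C \<in> \<C> \<Longrightarrow> souslin \<C> C"
  unfolding souslin_def souslin_scheme_def by (intro exI[of _ "\<lambda>_ _. C"]) auto

lemma souslin_UN:
  assumes "\<And>i::nat. souslin \<C> (E i)" "Y \<in> \<C>" "\<Union>\<C> \<subseteq> Y"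
  shows "souslin \<C> (\<Union>i. E i)"
proof -
  obtain C where "\<And>i. souslin_scheme \<C> (C i) (E i)"
    using souslin_choice[of \<C> E] assms(1) by blast
  note C = souslin_schemeD[OF this]
  \<comment> \<open>At level 0 no entry of \<open>t\<close> may be consulted, so the scheme starts
    with the whole space; from then on \<open>t 0\<close> selects the set.\<close>
  define D where "D n t = (case n of 0 \<Rightarrow> Y | Suc m \<Rightarrow> C (t 0) m (\<lambda>j. t (Suc j)))" for n t
  have "D n t = D n t'" if "\<forall>j<n. t j = t' j" for n t t'
    using that by (auto simp: D_def split: nat.split intro!: C(2))
  moreover have "D n t \<in> \<C>" for n t using C(1) assms(2) by (auto simp: D_def split: nat.split)
  moreover have "(\<Union>i. E i) = {y. \<exists>t. \<forall>n. y \<in> D n t}"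
  proof (intro Set.set_eqI iffI)
    fix y assume "y \<in> (\<Union>i. E i)"
    then obtain i t where it: "\<forall>n. y \<in> C i n t" unfolding UN_iff C(3) by auto
    then have "y \<in> Y" using C(1)[of i 0 t] assms(3) by blast
    then have "\<forall>n. y \<in> D n (case_nat i t)" using it by (auto simp: D_def split: nat.split)
    then show "y \<in> {y. \<exists>t. \<forall>n. y \<in> D n t}" by blast
  next
    fix y assume "y \<in> {y. \<exists>t. \<forall>n. y \<in> D n t}"
    then obtain t where "\<forall>n. y \<in> D n t" by blast
    then have "\<forall>n. y \<in> D (Suc n) t" by blast
    then show "y \<in> (\<Union>i. E i)" unfolding UN_iff C(3) by (auto simp: D_def)
  qed
  ultimately have "souslin_scheme \<C> D (\<Union>i. E i)" unfolding souslin_scheme_def by blast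
  then show ?thesis unfolding souslin_def by blast
qed

lemma souslin_INT:
  assumes "\<And>i::nat. souslin \<C> (E i)"
  shows "souslin \<C> (\<Inter>i. E i)"
proof -
  obtain C where "\<And>i. souslin_scheme \<C> (C i) (E i)"
    using souslin_choice[of \<C> E] assms(1) by blast
  note C = souslin_schemeD[OF this]
  \<comment> \<open>One sequence interleaves branches for all \<open>i\<close>. Level
    \<open>prod_encode (i, n)\<close> reads only the entries \<open>prod_encode (i, j)\<close> with
    \<open>j < n\<close>, which precede it by \<open>enc\<close>.\<close>
  define D where "D m t = (case prod_decode m of (i, n) \<Rightarrow> C i n (\<lambda>j. t (prod_encode (i, j))))" for m t
  have enc: "j < n \<Longrightarrow> prod_encode (i, j) < prod_encode (i, n)" for i j n
    by (induction n) (auto simp: prod_encode_def less_Suc_eq)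
  have "D m t = D m t'" if "\<forall>j<m. t j = t' j" for m t t'
  proof -
    obtain i n where m: "m = prod_encode (i, n)" by (metis prod_decode_inverse surj_pair)
    show ?thesis using that unfolding D_def m by (auto intro!: C(2) dest: enc)
  qed
  moreover have "D m t \<in> \<C>" for m t using C(1) by (auto simp: D_def split: prod.split)
  moreover have "(\<Inter>i. E i) = {y. \<exists>t. \<forall>n. y \<in> D n t}"
  proof (intro Set.set_eqI iffI)
    fix y assume "y \<in> (\<Inter>i. E i)"
    then have "\<forall>i. \<exists>t. \<forall>n. y \<in> C i n t" unfolding INT_iff C(3) by auto
    then obtain t where t: "\<forall>i n. y \<in> C i n (t i)" by metis
    then have "\<forall>n. y \<in> D n (\<lambda>m. case prod_decode m of (i, j) \<Rightarrow> t i j)"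
      by (auto simp: D_def split: prod.split)
    then show "y \<in> {y. \<exists>t. \<forall>n. y \<in> D n t}" by blast
  next
    fix y assume "y \<in> {y. \<exists>t. \<forall>n. y \<in> D n t}"
    then obtain t where "\<forall>n. y \<in> D n t" by blast
    then have "y \<in> D (prod_encode (i, n)) t" for i n by blast
    then have "\<forall>i n. y \<in> C i n (\<lambda>j. t (prod_encode (i, j)))" by (auto simp: D_def)
    then show "y \<in> (\<Inter>i. E i)" unfolding INT_iff C(3) by auto
  qed
  ultimately have "souslin_scheme \<C> D (\<Inter>i. E i)" unfolding souslin_scheme_def by blast
  then show ?thesis unfolding souslin_def by blast
qed

text \<open>Souslin sets are not closed under complements, so the induction carries each set
  together with its complement. Open sets enter because they are countable unions of closed
  sets.\<close>

lemma souslin_borel: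
  assumes "metrizable_space T" "E \<in> sigma_sets (topspace T) {U. openin T U}"
  shows "souslin {C. closedin T C} E \<and> souslin {C. closedin T C} (topspace T - E)"
  using assms(2)
proof induction
  case (Basic U)
  then have U: "openin T U" by simp
  then obtain C where C: "\<And>n::nat. closedin T (C n)" "\<Union>(range C) = U"
    using open_imp_fsigma_in[OF assms(1)] fsigma_in_ascending by metis
  have "souslin {C. closedin T C} (\<Union>n. C n)"
    using C by (intro souslin_UN[where Y = "topspace T"] souslin_base) (auto dest: closedin_subset)
  then show ?case using C U by (auto intro!: souslin_base)
next
  case Empty
  then show ?case by (auto intro!: souslin_base)
next
  case (Compl E)
  have "E \<subseteq> topspace T" using Compl(1) by (metis openin_subset sigma_sets_into_sp mem_Collect_eq Pow_iff subsetI)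
  then show ?case using Compl by (simp add: double_diff)
next
  case (Union E)
  have "souslin {C. closedin T C} (\<Inter>i. topspace T - E i)" using Union by (intro souslin_INT) blast
  moreover have "(\<Inter>i. topspace T - E i) = topspace T - (\<Union>i. E i)" by auto
  ultimately have "souslin {C. closedin T C} (topspace T - (\<Union>i. E i))" by metis
  moreover have "souslin {C. closedin T C} (\<Union>i. E i)"
    using Union by (intro souslin_UN[where Y = "topspace T"]) (auto dest: closedin_subset)
  ultimately show ?case by simp
qed

text \<open>A branch guesses a preimage \<open>y\<close> of \<open>x\<close>: on which side of each
  \<open>D i\<close> the point \<open>x\<close> lies, branches witnessing that \<open>y\<close> is
  in \<open>A\<close> on the corresponding side of the preimage of \<open>D i\<close>, and centres
  of balls shrinking to \<open>y\<close>. Completeness turns consistent guesses into a point, and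
  separation forces \<open>s y = x\<close>.\<close>

lemma borel_image_completion:
  fixes M :: "'y measure" and N :: "'x measure"
  assumes fin: "finite_measure N" and std: "standard_borel M" and A: "A \<in> sets M"
    and sA: "s ` A \<subseteq> space N"
    and D: "\<And>i::nat. D i \<in> sets N" "\<And>i. s -` D i \<inter> space M \<in> sets M"
    and sep: "\<And>x y. x \<in> space N \<Longrightarrow> y \<in> space N \<Longrightarrow> (\<And>i. x \<in> D i \<longleftrightarrow> y \<in> D i) \<Longrightarrow> x = y"
  shows "s ` A \<in> sets (completion N)"
proof (cases "space M = {}")
  case True
  then show ?thesis using sets.sets_into_space[OF A] by simp
next
  case False
  obtain T where T: "completely_metrizable_space T" "second_countable T" "topspace T = space M"
      "sets M = sigma_sets (topspace T) {U. openin T U}"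
    using std unfolding standard_borel_def by blast
  obtain Y d where Yd: "Metric_space Y d" "Metric_space.mcomplete Y d" "T = Metric_space.mtopology Y d"
    using T(1) unfolding completely_metrizable_space_def by blast
  interpret Metric_space Y d by (rule Yd)
  have Y: "topspace T = Y" using Yd(3) topspace_mtopology by simp
  obtain S where S: "countable S" "S \<subseteq> Y" "T closure_of S = Y"
    using second_countable_imp_separable_space[OF T(2)] unfolding separable_space_def Y by blast
  have "S \<noteq> {}" using S(3) False T(3) Y by auto
  define q where "q = from_nat_into S"
  have qY: "q n \<in> Y" for n using from_nat_into[OF \<open>S \<noteq> {}\<close>] S(2) unfolding q_def by blast
  have q: "\<exists>n. d (q n) y \<le> e" if yY: "y \<in> Y" and e0: "0 < e" for y e
  proof -
    have "y \<in> mtopology closure_of S" using S(3) Yd(3) yY by simp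
    then obtain z where "z \<in> S" "z \<in> mball y e" using e0 unfolding metric_closure_of by blast
    moreover obtain n where "q n = z"
      using from_nat_into_surj[OF S(1) \<open>z \<in> S\<close>] unfolding q_def by blast
    ultimately show ?thesis by (auto simp: commute intro: less_imp_le)
  qed
  \<comment> \<open>The value \<open>b = 1\<close> stands for membership in \<open>D i\<close>,
    every other value for the opposite.\<close>
  define W where "W m = (case prod_decode m of (i, b) \<Rightarrow>
      if b = (1::nat) then A \<inter> (s -` D i \<inter> space M) else A - (s -` D i \<inter> space M))" for m
  have "W m \<in> sets M" for m using A D(2) by (auto simp: W_def split: prod.split)
  then have WS: "souslin {C. closedin T C} (W m)" for m
    using souslin_borel[OF completely_metrizable_imp_metrizable_space[OF T(1)]] T(4) by metis
  obtain C where "\<And>i. souslin_scheme {C. closedin T C} (C i) (W i)"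
    using souslin_choice[of "{C. closedin T C}" W] WS by blast
  note C = souslin_schemeD[OF this]
  have Cc: "closedin T (C i n t)" for i n t using C(1)[of i n t] by simp
  \<comment> \<open>One sequence carries three: the sides (\<open>tau\<close>), the centres of the
    balls (\<open>rho\<close>) and the witnesses (\<open>sig\<close>).\<close>
  define tau where "tau t m = fst (prod_decode (t m))" for t and m :: nat
  define rho where "rho t m = fst (prod_decode (snd (prod_decode (t m))))" for t and m :: nat
  define sig where "sig t m = snd (prod_decode (snd (prod_decode (t m))))" for t and m :: nat
  define K where "K m t = (case prod_decode m of (i::nat, n::nat) \<Rightarrow>
      C (prod_encode (i, tau t i)) n (\<lambda>j. sig t (prod_encode (i, j))) \<inter> mcball (q (rho t m)) (1 / Suc m))" for m t
  \<comment> \<open>The factor \<open>Y\<close> matters at \<open>n = 0\<close>, where the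
    intersection over no index is \<open>UNIV\<close>.\<close>
  define L where "L n t = Y \<inter> (\<Inter>m<n. K m t)" for n t
  \<comment> \<open>Only the emptiness of \<open>L n t\<close> enters, not a point of it. So
    \<open>B n t\<close> is empty or a finite Boolean combination of the sets \<open>D i\<close>,
    and lies in \<open>sets N\<close>.\<close>
  define B where "B n t = (if L n t = {} then {} else {x \<in> space N. \<forall>i\<in>{..<n}. x \<in> D i \<longleftrightarrow> tau t i = 1})" for n t
  have enc: "j < n \<Longrightarrow> prod_encode (i, j) < prod_encode (i, n)" for i j n
    by (induction n) (auto simp: prod_encode_def less_Suc_eq)
  have encle: "i \<le> prod_encode (i, n)" for i n by (rule le_prod_encode_1)
  have Kdep: "K m t = K m t'" if "\<forall>i\<le>m. t i = t' i" for m t t'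
  proof -
    obtain i n where m: "m = prod_encode (i, n)" by (metis prod_decode_inverse surj_pair)
    have "tau t i = tau t' i" "rho t m = rho t' m" using that encle[of i n] by (auto simp: m tau_def rho_def)
    moreover have "\<forall>j<n. sig t (prod_encode (i, j)) = sig t' (prod_encode (i, j))"
      using that enc[of _ n i] by (auto simp: m sig_def less_imp_le)
    ultimately show ?thesis unfolding K_def
      using C(2)[of n "\<lambda>j. sig t (prod_encode (i, j))" "\<lambda>j. sig t' (prod_encode (i, j))"] by (simp add: m)
  qed
  have Ldep: "L n t = L n t'" if "\<forall>i<n. t i = t' i" for n t t'
    unfolding L_def using that by (intro arg_cong2[where f="(\<inter>)"] INF_cong refl Kdep) auto
  have Bdep: "B n t = B n t'" if "\<forall>i<n. t i = t' i" for n t t'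
    using that Ldep[OF that] unfolding B_def by (auto simp: tau_def)
  have Ldec: "L (Suc n) t \<subseteq> L n t" for n t by (auto simp: L_def less_Suc_eq)
  have Bdec: "B (Suc n) t \<subseteq> B n t" for n t
    unfolding B_def using Ldec[of n t] by (auto simp: less_Suc_eq)
  have Bm: "B n t \<in> sets N" for n t
  proof -
    have "{x \<in> space N. \<forall>i\<in>{..<n}. x \<in> D i \<longleftrightarrow> tau t i = 1} \<in> sets N"
    proof (intro sets.sets_Collect_finite_All finite_lessThan)
      fix i
      have "{x \<in> space N. x \<in> D i \<longleftrightarrow> tau t i = 1} = (if tau t i = 1 then D i else space N - D i)"
        using sets.sets_into_space[OF D(1)[of i]] by auto
      then show "{x \<in> space N. x \<in> D i \<longleftrightarrow> tau t i = 1} \<in> sets N" using D(1) by simp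
    qed
    then show ?thesis unfolding B_def by (metis sets.empty_sets)
  qed
  have Kcl: "closedin T (K m t)" for m t
    unfolding K_def using Cc Yd(3) by (auto split: prod.split intro!: closedin_Int)
  have Lcl: "closedin mtopology (L n t)" for n t
  proof (cases n)
    case 0
    then show ?thesis using closedin_topspace[of mtopology] by (simp add: L_def)
  next
    case (Suc k)
    then show ?thesis unfolding L_def using Kcl Yd(3) Y closedin_topspace[of T]
      by (intro closedin_Int closedin_Inter) auto
  qed
  have "s ` A = {x. \<exists>t. \<forall>n. x \<in> B n t}"
  proof (intro Set.set_eqI iffI)
    fix x assume "x \<in> s ` A"
    then obtain y where y: "y \<in> A" "x = s y" by blast
    then have yM: "y \<in> space M" and yY: "y \<in> Y" using sets.sets_into_space[OF A] T(3) Y by auto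
    define ta where "ta i = (if x \<in> D i then 1 else (0::nat))" for i
    have "y \<in> W (prod_encode (i, ta i))" for i
      using y yM by (auto simp: W_def ta_def)
    then have "\<forall>i. \<exists>t. \<forall>n. y \<in> C (prod_encode (i, ta i)) n t" using C(3) by blast
    then obtain si where si: "\<And>i n. y \<in> C (prod_encode (i, ta i)) n (si i)" by metis
    have "\<forall>m. \<exists>n. d (q n) y \<le> 1 / Suc m" using q[OF yY] by simp
    then obtain ro where ro: "\<And>m. d (q (ro m)) y \<le> 1 / Suc m" by metis
    define t where "t m = prod_encode (ta m, prod_encode (ro m, case prod_decode m of (i, j) \<Rightarrow> si i j))" for m
    have t: "tau t = ta" "rho t = ro" "sig t (prod_encode (i, j)) = si i j" for i j
      by (auto simp: tau_def rho_def sig_def t_def)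
    have "y \<in> K m t" for m
      unfolding K_def t using si ro yY qY by (auto split: prod.split)
    then have "y \<in> L n t" for n unfolding L_def using yY by blast
    then have "x \<in> B n t" for n
      unfolding B_def t using y(1) sA unfolding y(2) by (auto simp: ta_def y(2))
    then show "x \<in> {x. \<exists>t. \<forall>n. x \<in> B n t}" by blast
  next
    fix x assume "x \<in> {x. \<exists>t. \<forall>n. x \<in> B n t}"
    then obtain t where t: "\<And>n. x \<in> B n t" by blast
    then have Lne: "L n t \<noteq> {}" for n unfolding B_def by (metis empty_iff)
    have xN: "x \<in> space N" using sets.sets_into_space[OF Bm] t by blast
    have xD: "x \<in> D i \<longleftrightarrow> tau t i = 1" for i
      using t[of "Suc i"] Lne[of "Suc i"] unfolding B_def by auto
    have "\<Inter>(range (\<lambda>n. L n t)) \<noteq> {}"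
    proof (rule Yd(2)[unfolded mcomplete_nest, rule_format], intro conjI allI impI)
      show "closedin mtopology (L n t)" "L n t \<noteq> {}" for n using Lcl Lne by auto
      show "decseq (\<lambda>n. L n t)" using Ldec by (intro decseq_SucI)
      fix e :: real assume "0 < e"
      then obtain m where m: "1 / Suc m < e" using nat_approx_posE by (metis of_nat_Suc)
      have "L (Suc m) t \<subseteq> K m t" by (auto simp: L_def)
      also have "K m t \<subseteq> mcball (q (rho t m)) (1 / Suc m)" unfolding K_def by (auto split: prod.split)
      also have "\<dots> \<subseteq> mcball (q (rho t m)) e" using m by auto
      finally show "\<exists>n a. L n t \<subseteq> mcball a e" by blast
    qed
    then obtain y where y: "\<And>n. y \<in> L n t" by blast
    have yK: "y \<in> K m t" for m using y[of "Suc m"] unfolding L_def by auto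
    have "y \<in> C (prod_encode (i, tau t i)) n (\<lambda>j. sig t (prod_encode (i, j)))" for i n
      using yK[of "prod_encode (i, n)"] unfolding K_def by simp
    then have yW: "y \<in> W (prod_encode (i, tau t i))" for i using C(3) by blast
    have yA: "y \<in> A" using yW[of 0] unfolding W_def by (auto split: if_splits)
    then have yM: "y \<in> space M" using sets.sets_into_space[OF A] by auto
    have "s y \<in> D i \<longleftrightarrow> x \<in> D i" for i
      using yW[of i] yM xD[of i] unfolding W_def by (auto split: if_splits)
    then have "s y = x" using sep sA yA xN by blast
    then show "x \<in> s ` A" using yA by blast
  qed
  also have "\<dots> \<in> sets (completion N)"
  proof (rule finite_measure.souslin_operation_completion[OF fin])
    show "B n t \<in> sets N" for n t by (rule Bm)
    show "B n t = B n t'" if "\<forall>i<n. t i = t' i" for n t t' using that by (rule Bdep)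
    show "B (Suc n) t \<subseteq> B n t" for n t by (rule Bdec)
  qed
  finally show ?thesis .
qed

section \<open>Reproducing kernel Hilbert spaces on the natural numbers\<close>

lemma mult_cnj_cmod: "z * cnj z = complex_of_real ((cmod z)\<^sup>2)"
  by (rule complex_norm_square[symmetric])

section \<open>Finite forms of a positive definite kernel\<close>

definition sform :: "(nat \<Rightarrow> nat \<Rightarrow> complex) \<Rightarrow> nat \<Rightarrow> (nat \<Rightarrow> complex) \<Rightarrow> (nat \<Rightarrow> complex) \<Rightarrow> complex" where
  "sform K N c d = (\<Sum>i<N. \<Sum>j<N. cnj (c i) * K i j * d j)"

definition pd_kernel :: "(nat \<Rightarrow> nat \<Rightarrow> complex) \<Rightarrow> bool" where
  "pd_kernel K \<longleftrightarrow> (\<forall>k. psd_matrix k K)"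

lemma pd_kernel_iff: "pd_kernel K \<longleftrightarrow> (\<forall>N c. Im (sform K N c c) = 0 \<and> 0 \<le> Re (sform K N c c))"
  by (simp add: pd_kernel_def psd_matrix_def sform_def Let_def)

lemma sform_add_left: "sform K N (\<lambda>i. c i + d i) e = sform K N c e + sform K N d e"
  by (simp add: sform_def algebra_simps sum.distrib)

lemma sform_add_right: "sform K N e (\<lambda>i. c i + d i) = sform K N e c + sform K N e d"
  by (simp add: sform_def algebra_simps sum.distrib)

lemma sform_scale_left: "sform K N (\<lambda>i. a * c i) e = cnj a * sform K N c e"
  by (simp add: sform_def sum_distrib_left algebra_simps)

lemma sform_scale_right: "sform K N e (\<lambda>i. a * c i) = a * sform K N e c"
  by (simp add: sform_def sum_distrib_left algebra_simps)

definition unitv :: "nat \<Rightarrow> nat \<Rightarrow> complex" where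
  "unitv k i = (if i = k then 1 else 0)"

lemma sum_unitv: "k < N \<Longrightarrow> (\<Sum>i<N. f i * unitv k i) = f k" "k < N \<Longrightarrow> (\<Sum>i<N. cnj (unitv k i) * f i) = f k"
proof -
  assume k: "k < N"
  have "(\<Sum>i<N. f i * unitv k i) = (\<Sum>i<N. if i = k then f i else 0)"
    "(\<Sum>i<N. cnj (unitv k i) * f i) = (\<Sum>i<N. if i = k then f i else 0)"
    by (intro sum.cong; simp add: unitv_def)+
  then show "(\<Sum>i<N. f i * unitv k i) = f k" "(\<Sum>i<N. cnj (unitv k i) * f i) = f k"
    using k by simp_all
qed

lemma sform_unitv_right: "k < N \<Longrightarrow> sform K N c (unitv k) = (\<Sum>i<N. cnj (c i) * K i k)"
  unfolding sform_def by (simp add: sum_unitv)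

lemma sform_unitv_left: "k < N \<Longrightarrow> sform K N (unitv k) c = (\<Sum>j<N. K k j * c j)"
proof -
  assume k: "k < N"
  have "sform K N (unitv k) c = (\<Sum>i<N. cnj (unitv k i) * (\<Sum>j<N. K i j * c j))"
    by (simp add: sform_def sum_distrib_left mult.assoc)
  then show ?thesis using sum_unitv(2)[OF k] by simp
qed

lemma sform_unitv: "k < N \<Longrightarrow> l < N \<Longrightarrow> sform K N (unitv k) (unitv l) = K k l"
  by (simp add: sform_unitv_left sum_unitv)

lemma pd_kernel_diag: "pd_kernel K \<Longrightarrow> Im (K k k) = 0 \<and> 0 \<le> Re (K k k)"
  unfolding pd_kernel_iff using sform_unitv[of k "Suc k" k K] by (metis lessI)

lemma pd_kernel_herm:
  assumes "pd_kernel K" shows "K j i = cnj (K i j)"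
proof -
  define N where "N = Suc (max i j)"
  have N: "i < N" "j < N" by (auto simp: N_def)
  have e: "sform K N (\<lambda>n. unitv i n + a * unitv j n) (\<lambda>n. unitv i n + a * unitv j n)
      = K i i + a * K i j + cnj a * K j i + cnj a * a * K j j" for a
    by (simp add: sform_add_left sform_add_right sform_scale_left sform_scale_right sform_unitv N algebra_simps)
  have "Im (K i i + a * K i j + cnj a * K j i + cnj a * a * K j j) = 0" for a
    using assms e unfolding pd_kernel_iff by metis
  \<comment> \<open>Polarisation: as the diagonal is real, \<open>a = 1\<close> gives the imaginary
    part of the claim and \<open>a = \<i>\<close> the real part.\<close>
  from this[of 1] this[of \<i>] have "Im (K i j) + Im (K j i) = 0" "Re (K i j) - Re (K j i) = 0"
    using pd_kernel_diag[OF assms] by auto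
  then show ?thesis by (simp add: complex_eq_iff)
qed

lemma pd_kernel_diag_real: "pd_kernel K \<Longrightarrow> K k k = complex_of_real (Re (K k k))"
  using pd_kernel_diag by (simp add: complex_eq_iff)

lemma sform_herm:
  assumes "pd_kernel K" shows "sform K N d c = cnj (sform K N c d)"
proof -
  have "cnj (sform K N c d) = (\<Sum>i<N. \<Sum>j<N. c i * K j i * cnj (d j))"
    by (simp add: sform_def pd_kernel_herm[OF assms, symmetric]) 
  also have "\<dots> = sform K N d c"
    unfolding sform_def by (subst sum.swap) (simp add: mult_ac)
  finally show ?thesis by simp
qed

lemma sform_perturb:
  assumes K: "pd_kernel K" and k: "k < N"
  shows "Re (sform K N (\<lambda>i. c i + a * unitv k i) (\<lambda>i. c i + a * unitv k i))
    = Re (sform K N c c) + 2 * Re (cnj a * sform K N (unitv k) c) + (cmod a)\<^sup>2 * Re (K k k)"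
proof -
  have "sform K N (\<lambda>i. c i + a * unitv k i) (\<lambda>i. c i + a * unitv k i) = sform K N c c +
      cnj a * sform K N (unitv k) c + cnj (cnj a * sform K N (unitv k) c) + (a * cnj a) * K k k"
    by (simp add: sform_add_left sform_add_right sform_scale_left sform_scale_right sform_unitv k
        sform_herm[OF K, of N c "unitv k"] algebra_simps)
  also have "a * cnj a = complex_of_real ((cmod a)\<^sup>2)" by (simp add: mult_cnj_cmod)
  finally show ?thesis by simp
qed

section \<open>Elimination of one vector: Schur complements\<close>

definition schur :: "(nat \<Rightarrow> nat \<Rightarrow> complex) \<Rightarrow> nat \<Rightarrow> nat \<Rightarrow> nat \<Rightarrow> complex" where
  "schur K k i j = K i j - K i k * K k j / K k k"

text \<open>The counterpart of \<open>schur\<close> for functions: the component along vector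
  \<open>k\<close> is removed. If \<open>K k k = 0\<close>, division by zero makes both operations
  the identity, as it should be, because row and column \<open>k\<close> then vanish.\<close>

definition schurf :: "(nat \<Rightarrow> nat \<Rightarrow> complex) \<Rightarrow> nat \<Rightarrow> (nat \<Rightarrow> complex) \<Rightarrow> nat \<Rightarrow> complex" where
  "schurf K k f i = f i - K i k * f k / K k k"

lemma sform_extend:
  "N \<le> M \<Longrightarrow> sform K N c d = sform K M (\<lambda>i. if i < N then c i else 0) (\<lambda>i. if i < N then d i else 0)"
proof -
  assume "N \<le> M"
  then have e: "(\<Sum>i<M. if i < N then f i else 0) = (\<Sum>i<N. f i)" for f :: "nat \<Rightarrow> complex"
    by (intro sum.mono_neutral_cong_right) auto
  have "sform K M (\<lambda>i. if i < N then c i else 0) (\<lambda>i. if i < N then d i else 0)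
    = (\<Sum>i<M. if i < N then (\<Sum>j<M. if j < N then cnj (c i) * K i j * d j else 0) else 0)"
    unfolding sform_def by (auto intro!: sum.cong)
  then show ?thesis unfolding e by (simp add: sform_def)
qed

text \<open>The vector \<open>c + a \<delta>\<^sub>k\<close> is \<open>K\<close>-orthogonal to \<open>\<delta>\<^sub>k\<close> for the coefficient \<open>a\<close> chosen here; the Schur
  complement is the form \<open>K\<close> of that vector.\<close>

lemma sform_schur:
  fixes c :: "nat \<Rightarrow> complex"
  assumes K: "pd_kernel K" and k: "k < N"
  defines "a \<equiv> - sform K N (unitv k) c / K k k"
  assumes z: "K k k = 0 \<Longrightarrow> sform K N (unitv k) c = 0"
  shows "Re (sform K N (\<lambda>i. c i + (a + b) * unitv k i) (\<lambda>i. c i + (a + b) * unitv k i))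
     = Re (sform (schur K k) N c c) + (cmod b)\<^sup>2 * Re (K k k)"
proof -
  let ?s = "sform K N (unitv k) c" and ?r = "Re (K k k)"
  have kk: "K k k = complex_of_real ?r" by (rule pd_kernel_diag_real[OF K])
  have e1: "sform (schur K k) N c c = sform K N c c - cnj ?s * ?s / K k k"
  proof -
    have "sform (schur K k) N c c = sform K N c c - (\<Sum>i<N. \<Sum>j<N. (cnj (c i) * K i k) * (K k j * c j)) / K k k"
      unfolding sform_def schur_def by (simp add: algebra_simps sum_subtractf sum_divide_distrib)
    also have "(\<Sum>i<N. \<Sum>j<N. (cnj (c i) * K i k) * (K k j * c j)) = sform K N c (unitv k) * ?s"
      unfolding sform_unitv_left[OF k] sform_unitv_right[OF k] by (simp add: sum_product)
    finally show ?thesis by (simp add: sform_herm[OF K, of N c "unitv k"])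
  qed
  have e2: "cnj ?s * ?s / K k k = complex_of_real ((cmod ?s)\<^sup>2 / ?r)"
    by (subst kk) (simp add: mult_cnj_cmod mult.commute[of "cnj ?s"])
  show ?thesis
  proof (cases "K k k = 0")
    case True
    then show ?thesis using z[OF True] by (subst sform_perturb[OF K k]) (simp add: e1 a_def)
  next
    case False
    then have r: "?r \<noteq> 0" using kk by auto
    have a: "a = - (?s / ?r)" unfolding a_def by (subst kk) simp
    have "Re (sform K N (\<lambda>i. c i + (a + b) * unitv k i) (\<lambda>i. c i + (a + b) * unitv k i))
      = Re (sform K N c c) + 2 * Re (cnj (a + b) * ?s) + (cmod (a + b))\<^sup>2 * ?r"
      by (rule sform_perturb[OF K k])
    also have "\<dots> = Re (sform K N c c) - (cmod ?s)\<^sup>2 / ?r + (cmod b)\<^sup>2 * ?r"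
      unfolding a cmod_power2 using r
      by (simp add: power2_eq_square field_simps) 
    finally show ?thesis using e1 e2 by simp
  qed
qed

text \<open>A vector of length zero is orthogonal to all others; otherwise the form would decrease
  linearly, and below zero, when another vector is moved along it.\<close>

lemma pd_kernel_zero:
  assumes K: "pd_kernel K" and z: "K k k = 0"
  shows "K k j = 0" "K j k = 0"
proof -
  define N where "N = Suc (max j k)"
  have N: "j < N" "k < N" by (auto simp: N_def)
  have "0 \<le> Re (K j j) + 2 * Re (cnj a * K k j)" for a
  proof -
    have "0 \<le> Re (sform K N (\<lambda>i. unitv j i + a * unitv k i) (\<lambda>i. unitv j i + a * unitv k i))"
      using K unfolding pd_kernel_iff by blast
    then show ?thesis unfolding sform_perturb[OF K N(2)] by (simp add: sform_unitv N z)
  qed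
  from this[of "- complex_of_real t * K k j" for t] 
  have h: "0 \<le> Re (K j j) - 2 * t * (cmod (K k j))\<^sup>2" for t
    unfolding cmod_power2 by (simp add: power2_eq_square algebra_simps)
  show "K k j = 0"
  proof (rule ccontr)
    assume "K k j \<noteq> 0"
    then have p: "0 < (cmod (K k j))\<^sup>2" by simp
    \<comment> \<open>This value of \<open>t\<close> turns \<open>h\<close> into the inequality
      \<open>0 \<le> -1\<close>.\<close>
    show False using h[of "(Re (K j j) + 1) / (2 * (cmod (K k j))\<^sup>2)"] p by simp
  qed
  then show "K j k = 0" using pd_kernel_herm[OF K, of k j] by simp
qed

lemma sform_unitv_zero: "pd_kernel K \<Longrightarrow> K k k = 0 \<Longrightarrow> k < N \<Longrightarrow> sform K N (unitv k) c = 0"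
  by (simp add: sform_unitv_left pd_kernel_zero(1)[of K k])

lemma pd_kernel_schur:
  assumes K: "pd_kernel K" shows "pd_kernel (schur K k)"
proof -
  have h: "schur K k j i = cnj (schur K k i j)" for i j
    by (simp add: schur_def pd_kernel_herm[OF K, symmetric])
  have im: "Im (sform (schur K k) N c c) = 0" for N c
  proof -
    have "cnj (sform (schur K k) N c c) = (\<Sum>i<N. \<Sum>j<N. c i * schur K k j i * cnj (c j))"
      by (simp add: sform_def h[symmetric])
    also have "\<dots> = sform (schur K k) N c c"
      unfolding sform_def by (subst sum.swap) (simp add: mult_ac)
    finally show ?thesis by (metis complex_cnj_cnj cnj.simps(2) equal_neg_zero)
  qed
  have re: "0 \<le> Re (sform (schur K k) N c c)" for N c
  proof -
    define M where "M = Suc (max N k)"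
    define d where "d i = (if i < N then c i else 0)" for i
    have M: "k < M" "N \<le> M" by (auto simp: M_def)
    \<comment> \<open>With \<open>b = 0\<close>, \<open>sform_schur\<close> presents the Schur form
      as the form of \<open>K\<close> at a corrected vector. The range is enlarged to
      \<open>M\<close> so that \<open>k\<close> is among the indices.\<close>
    let ?d = "\<lambda>i. d i + (- sform K M (unitv k) d / K k k + 0) * unitv k i"
    have "Re (sform (schur K k) N c c) = Re (sform (schur K k) M d d)"
      unfolding d_def by (subst sform_extend[OF M(2)]) (rule refl)
    also have "\<dots> = Re (sform K M ?d ?d)"
      by (subst sform_schur[OF K M(1)]) (simp_all add: sform_unitv_zero[OF K _ M(1)])
    finally have "Re (sform (schur K k) N c c) = Re (sform K M ?d ?d)" .
    moreover have "0 \<le> Re (sform K M ?d ?d)" using K unfolding pd_kernel_iff by blast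
    ultimately show ?thesis by linarith
  qed
  show ?thesis unfolding pd_kernel_iff using im re by simp
qed

text \<open>Membership in the reproducing kernel space with squared norm at most \<open>C\<close>,
  expressed before any norm exists: the functional given by \<open>f\<close> on finite combinations
  is bounded in the seminorm of \<open>K\<close>.\<close>

definition kernel_bdd :: "(nat \<Rightarrow> nat \<Rightarrow> complex) \<Rightarrow> (nat \<Rightarrow> complex) \<Rightarrow> real \<Rightarrow> bool" where
  "kernel_bdd K f C \<longleftrightarrow> 0 \<le> C \<and> (\<forall>N c. (cmod (\<Sum>i<N. cnj (c i) * f i))\<^sup>2 \<le> C * Re (sform K N c c))"

lemma kernel_bddD:
  "kernel_bdd K f C \<Longrightarrow> (cmod (\<Sum>i<N. cnj (c i) * f i))\<^sup>2 \<le> C * Re (sform K N c c)"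
  unfolding kernel_bdd_def by blast

lemma kernel_bdd_pointwise:
  assumes "kernel_bdd K f C" shows "(cmod (f k))\<^sup>2 \<le> C * Re (K k k)"
proof -
  have "(cmod (\<Sum>i<Suc k. cnj (unitv k i) * f i))\<^sup>2 \<le> C * Re (sform K (Suc k) (unitv k) (unitv k))"
    using assms unfolding kernel_bdd_def by blast
  then show ?thesis using sum_unitv(2)[of k "Suc k" f] sform_unitv[of k "Suc k" k K] by simp
qed

text \<open>Pythagoras: removing the component along vector \<open>k\<close> lowers the squared norm
  by the squared length of that component. The bound for \<open>f\<close> is applied to
  \<open>c + (a + m) \<delta>\<^sub>k\<close> with \<open>m\<close> free, and optimising over
  \<open>m\<close> extracts the gain.\<close>

lemma kernel_bdd_schur:
  assumes K: "pd_kernel K" and b: "kernel_bdd K f C"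
  shows "kernel_bdd (schur K k) (schurf K k f) (C - (cmod (f k))\<^sup>2 / Re (K k k))"
proof (cases "K k k = 0")
  case True
  then have "schur K k = K" "schurf K k f = f" by (auto simp: schur_def schurf_def fun_eq_iff)
  then show ?thesis using b True by simp
next
  case False
  let ?r = "Re (K k k)" and ?B = "cmod (f k)"
  have kk: "K k k = complex_of_real ?r" by (rule pd_kernel_diag_real[OF K])
  then have r: "0 < ?r" using False pd_kernel_diag[OF K, of k] by (metis less_eq_real_def of_real_0)
  have C: "?B\<^sup>2 / ?r \<le> C"
    using kernel_bdd_pointwise[OF b, of k] r by (simp add: field_simps)
  have main: "(cmod (\<Sum>i<N. cnj (c i) * schurf K k f i))\<^sup>2 \<le> (C - ?B\<^sup>2 / ?r) * Re (sform (schur K k) N c c)"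
    if k: "k < N" for N c
  proof -
    define s where "s = sform K N (unitv k) c"
    define a where "a = - s / K k k"
    define l where "l = (\<Sum>i<N. cnj (c i) * schurf K k f i)"
    define q where "q = Re (sform (schur K k) N c c)"
    have q0: "0 \<le> q" using pd_kernel_schur[OF K, of k] unfolding q_def pd_kernel_iff by blast
    have cs: "cnj s = (\<Sum>i<N. cnj (c i) * K i k)"
      unfolding s_def using sform_herm[OF K, of N c "unitv k"] sform_unitv_right[OF k] by simp
    have l1: "l = (\<Sum>i<N. cnj (c i) * f i) - cnj s * f k / K k k"
      unfolding l_def schurf_def cs by (simp add: algebra_simps sum_subtractf sum_divide_distrib sum_distrib_left)
    have ca: "cnj a = - cnj s / K k k" unfolding a_def by (subst (2) kk, subst kk) simp
    have l2: "(\<Sum>i<N. cnj (c i + (a + m) * unitv k i) * f i) = l + cnj m * f k" for m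
    proof -
      have "(\<Sum>i<N. cnj (c i + (a + m) * unitv k i) * f i)
        = (\<Sum>i<N. cnj (c i) * f i) + cnj (a + m) * (\<Sum>i<N. cnj (unitv k i) * f i)"
        by (simp add: algebra_simps sum.distrib sum_distrib_left)
      then show ?thesis unfolding sum_unitv(2)[OF k] l1 using ca by (simp add: algebra_simps)
    qed
    have ineq: "(cmod (l + cnj m * f k))\<^sup>2 \<le> C * (q + (cmod m)\<^sup>2 * ?r)" for m
    proof -
      have "(cmod (\<Sum>i<N. cnj (c i + (a + m) * unitv k i) * f i))\<^sup>2
        \<le> C * Re (sform K N (\<lambda>i. c i + (a + m) * unitv k i) (\<lambda>i. c i + (a + m) * unitv k i))"
        by (rule kernel_bddD[OF b])
      then show ?thesis unfolding l2 unfolding a_def s_def q_def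
        using sform_schur[OF K k, of c m] False by simp
    qed
    have "(cmod l)\<^sup>2 \<le> (C - ?B\<^sup>2 / ?r) * q"
    proof (cases "l = 0")
      case True
      then show ?thesis using C q0 by simp
    next
      case False
      then have A: "0 < (cmod l)\<^sup>2" by simp
      \<comment> \<open>The optimal choice: \<open>l + cnj m * f k\<close> becomes
        \<open>(1 + t) * l\<close>, and the square of \<open>cmod m\<close> times the pivot becomes
        \<open>q * t\<close>, so a factor \<open>1 + t\<close> cancels.\<close>
      define t where "t = ?B\<^sup>2 * q / (?r * (cmod l)\<^sup>2)"
      have t0: "0 \<le> t" unfolding t_def using r q0 by simp
      define m where "m = cnj (l * cnj (f k) * complex_of_real (q / (?r * (cmod l)\<^sup>2)))"
      have "cnj m * f k = l * (f k * cnj (f k)) * complex_of_real (q / (?r * (cmod l)\<^sup>2))"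
        unfolding m_def by simp
      also have "f k * cnj (f k) = complex_of_real (?B\<^sup>2)" by (simp add: mult_cnj_cmod)
      finally have e1: "l + cnj m * f k = l * complex_of_real (1 + t)" by (simp add: t_def algebra_simps)
      have "cmod m = cmod l * ?B * (q / (?r * (cmod l)\<^sup>2))"
        unfolding m_def using q0 r by (simp add: norm_mult norm_divide norm_power)
      then have "(cmod m)\<^sup>2 * ?r = (cmod l)\<^sup>2 * ?B\<^sup>2 * (q / (?r * (cmod l)\<^sup>2))\<^sup>2 * ?r"
        by (simp only: power_mult_distrib)
      also have "\<dots> = q * t" unfolding t_def using r A by (simp add: power2_eq_square field_simps)
      finally have "(cmod (l * complex_of_real (1 + t)))\<^sup>2 \<le> C * (q * (1 + t))"
        using ineq[of m] unfolding e1 by (simp add: algebra_simps)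
      then have "(cmod l)\<^sup>2 * (1 + t)\<^sup>2 \<le> C * q * (1 + t)"
        using t0 by (simp add: norm_mult power_mult_distrib mult_ac del: of_real_add)
      then have "((cmod l)\<^sup>2 * (1 + t)) * (1 + t) \<le> (C * q) * (1 + t)" by (simp add: power2_eq_square mult_ac)
      then have "(cmod l)\<^sup>2 * (1 + t) \<le> C * q" 
        by (rule mult_right_le_imp_le) (use t0 in linarith)
      moreover have "(cmod l)\<^sup>2 * t = ?B\<^sup>2 / ?r * q" unfolding t_def using r A by (simp add: field_simps)
      ultimately show ?thesis by (simp add: algebra_simps)
    qed
    then show ?thesis unfolding l_def q_def .
  qed
  have "(cmod (\<Sum>i<N. cnj (c i) * schurf K k f i))\<^sup>2 \<le> (C - ?B\<^sup>2 / ?r) * Re (sform (schur K k) N c c)" for N c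
  proof -
    define M where "M = Suc (max N k)"
    define d where "d i = (if i < N then c i else 0)" for i
    have M: "k < M" "N \<le> M" by (auto simp: M_def)
    have "(\<Sum>i<N. cnj (c i) * schurf K k f i) = (\<Sum>i<M. cnj (d i) * schurf K k f i)"
      using M(2) by (intro sum.mono_neutral_cong_left) (auto simp: d_def)
    moreover have "sform (schur K k) N c c = sform (schur K k) M d d"
      unfolding d_def by (subst sform_extend[OF M(2)]) (rule refl)
    ultimately show ?thesis using main[OF M(1), of d] by simp
  qed
  then show ?thesis unfolding kernel_bdd_def using C by simp
qed


section \<open>Gram-Schmidt elimination of all vectors in turn\<close>

primrec kern_n :: "(nat \<Rightarrow> nat \<Rightarrow> complex) \<Rightarrow> nat \<Rightarrow> nat \<Rightarrow> nat \<Rightarrow> complex" where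
  "kern_n K 0 = K"
| "kern_n K (Suc k) = schur (kern_n K k) k"

primrec vec_n :: "(nat \<Rightarrow> nat \<Rightarrow> complex) \<Rightarrow> (nat \<Rightarrow> complex) \<Rightarrow> nat \<Rightarrow> nat \<Rightarrow> complex" where
  "vec_n K f 0 = f"
| "vec_n K f (Suc k) = schurf (kern_n K k) k (vec_n K f k)"

text \<open>Gram--Schmidt without dividing by vanishing pivots: if \<open>pivot K k = 0\<close>, the division below
  yields \<open>0\<close>, which is the right value.\<close>

definition pivot :: "(nat \<Rightarrow> nat \<Rightarrow> complex) \<Rightarrow> nat \<Rightarrow> real" where
  "pivot K k = sqrt (Re (kern_n K k k k))"

definition coord :: "(nat \<Rightarrow> nat \<Rightarrow> complex) \<Rightarrow> (nat \<Rightarrow> complex) \<Rightarrow> nat \<Rightarrow> complex" where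
  "coord K f k = vec_n K f k k / complex_of_real (pivot K k)"

text \<open>Column \<open>k\<close> of the Cholesky factor of \<open>K\<close>; as a function it is
  the \<open>k\<close>-th Gram-Schmidt vector, and zero if the pivot vanishes.\<close>

definition onv :: "(nat \<Rightarrow> nat \<Rightarrow> complex) \<Rightarrow> nat \<Rightarrow> nat \<Rightarrow> complex" where
  "onv K k i = kern_n K k i k / complex_of_real (pivot K k)"

lemma pd_kern_n: "pd_kernel K \<Longrightarrow> pd_kernel (kern_n K k)"
  by (induction k) (auto intro: pd_kernel_schur)

text \<open>An eliminated row stays zero in later steps; at a zero pivot it is zero already by
  \<open>pd_kernel_zero\<close>.\<close>

lemma kern_n_zero:
  assumes K: "pd_kernel K"
  shows "i < k \<Longrightarrow> kern_n K k i j = 0 \<and> kern_n K k j i = 0"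
proof (induction k arbitrary: j)
  case (Suc k)
  show ?case
  proof (cases "i = k")
    case True
    then show ?thesis using pd_kernel_zero[OF pd_kern_n[OF K, of k], of k]
      by (cases "kern_n K k k k = 0") (auto simp: schur_def)
  next
    case False
    then show ?thesis using Suc.IH[of j] Suc.IH[of k] Suc.prems by (simp add: schur_def)
  qed
qed simp

lemma pivot_sq:
  assumes K: "pd_kernel K"
  shows "complex_of_real (pivot K k) * complex_of_real (pivot K k) = kern_n K k k k"
    "(pivot K k)\<^sup>2 = Re (kern_n K k k k)"
  using pd_kernel_diag[OF pd_kern_n[OF K, of k], of k] pd_kernel_diag_real[OF pd_kern_n[OF K, of k], of k]
  unfolding pivot_def by (simp_all add: of_real_mult[symmetric] del: of_real_mult)

lemma onv_prod:
  assumes K: "pd_kernel K"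
  shows "kern_n K k i k * kern_n K k k j / kern_n K k k k = onv K k i * cnj (onv K k j)"
    "kern_n K k i k * vec_n K f k k / kern_n K k k k = coord K f k * onv K k i"
  unfolding onv_def coord_def pivot_sq(1)[OF K, of k, symmetric]
  by (simp_all add: pd_kernel_herm[OF pd_kern_n[OF K], of k k j])

lemma kern_n_eq:
  assumes K: "pd_kernel K"
  shows "kern_n K m i j = K i j - (\<Sum>k<m. onv K k i * cnj (onv K k j))"
  by (induction m) (simp_all add: schur_def onv_prod[OF K])

lemma vec_n_eq:
  assumes K: "pd_kernel K"
  shows "vec_n K f m i = f i - (\<Sum>k<m. coord K f k * onv K k i)"
  by (induction m) (simp_all add: schurf_def onv_prod[OF K])

lemma kernel_bdd_n:
  assumes K: "pd_kernel K" and b: "kernel_bdd K f C"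
  shows "kernel_bdd (kern_n K m) (vec_n K f m) (C - (\<Sum>k<m. (cmod (coord K f k))\<^sup>2))"
proof (induction m)
  case (Suc m)
  have "(cmod (coord K f m))\<^sup>2 = (cmod (vec_n K f m m))\<^sup>2 / Re (kern_n K m m m)"
    unfolding coord_def by (simp add: norm_divide power_divide pivot_sq(2)[OF K])
  then show ?case using kernel_bdd_schur[OF pd_kern_n[OF K] Suc, of m] by (simp add: algebra_simps)
qed (use b in simp)

lemma sform_kern_n:
  assumes K: "pd_kernel K"
  shows "Re (sform (kern_n K m) N c c) = Re (sform K N c c) - (\<Sum>k<m. (cmod (\<Sum>i<N. cnj (c i) * onv K k i))\<^sup>2)"
proof -
  let ?u = "\<lambda>k. \<Sum>i<N. cnj (c i) * onv K k i"
  have "sform (kern_n K m) N c c = sform K N c c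
      - (\<Sum>i<N. \<Sum>j<N. \<Sum>k<m. (cnj (c i) * onv K k i) * (cnj (onv K k j) * c j))"
    unfolding sform_def kern_n_eq[OF K]
    by (simp add: algebra_simps sum_subtractf sum_distrib_left)
  also have "(\<Sum>i<N. \<Sum>j<N. \<Sum>k<m. (cnj (c i) * onv K k i) * (cnj (onv K k j) * c j))
    = (\<Sum>k<m. \<Sum>i<N. \<Sum>j<N. (cnj (c i) * onv K k i) * (cnj (onv K k j) * c j))"
  proof -
    have "(\<Sum>i<N. \<Sum>j<N. \<Sum>k<m. (cnj (c i) * onv K k i) * (cnj (onv K k j) * c j))
      = (\<Sum>i<N. \<Sum>k<m. \<Sum>j<N. (cnj (c i) * onv K k i) * (cnj (onv K k j) * c j))"
      by (intro sum.cong refl sum.swap)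
    also have "\<dots> = (\<Sum>k<m. \<Sum>i<N. \<Sum>j<N. (cnj (c i) * onv K k i) * (cnj (onv K k j) * c j))"
      by (rule sum.swap)
    finally show ?thesis .
  qed
  also have "\<dots> = (\<Sum>k<m. ?u k * cnj (?u k))"
  proof -
    have "cnj (?u k) = (\<Sum>j<N. cnj (onv K k j) * c j)" for k by (simp add: mult.commute)
    then show ?thesis by (simp only: sum_product)
  qed
  also have "\<dots> = complex_of_real (\<Sum>k<m. (cmod (?u k))\<^sup>2)"
    unfolding mult_cnj_cmod by simp
  finally show ?thesis by simp
qed

lemma sform_kern_n_le:
  "pd_kernel K \<Longrightarrow> Re (sform (kern_n K m) N c c) \<le> Re (sform K N c c)"
  unfolding sform_kern_n by (simp add: sum_nonneg)

lemma kernel_bdd_kern_n: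
  assumes K: "pd_kernel K" and b: "kernel_bdd (kern_n K m) f C"
  shows "kernel_bdd K f C"
  unfolding kernel_bdd_def
proof (intro conjI allI)
  show C: "0 \<le> C" using b unfolding kernel_bdd_def by simp
  show "(cmod (\<Sum>i<N. cnj (c i) * f i))\<^sup>2 \<le> C * Re (sform K N c c)" for N c
    using kernel_bddD[OF b, of c N] mult_left_mono[OF sform_kern_n_le[OF K, of m N c] C] by linarith
qed

text \<open>No limit is involved: after \<open>m\<close> steps the remaining kernel vanishes on the
  diagonal below \<open>m\<close>, and a function bounded by it must vanish there as well.\<close>

lemma kernel_expand:
  assumes K: "pd_kernel K" and b: "kernel_bdd K f C" and i: "i < m"
  shows "f i = (\<Sum>k<m. coord K f k * onv K k i)"
proof -
  have "vec_n K f m i = 0"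
    using kernel_bdd_pointwise[OF kernel_bdd_n[OF K b, of m], of i] kern_n_zero[OF K i, of i] by simp
  then show ?thesis using vec_n_eq[OF K, of f m i] by simp
qed

section \<open>Norm and inner product in Gram-Schmidt coordinates\<close>

definition nsq :: "(nat \<Rightarrow> nat \<Rightarrow> complex) \<Rightarrow> (nat \<Rightarrow> complex) \<Rightarrow> real" where
  "nsq K f = (\<Sum>k. (cmod (coord K f k))\<^sup>2)"

definition ip :: "(nat \<Rightarrow> nat \<Rightarrow> complex) \<Rightarrow> (nat \<Rightarrow> complex) \<Rightarrow> (nat \<Rightarrow> complex) \<Rightarrow> complex" where
  "ip K f g = (\<Sum>k. coord K f k * cnj (coord K g k))"

definition rk :: "(nat \<Rightarrow> nat \<Rightarrow> complex) \<Rightarrow> (nat \<Rightarrow> complex) set" where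
  "rk K = {f. \<exists>C. kernel_bdd K f C}"

lemma rkE: "f \<in> rk K \<Longrightarrow> (\<And>C. kernel_bdd K f C \<Longrightarrow> thesis) \<Longrightarrow> thesis"
  unfolding rk_def by blast

lemma sum_coord_le:
  assumes K: "pd_kernel K" and b: "kernel_bdd K f C"
  shows "(\<Sum>k<m. (cmod (coord K f k))\<^sup>2) \<le> C"
  using kernel_bdd_n[OF K b, of m] unfolding kernel_bdd_def by simp

lemma summable_coord:
  assumes K: "pd_kernel K" and f: "f \<in> rk K"
  shows "summable (\<lambda>k. (cmod (coord K f k))\<^sup>2)"
  using f by (elim rkE) (rule summableI_nonneg_bounded[OF _ sum_coord_le[OF K]], simp_all)

lemma nsq_le:
  assumes K: "pd_kernel K" and b: "kernel_bdd K f C"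
  shows "nsq K f \<le> C"
  unfolding nsq_def using summable_coord[OF K, of f] b sum_coord_le[OF K b]
  by (intro suminf_le_const) (auto simp: rk_def)

lemma nsq_nonneg: "pd_kernel K \<Longrightarrow> f \<in> rk K \<Longrightarrow> 0 \<le> nsq K f"
  unfolding nsq_def by (intro suminf_nonneg summable_coord) auto

text \<open>Cauchy-Schwarz in coordinates, combined with Bessel's inequality read off from
  \<open>sform_kern_n\<close>. Together with \<open>nsq_le\<close> it makes \<open>nsq K f\<close>
  the least constant in \<open>kernel_bdd\<close>, so norms can be estimated through finite
  combinations alone.\<close>

lemma kernel_bdd_nsq:
  assumes K: "pd_kernel K" and f: "f \<in> rk K"
  shows "kernel_bdd K f (nsq K f)"
  unfolding kernel_bdd_def
proof (intro conjI allI)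
  show "0 \<le> nsq K f" using nsq_nonneg[OF K f] .
  fix N c
  obtain C where b: "kernel_bdd K f C" using f by (rule rkE)
  let ?u = "\<lambda>k. \<Sum>i<N. cnj (c i) * onv K k i"
  have "(\<Sum>i<N. cnj (c i) * f i) = (\<Sum>i<N. \<Sum>k<N. coord K f k * (cnj (c i) * onv K k i))"
  proof (intro sum.cong refl)
    fix i assume "i \<in> {..<N}"
    then show "cnj (c i) * f i = (\<Sum>k<N. coord K f k * (cnj (c i) * onv K k i))"
      using kernel_expand[OF K b, of i N] by (simp add: sum_distrib_left mult_ac)
  qed
  also have "\<dots> = (\<Sum>k<N. coord K f k * ?u k)"
    by (subst sum.swap) (simp add: sum_distrib_left)
  finally have e: "(\<Sum>i<N. cnj (c i) * f i) = (\<Sum>k<N. coord K f k * ?u k)" .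
  have "cmod (\<Sum>k<N. coord K f k * ?u k) \<le> (\<Sum>k<N. cmod (coord K f k) * cmod (?u k))"
    using norm_sum[of "\<lambda>k. coord K f k * ?u k" "{..<N}"] by (simp add: norm_mult)
  then have "(cmod (\<Sum>k<N. coord K f k * ?u k))\<^sup>2 \<le> (\<Sum>k<N. cmod (coord K f k) * cmod (?u k))\<^sup>2"
    by (intro power_mono) auto
  also have "\<dots> \<le> (\<Sum>k<N. (cmod (coord K f k))\<^sup>2) * (\<Sum>k<N. (cmod (?u k))\<^sup>2)"
    by (rule Cauchy_Schwarz_ineq_sum)
  also have "\<dots> \<le> nsq K f * Re (sform K N c c)"
  proof (intro mult_mono)
    show "(\<Sum>k<N. (cmod (coord K f k))\<^sup>2) \<le> nsq K f"
      unfolding nsq_def by (intro sum_le_suminf summable_coord[OF K f]) auto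
    have "0 \<le> Re (sform (kern_n K N) N c c)" using pd_kern_n[OF K, of N] unfolding pd_kernel_iff by blast
    then show "(\<Sum>k<N. (cmod (?u k))\<^sup>2) \<le> Re (sform K N c c)" unfolding sform_kern_n[OF K] by simp
  qed (use nsq_nonneg[OF K f] in \<open>auto intro: sum_nonneg\<close>)
  finally show "(cmod (\<Sum>i<N. cnj (c i) * f i))\<^sup>2 \<le> nsq K f * Re (sform K N c c)" unfolding e .
qed

lemma kernel_bdd_add:
  assumes f: "kernel_bdd K f C" and g: "kernel_bdd K g D"
  shows "kernel_bdd K (\<lambda>i. f i + g i) (2 * (C + D))"
  unfolding kernel_bdd_def
proof (intro conjI allI)
  show "0 \<le> 2 * (C + D)" using f g unfolding kernel_bdd_def by simp
  fix N c
  have p: "(cmod (x + y))\<^sup>2 \<le> 2 * (cmod x)\<^sup>2 + 2 * (cmod y)\<^sup>2" for x y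
  proof -
    have "(cmod (x + y))\<^sup>2 \<le> (cmod x + cmod y)\<^sup>2" by (intro power_mono norm_triangle_ineq) simp
    also have "\<dots> \<le> 2 * (cmod x)\<^sup>2 + 2 * (cmod y)\<^sup>2" 
      using sum_squares_bound[of "cmod x" "cmod y"] by (simp add: power2_eq_square algebra_simps)
    finally show ?thesis .
  qed
  show "(cmod (\<Sum>i<N. cnj (c i) * (f i + g i)))\<^sup>2 \<le> 2 * (C + D) * Re (sform K N c c)"
    using p[of "\<Sum>i<N. cnj (c i) * f i" "\<Sum>i<N. cnj (c i) * g i"] kernel_bddD[OF f, of c N] kernel_bddD[OF g, of c N]
    by (simp add: algebra_simps sum.distrib)
qed

lemma kernel_bdd_scale:
  assumes f: "kernel_bdd K f C"
  shows "kernel_bdd K (\<lambda>i. a * f i) ((cmod a)\<^sup>2 * C)"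
  unfolding kernel_bdd_def
proof (intro conjI allI)
  show "0 \<le> (cmod a)\<^sup>2 * C" using f unfolding kernel_bdd_def by simp
  fix N c
  have "(\<Sum>i<N. cnj (c i) * (a * f i)) = a * (\<Sum>i<N. cnj (c i) * f i)"
    by (simp add: sum_distrib_left mult_ac)
  then show "(cmod (\<Sum>i<N. cnj (c i) * (a * f i)))\<^sup>2 \<le> (cmod a)\<^sup>2 * C * Re (sform K N c c)"
    using mult_left_mono[OF kernel_bddD[OF f, of c N], of "(cmod a)\<^sup>2"]
    by (simp add: norm_mult power_mult_distrib mult.assoc)
qed

lemma rk_add: "f \<in> rk K \<Longrightarrow> g \<in> rk K \<Longrightarrow> (\<lambda>i. f i + g i) \<in> rk K"
  unfolding rk_def using kernel_bdd_add by blast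

lemma rk_scale: "f \<in> rk K \<Longrightarrow> (\<lambda>i. a * f i) \<in> rk K"
  unfolding rk_def using kernel_bdd_scale by blast

lemma rk_diff: "f \<in> rk K \<Longrightarrow> g \<in> rk K \<Longrightarrow> (\<lambda>i. f i - g i) \<in> rk K"
  using rk_add[OF _ rk_scale[of g K "-1"], of f] by simp

lemma rk_uminus: "f \<in> rk K \<Longrightarrow> (\<lambda>i. - f i) \<in> rk K"
  using rk_scale[of f K "-1"] by simp

lemma rk_zero: "pd_kernel K \<Longrightarrow> (\<lambda>i. 0) \<in> rk K"
  unfolding rk_def kernel_bdd_def by (auto intro!: exI[of _ 0])

lemma rk_sum: "pd_kernel K \<Longrightarrow> (\<And>k. k < m \<Longrightarrow> f k \<in> rk K) \<Longrightarrow> (\<lambda>i. \<Sum>k<m. a k * f k i) \<in> rk K"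
  for m :: nat
  by (induction m) (auto intro!: rk_zero rk_add rk_scale)

lemma vec_n_add: "vec_n K (\<lambda>i. f i + g i) m = (\<lambda>i. vec_n K f m i + vec_n K g m i)"
  by (induction m) (auto simp: schurf_def fun_eq_iff algebra_simps add_divide_distrib)

lemma vec_n_scale: "vec_n K (\<lambda>i. a * f i) m = (\<lambda>i. a * vec_n K f m i)"
  by (induction m) (auto simp: schurf_def fun_eq_iff algebra_simps)

lemma coord_add: "coord K (\<lambda>i. f i + g i) k = coord K f k + coord K g k"
  by (simp add: coord_def vec_n_add add_divide_distrib)

lemma coord_scale: "coord K (\<lambda>i. a * f i) k = a * coord K f k"
  by (simp add: coord_def vec_n_scale)

lemma summable_ip:
  assumes K: "pd_kernel K" and f: "f \<in> rk K" and g: "g \<in> rk K"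
  shows "summable (\<lambda>k. coord K f k * cnj (coord K g k))"
proof (rule summable_comparison_test')
  show "summable (\<lambda>k. (cmod (coord K f k))\<^sup>2 + (cmod (coord K g k))\<^sup>2)"
    by (intro summable_add summable_coord K f g)
  show "norm (coord K f n * cnj (coord K g n)) \<le> (cmod (coord K f n))\<^sup>2 + (cmod (coord K g n))\<^sup>2" for n
  proof -
    have "0 \<le> cmod (coord K f n) * cmod (coord K g n)" by simp
    then show ?thesis using sum_squares_bound[of "cmod (coord K f n)" "cmod (coord K g n)"]
      unfolding norm_mult complex_mod_cnj by linarith
  qed
qed

lemma ip_add:
  assumes K: "pd_kernel K" and f: "f \<in> rk K" "g \<in> rk K" "h \<in> rk K"
  shows "ip K (\<lambda>i. f i + g i) h = ip K f h + ip K g h"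
  unfolding ip_def coord_add using f
  by (subst suminf_add) (auto intro!: summable_ip[OF K] simp: algebra_simps)

lemma ip_scale:
  assumes K: "pd_kernel K" and f: "f \<in> rk K" "g \<in> rk K"
  shows "ip K (\<lambda>i. a * f i) g = a * ip K f g"
  unfolding ip_def coord_scale using suminf_mult[OF summable_ip[OF K f], of a] by (simp add: mult.assoc)

lemma ip_cnj:
  assumes K: "pd_kernel K" and f: "f \<in> rk K" "g \<in> rk K"
  shows "ip K g f = cnj (ip K f g)"
  unfolding ip_def
  using sums_unique[OF sums_cnj[THEN iffD2, OF summable_sums[OF summable_ip[OF K f]]]]
  by (simp add: mult.commute)

lemma ip_self:
  assumes K: "pd_kernel K" and f: "f \<in> rk K"
  shows "ip K f f = complex_of_real (nsq K f)"
  unfolding ip_def nsq_def mult_cnj_cmod by (rule suminf_of_real[OF summable_coord[OF K f], symmetric])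

lemma nsq_add:
  assumes K: "pd_kernel K" and f: "f \<in> rk K" and g: "g \<in> rk K"
  shows "nsq K (\<lambda>i. f i + g i) = nsq K f + nsq K g + 2 * Re (ip K f g)"
proof -
  have "ip K (\<lambda>i. f i + g i) (\<lambda>i. f i + g i) = ip K f f + ip K g g + (ip K f g + cnj (ip K f g))"
    using ip_cnj[OF K rk_add[OF f g] f] ip_cnj[OF K rk_add[OF f g] g] ip_cnj[OF K f g]
      ip_cnj[OF K f f] ip_cnj[OF K g g]
    by (simp add: ip_add[OF K f g] f g rk_add[OF f g])
  also have "ip K f g + cnj (ip K f g) = complex_of_real (2 * Re (ip K f g))" by (simp add: complex_eq_iff)
  finally show ?thesis using ip_self[OF K] f g rk_add[OF f g]
    by (metis (mono_tags, lifting) of_real_add of_real_eq_iff)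
qed

lemma nsq_scale:
  assumes K: "pd_kernel K" and f: "f \<in> rk K"
  shows "nsq K (\<lambda>i. a * f i) = (cmod a)\<^sup>2 * nsq K f"
  unfolding nsq_def coord_scale using suminf_mult[OF summable_coord[OF K f], of "(cmod a)\<^sup>2"]
  by (simp add: norm_mult power_mult_distrib)

lemma nsq_pointwise:
  "pd_kernel K \<Longrightarrow> f \<in> rk K \<Longrightarrow> (cmod (f i))\<^sup>2 \<le> nsq K f * Re (K i i)"
  by (rule kernel_bdd_pointwise[OF kernel_bdd_nsq])

lemma onv_rk:
  assumes K: "pd_kernel K" shows "onv K k \<in> rk K"
proof -
  have "(cmod (\<Sum>i<N. cnj (c i) * onv K k i))\<^sup>2 \<le> Re (sform K N c c)" for N c
  proof -
    have "(cmod (\<Sum>i<N. cnj (c i) * onv K k i))\<^sup>2 \<le> (\<Sum>k<Suc k. (cmod (\<Sum>i<N. cnj (c i) * onv K k i))\<^sup>2)"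
      by (rule member_le_sum[of k "{..<Suc k}" "\<lambda>k. (cmod (\<Sum>i<N. cnj (c i) * onv K k i))\<^sup>2"]) auto
    moreover have "0 \<le> Re (sform (kern_n K (Suc k)) N c c)"
      using pd_kern_n[OF K, of "Suc k"] unfolding pd_kernel_iff by blast
    ultimately show ?thesis unfolding sform_kern_n[OF K] by linarith
  qed
  then have "kernel_bdd K (onv K k) 1" unfolding kernel_bdd_def by simp
  then show ?thesis unfolding rk_def by blast
qed

lemma vec_n_col: "vec_n K (\<lambda>i. K i j) m = (\<lambda>i. kern_n K m i j)"
  by (induction m) (auto simp: schurf_def schur_def fun_eq_iff)

lemma coord_col: "pd_kernel K \<Longrightarrow> coord K (\<lambda>i. K i j) k = cnj (onv K k j)"
  by (simp add: coord_def vec_n_col onv_def pd_kernel_herm[OF pd_kern_n, of K k k j])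

lemma col_rk:
  assumes K: "pd_kernel K" shows "(\<lambda>i. K i j) \<in> rk K"
proof -
  have "K i j = (\<Sum>k<Suc j. cnj (onv K k j) * onv K k i)" for i
    using kern_n_eq[OF K, of "Suc j" i j] kern_n_zero[OF K, of j "Suc j" i] by (simp add: mult.commute)
  then have "(\<lambda>i. K i j) = (\<lambda>i. \<Sum>k<Suc j. cnj (onv K k j) * onv K k i)" by blast
  then show ?thesis using rk_sum[OF K, of "Suc j" "onv K" "\<lambda>k. cnj (onv K k j)"] onv_rk[OF K] by simp
qed

lemma ip_col:
  assumes K: "pd_kernel K" and f: "f \<in> rk K"
  shows "ip K f (\<lambda>i. K i j) = f j"
proof -
  obtain C where b: "kernel_bdd K f C" using f by (rule rkE)
  have "ip K f (\<lambda>i. K i j) = (\<Sum>k. coord K f k * onv K k j)"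
    unfolding ip_def coord_col[OF K] by simp
  \<comment> \<open>\<open>onv K k\<close> vanishes at all indices below \<open>k\<close>, so the
    series breaks off.\<close>
  also have "\<dots> = (\<Sum>k<Suc j. coord K f k * onv K k j)"
    by (rule suminf_finite) (auto simp: onv_def kern_n_zero[OF K])
  also have "\<dots> = f j" using kernel_expand[OF K b, of j "Suc j"] by simp
  finally show ?thesis .
qed

lemma nsq_col:
  assumes K: "pd_kernel K" shows "nsq K (\<lambda>i. K i j) = Re (K j j)"
  using ip_self[OF K col_rk[OF K], of j] ip_col[OF K col_rk[OF K], of j j] by simp

text \<open>Each instance of the bound involves finitely many values of the function, so pointwise
  convergence is enough.\<close>

lemma kernel_bdd_limit:
  assumes lim: "\<And>i. (\<lambda>n. g n i) \<longlonglongrightarrow> f i" and b: "\<And>n. s \<le> n \<Longrightarrow> kernel_bdd K (g n) C"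
  shows "kernel_bdd K f C"
  unfolding kernel_bdd_def
proof (intro conjI allI)
  show "0 \<le> C" using b[of s] unfolding kernel_bdd_def by simp
  fix N c
  have "(\<lambda>n. (cmod (\<Sum>i<N. cnj (c i) * g n i))\<^sup>2) \<longlonglongrightarrow> (cmod (\<Sum>i<N. cnj (c i) * f i))\<^sup>2"
    by (intro tendsto_intros lim)
  then show "(cmod (\<Sum>i<N. cnj (c i) * f i))\<^sup>2 \<le> C * Re (sform K N c c)"
    by (rule LIMSEQ_le_const2) (use kernel_bddD[OF b] in blast)
qed

text \<open>By \<open>nsq_pointwise\<close>, norm-Cauchy implies pointwise Cauchy. The pointwise
  limit is compared with the sequence through \<open>kernel_bdd\<close>, which passes to pointwise
  limits, so no infinite sum is interchanged with the limit.\<close>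

lemma rk_complete:
  assumes K: "pd_kernel K" and g: "\<And>n. g n \<in> rk K"
    and cauchy: "\<And>e. 0 < e \<Longrightarrow> \<exists>N0. \<forall>m\<ge>N0. \<forall>n\<ge>N0. nsq K (\<lambda>i. g m i - g n i) < e"
  shows "\<exists>f\<in>rk K. (\<lambda>n. nsq K (\<lambda>i. g n i - f i)) \<longlonglongrightarrow> 0"
proof -
  have "Cauchy (\<lambda>n. g n i)" for i
  proof (rule CauchyI)
    fix e :: real assume e: "0 < e"
    let ?r = "Re (K i i)"
    have r: "0 \<le> ?r" using pd_kernel_diag[OF K] by blast
    obtain N0 where N0: "\<And>m n. N0 \<le> m \<Longrightarrow> N0 \<le> n \<Longrightarrow> nsq K (\<lambda>i. g m i - g n i) < e\<^sup>2 / (?r + 1)"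
      using cauchy[of "e\<^sup>2 / (?r + 1)"] e r by auto
    have "cmod (g m i - g n i) < e" if "N0 \<le> m" "N0 \<le> n" for m n
    proof -
      have "(cmod (g m i - g n i))\<^sup>2 \<le> nsq K (\<lambda>i. g m i - g n i) * ?r"
        by (rule nsq_pointwise[OF K rk_diff[OF g g]])
      also have "\<dots> \<le> e\<^sup>2 / (?r + 1) * ?r" using N0[OF that] r by (intro mult_right_mono) auto
      also have "\<dots> < e\<^sup>2" using e r by (simp add: field_simps)
      finally show ?thesis using e by (simp add: power2_less_imp_less)
    qed
    then show "\<exists>M. \<forall>m\<ge>M. \<forall>n\<ge>M. norm (g m i - g n i) < e" by blast
  qed
  then obtain f where f: "\<And>i. (\<lambda>n. g n i) \<longlonglongrightarrow> f i"
    unfolding Cauchy_convergent_iff convergent_def by metis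
  have ev: "\<exists>N0. \<forall>m\<ge>N0. kernel_bdd K (\<lambda>i. g m i - f i) e" if e: "0 < e" for e
  proof -
    obtain N0 where N0: "\<And>m n. N0 \<le> m \<Longrightarrow> N0 \<le> n \<Longrightarrow> nsq K (\<lambda>i. g m i - g n i) < e"
      using cauchy[OF e] by auto
    have "kernel_bdd K (\<lambda>i. g m i - f i) e" if "N0 \<le> m" for m
    proof (rule kernel_bdd_limit[where s = N0])
      show "(\<lambda>n. g m i - g n i) \<longlonglongrightarrow> g m i - f i" for i by (intro tendsto_intros f)
      show "kernel_bdd K (\<lambda>i. g m i - g n i) e" if n: "N0 \<le> n" for n
      proof -
        have b: "kernel_bdd K (\<lambda>i. g m i - g n i) (nsq K (\<lambda>i. g m i - g n i))"
          by (rule kernel_bdd_nsq[OF K rk_diff[OF g g]])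
        have "nsq K (\<lambda>i. g m i - g n i) * Re (sform K N c c) \<le> e * Re (sform K N c c)" for N c
          using N0[OF \<open>N0 \<le> m\<close> n] K unfolding pd_kernel_iff by (intro mult_right_mono) auto
        then show ?thesis using kernel_bddD[OF b] e unfolding kernel_bdd_def by (meson less_imp_le order_trans)
      qed
    qed
    then show ?thesis by blast
  qed
  obtain m where "kernel_bdd K (\<lambda>i. g m i - f i) 1" using ev[of 1] by auto
  then have "(\<lambda>i. g m i - f i) \<in> rk K" unfolding rk_def by blast
  from rk_diff[OF g[of m] this] have frk: "f \<in> rk K" by simp
  have "(\<lambda>n. nsq K (\<lambda>i. g n i - f i)) \<longlonglongrightarrow> 0"
  proof (rule LIMSEQ_I)
    fix e :: real assume e: "0 < e"
    obtain N0 where N0: "\<And>m. N0 \<le> m \<Longrightarrow> kernel_bdd K (\<lambda>i. g m i - f i) (e / 2)" using ev[of "e/2"] e by auto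
    have "norm (nsq K (\<lambda>i. g m i - f i) - 0) < e" if "N0 \<le> m" for m
      using nsq_le[OF K N0[OF that]] nsq_nonneg[OF K rk_diff[OF g frk], of m] e by simp
    then show "\<exists>N0. \<forall>n\<ge>N0. norm (nsq K (\<lambda>i. g n i - f i) - 0) < e" by blast
  qed
  then show ?thesis using frk by blast
qed

lemma nsq_eq_zero:
  assumes K: "pd_kernel K" and f: "f \<in> rk K" and z: "nsq K f = 0"
  shows "f = (\<lambda>i. 0)"
  using nsq_pointwise[OF K f] z by (auto simp: fun_eq_iff)

text \<open>The remainder is \<open>vec_n K f m\<close>. It is bounded with respect to
  \<open>kern_n K m\<close>, hence with respect to the larger form \<open>K\<close>, by the tail of
  a convergent series.\<close>

lemma nsq_tail:
  assumes K: "pd_kernel K" and f: "f \<in> rk K"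
  shows "(\<lambda>m. nsq K (\<lambda>i. f i - (\<Sum>k<m. coord K f k * onv K k i))) \<longlonglongrightarrow> 0"
proof (rule tendsto_sandwich)
  have s: "kernel_bdd K (\<lambda>i. f i - (\<Sum>k<m. coord K f k * onv K k i))
      (nsq K f - (\<Sum>k<m. (cmod (coord K f k))\<^sup>2))" for m
    using kernel_bdd_kern_n[OF K kernel_bdd_n[OF K kernel_bdd_nsq[OF K f], of m]]
    unfolding vec_n_eq[OF K, abs_def] .
  show "\<forall>\<^sub>F m in sequentially. 0 \<le> nsq K (\<lambda>i. f i - (\<Sum>k<m. coord K f k * onv K k i))"
    using s by (intro always_eventually allI nsq_nonneg K) (auto simp: rk_def)
  show "\<forall>\<^sub>F m in sequentially. nsq K (\<lambda>i. f i - (\<Sum>k<m. coord K f k * onv K k i))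
      \<le> nsq K f - (\<Sum>k<m. (cmod (coord K f k))\<^sup>2)"
    using s by (intro always_eventually allI nsq_le K)
  show "(\<lambda>m. nsq K f - (\<Sum>k<m. (cmod (coord K f k))\<^sup>2)) \<longlonglongrightarrow> 0"
    using tendsto_diff[OF tendsto_const summable_LIMSEQ[OF summable_coord[OF K f]], of "nsq K f"]
    by (simp add: nsq_def)
qed simp

section \<open>The reproducing kernel space as a Hilbert space\<close>

definition rkhs :: "(nat \<Rightarrow> nat \<Rightarrow> complex) \<Rightarrow> (nat \<Rightarrow> complex) hilbert" where
  "rkhs K = \<lparr>carrier = rk K, monoid.mult = (\<lambda>f g. f), one = (\<lambda>i. 0), zero = (\<lambda>i. 0),
     add = (\<lambda>f g i. f i + g i), smult = (\<lambda>a f i. a * f i), cinner = ip K\<rparr>"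

lemma rkhs_simps [simp]:
  "carrier (rkhs K) = rk K" "zero (rkhs K) = (\<lambda>i. 0)" "add (rkhs K) f g = (\<lambda>i. f i + g i)"
  "smult (rkhs K) a f = (\<lambda>i. a * f i)" "cinner (rkhs K) f g = ip K f g"
  by (simp_all add: rkhs_def)

lemma rkhs_abelian_group:
  assumes K: "pd_kernel K" shows "abelian_group (rkhs K)"
proof (rule abelian_groupI)
  show "\<exists>g\<in>carrier (rkhs K). g \<oplus>\<^bsub>rkhs K\<^esub> f = \<zero>\<^bsub>rkhs K\<^esub>" if "f \<in> carrier (rkhs K)" for f
    using that by (intro bexI[of _ "\<lambda>i. - f i"]) (simp_all add: rk_uminus)
qed (auto simp: rk_add rk_zero K algebra_simps)

lemma rkhs_minus:
  assumes K: "pd_kernel K" and f: "f \<in> rk K" and g: "g \<in> rk K"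
  shows "f \<ominus>\<^bsub>rkhs K\<^esub> g = (\<lambda>i. f i - g i)"
proof -
  interpret abelian_group "rkhs K" by (rule rkhs_abelian_group[OF K])
  have "\<ominus>\<^bsub>rkhs K\<^esub> g = (\<lambda>i. - g i)"
    by (rule minus_equality) (use g in \<open>simp_all add: rk_uminus\<close>)
  then show ?thesis by (simp add: a_minus_def)
qed

lemma hnorm_rkhs:
  assumes K: "pd_kernel K" and f: "f \<in> rk K"
  shows "hnorm (rkhs K) f = sqrt (nsq K f)"
  by (simp add: hnorm_def ip_self[OF K f])

lemma rkhs_finsum:
  fixes m :: nat
  assumes K: "pd_kernel K" and f: "\<And>k. f k \<in> rk K"
  shows "(\<Oplus>\<^bsub>rkhs K\<^esub>k\<in>{..<m}. a k \<odot>\<^bsub>rkhs K\<^esub> f k) = (\<lambda>i. \<Sum>k<m. a k * f k i)"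
proof -
  interpret abelian_group "rkhs K" by (rule rkhs_abelian_group[OF K])
  show ?thesis
  proof (induction m)
    case (Suc m)
    have "(\<Oplus>\<^bsub>rkhs K\<^esub>k\<in>insert m {..<m}. a k \<odot>\<^bsub>rkhs K\<^esub> f k)
      = a m \<odot>\<^bsub>rkhs K\<^esub> f m \<oplus>\<^bsub>rkhs K\<^esub> (\<Oplus>\<^bsub>rkhs K\<^esub>k\<in>{..<m}. a k \<odot>\<^bsub>rkhs K\<^esub> f k)"
      by (rule finsum_insert) (use f in \<open>auto simp: rk_scale\<close>)
    then show ?case using Suc by (simp add: lessThan_Suc add.commute)
  qed simp
qed

lemma rkhs_complex_hilbert_space:
  assumes K: "pd_kernel K" shows "complex_hilbert_space (rkhs K)"
proof -
  interpret M: Module.module "ring_of_type_algebra :: complex ring" "rkhs K"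
    by (rule moduleI[OF cring_from_type_algebra rkhs_abelian_group[OF K]])
      (auto simp: rk_scale ring_of_type_algebra_def algebra_simps)
  show ?thesis
  proof
    show "\<exists>l\<in>carrier (rkhs K). (\<lambda>n. hnorm (rkhs K) (f n \<ominus>\<^bsub>rkhs K\<^esub> l)) \<longlonglongrightarrow> 0"
      if r: "range f \<subseteq> carrier (rkhs K)" and
        c: "\<And>e. 0 < e \<Longrightarrow> \<exists>N. \<forall>m\<ge>N. \<forall>n\<ge>N. hnorm (rkhs K) (f m \<ominus>\<^bsub>rkhs K\<^esub> f n) < e" for f
    proof -
      have f: "f n \<in> rk K" for n using r by auto
      have h: "hnorm (rkhs K) (f m \<ominus>\<^bsub>rkhs K\<^esub> g) = sqrt (nsq K (\<lambda>i. f m i - g i))" if "g \<in> rk K" for m g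
        using that f by (simp add: rkhs_minus[OF K] hnorm_rkhs[OF K rk_diff])
      have "\<exists>N0. \<forall>m\<ge>N0. \<forall>n\<ge>N0. nsq K (\<lambda>i. f m i - f n i) < e" if e: "0 < e" for e
        using c[of "sqrt e"] e unfolding h[OF f] by simp
      then have "\<exists>l\<in>rk K. (\<lambda>n. nsq K (\<lambda>i. f n i - l i)) \<longlonglongrightarrow> 0"
        by (rule rk_complete[of K f, OF K f])
      then obtain l where l: "l \<in> rk K" "(\<lambda>n. nsq K (\<lambda>i. f n i - l i)) \<longlonglongrightarrow> 0"
        by blast
      then have "(\<lambda>n. hnorm (rkhs K) (f n \<ominus>\<^bsub>rkhs K\<^esub> l)) \<longlonglongrightarrow> 0"
        unfolding h[OF l(1)] using tendsto_real_sqrt[OF l(2)] by simp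
      then show ?thesis using l(1) by auto
    qed
    show "cinner (rkhs K) v u = cnj (cinner (rkhs K) u v)"
      if "u \<in> carrier (rkhs K)" "v \<in> carrier (rkhs K)" for u v
      using that ip_cnj[OF K, of u v] by simp
    show "u = \<zero>\<^bsub>rkhs K\<^esub>" if "u \<in> carrier (rkhs K)" "cinner (rkhs K) u u = 0" for u
      using that nsq_eq_zero[OF K, of u] by (simp add: ip_self[OF K])
  qed (simp_all add: ip_add[OF K] ip_scale[OF K] ip_self[OF K] nsq_nonneg[OF K])
qed

lemma total_sequence_onv:
  assumes K: "pd_kernel K" shows "total_sequence (rkhs K) (onv K)"
  unfolding total_sequence_def
proof (intro ballI allI impI)
  fix v and e :: real assume v: "v \<in> carrier (rkhs K)" and e: "0 < e"
  then have vr: "v \<in> rk K" by simp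
  obtain m where m: "nsq K (\<lambda>i. v i - (\<Sum>k<m. coord K v k * onv K k i)) < e\<^sup>2"
    using order_tendstoD(2)[OF nsq_tail[OF K vr], of "e\<^sup>2"] e by (auto simp: eventually_sequentially)
  have s: "(\<lambda>i. \<Sum>k<m. coord K v k * onv K k i) \<in> rk K" by (intro rk_sum K onv_rk)
  have "hnorm (rkhs K) (v \<ominus>\<^bsub>rkhs K\<^esub> (\<Oplus>\<^bsub>rkhs K\<^esub>k\<in>{..<m}. coord K v k \<odot>\<^bsub>rkhs K\<^esub> onv K k)) < e"
    unfolding rkhs_finsum[OF K onv_rk[OF K]] rkhs_minus[OF K vr s] hnorm_rkhs[OF K rk_diff[OF vr s]]
    using m e by (simp add: real_sqrt_less_iff[of _ "e\<^sup>2", symmetric] del: real_sqrt_less_iff)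
  then show "\<exists>k c. hnorm (rkhs K) (v \<ominus>\<^bsub>rkhs K\<^esub> (\<Oplus>\<^bsub>rkhs K\<^esub>i\<in>{..<k}. c i \<odot>\<^bsub>rkhs K\<^esub> onv K i)) < e"
    by blast
qed

section \<open>Change of indices, repeated indices, and decay at infinity\<close>

lemma kernel_bdd_reindex:
  assumes b: "kernel_bdd K f C" and K: "\<And>i j. K (\<sigma> i) (\<sigma> j) = K' i j"
  shows "kernel_bdd K' (\<lambda>i. f (\<sigma> i)) C"
  unfolding kernel_bdd_def
proof (intro conjI allI)
  show "0 \<le> C" using b unfolding kernel_bdd_def by simp
  fix N and c :: "nat \<Rightarrow> complex"
  define M where "M = Suc (\<Sum>i<N. \<sigma> i)"
  have M: "\<sigma> i < M" if "i < N" for i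
    unfolding M_def using member_le_sum[of i "{..<N}" \<sigma>] that by (simp add: less_Suc_eq_le)
  \<comment> \<open>The push-forward of \<open>c\<close> along \<open>\<sigma>\<close>: coefficients
    of indices with the same image are added, so \<open>\<sigma>\<close> may repeat values.\<close>
  define d where "d l = (\<Sum>i<N. c i * unitv (\<sigma> i) l)" for l
  have push: "(\<Sum>l<M. (\<Sum>i<N. a i * unitv (\<sigma> i) l) * g l) = (\<Sum>i<N. a i * g (\<sigma> i))" for a g
  proof -
    have "(\<Sum>l<M. (\<Sum>i<N. a i * unitv (\<sigma> i) l) * g l) = (\<Sum>i<N. \<Sum>l<M. a i * (g l * unitv (\<sigma> i) l))"
      by (subst sum.swap) (simp add: sum_distrib_left sum_distrib_right mult_ac)
    then show ?thesis using M by (simp add: sum_distrib_left[symmetric] sum_unitv(1))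
  qed
  have cu: "cnj (unitv k l) = unitv k l" for k l by (simp add: unitv_def)
  have cd: "cnj (d l) = (\<Sum>i<N. cnj (c i) * unitv (\<sigma> i) l)" for l by (simp add: d_def cu)
  have 1: "(\<Sum>l<M. cnj (d l) * f l) = (\<Sum>i<N. cnj (c i) * f (\<sigma> i))"
    unfolding cd by (rule push)
  have "sform K M d d = (\<Sum>l<M. cnj (d l) * (\<Sum>m<M. d m * K l m))"
    by (simp add: sform_def sum_distrib_left mult_ac)
  also have "\<dots> = (\<Sum>i<N. cnj (c i) * (\<Sum>j<N. c j * K (\<sigma> i) (\<sigma> j)))"
    unfolding cd push unfolding d_def push ..
  also have "\<dots> = sform K' N c c" unfolding K by (simp add: sform_def sum_distrib_left mult_ac)
  finally show "(cmod (\<Sum>i<N. cnj (c i) * f (\<sigma> i)))\<^sup>2 \<le> C * Re (sform K' N c c)"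
    using kernel_bddD[OF b, of d M] unfolding 1 by simp
qed

text \<open>Reindexing along \<open>\<sigma>\<close> and along \<open>\<tau>\<close> does not
  increase norms, so both are isometries, and polarisation recovers the inner product. The inverse
  laws are asked for functions of the two spaces only: on indices the maps may fail to be inverse
  when a vector has several codes.\<close>

lemma rkhs_reindex_unitary:
  assumes K: "pd_kernel K" and K': "pd_kernel K'"
    and st: "\<And>i j. K (\<sigma> i) (\<sigma> j) = K' i j" "\<And>i j. K' (\<tau> i) (\<tau> j) = K i j"
    and inv: "\<And>f i. f \<in> rk K \<Longrightarrow> f (\<sigma> (\<tau> i)) = f i" "\<And>f i. f \<in> rk K' \<Longrightarrow> f (\<tau> (\<sigma> i)) = f i"
  shows "unitary (rkhs K) (rkhs K') (\<lambda>f i. f (\<sigma> i))"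
proof -
  have m1: "(\<lambda>i. f (\<sigma> i)) \<in> rk K'" if "f \<in> rk K" for f
    using that kernel_bdd_reindex[of K f _ \<sigma> K'] st(1) unfolding rk_def by blast
  have m2: "(\<lambda>i. f (\<tau> i)) \<in> rk K" if "f \<in> rk K'" for f
    using that kernel_bdd_reindex[of K' f _ \<tau> K] st(2) unfolding rk_def by blast
  have n: "nsq K' (\<lambda>i. f (\<sigma> i)) = nsq K f" if f: "f \<in> rk K" for f
  proof (rule antisym)
    show "nsq K' (\<lambda>i. f (\<sigma> i)) \<le> nsq K f"
      using nsq_le[OF K' kernel_bdd_reindex[OF kernel_bdd_nsq[OF K f], of \<sigma> K']] st(1) by blast
    have "nsq K (\<lambda>i. f (\<sigma> (\<tau> i))) \<le> nsq K' (\<lambda>i. f (\<sigma> i))"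
      using nsq_le[OF K kernel_bdd_reindex[OF kernel_bdd_nsq[OF K' m1[OF f]], of \<tau> K]] st(2) by blast
    then show "nsq K f \<le> nsq K' (\<lambda>i. f (\<sigma> i))" using inv(1)[OF f] by simp
  qed
  have re: "Re (ip K' (\<lambda>i. f (\<sigma> i)) (\<lambda>i. g (\<sigma> i))) = Re (ip K f g)" if "f \<in> rk K" "g \<in> rk K" for f g
    using nsq_add[OF K that] nsq_add[OF K' m1[OF that(1)] m1[OF that(2)]] n[OF rk_add[OF that]] n that by simp
  have ip: "ip K' (\<lambda>i. f (\<sigma> i)) (\<lambda>i. g (\<sigma> i)) = ip K f g" if fg: "f \<in> rk K" "g \<in> rk K" for f g
  proof (rule complex_eqI)
    show "Re (ip K' (\<lambda>i. f (\<sigma> i)) (\<lambda>i. g (\<sigma> i))) = Re (ip K f g)" by (rule re[OF fg])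
    \<comment> \<open>Multiplying by \<open>- \<i>\<close> turns an imaginary part into a real
      part.\<close>
    have "Re (ip K' (\<lambda>i. (- \<i>) * f (\<sigma> i)) (\<lambda>i. g (\<sigma> i))) = Re (ip K (\<lambda>i. (- \<i>) * f i) g)"
      by (rule re[OF rk_scale[OF fg(1)] fg(2)])
    then show "Im (ip K' (\<lambda>i. f (\<sigma> i)) (\<lambda>i. g (\<sigma> i))) = Im (ip K f g)"
      unfolding ip_scale[OF K fg] ip_scale[OF K' m1[OF fg(1)] m1[OF fg(2)]] by simp
  qed
  have "bij_betw (\<lambda>f i. f (\<sigma> i)) (rk K) (rk K')"
    by (rule bij_betw_byWitness[where f' = "\<lambda>f i. f (\<tau> i)"]) (use m1 m2 inv in \<open>auto simp: fun_eq_iff\<close>)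
  then show ?thesis unfolding unitary_def using ip by simp
qed

text \<open>The vectors coded by \<open>i\<close> and \<open>j\<close> coincide: the form is 0 at
  their difference, so the functional of \<open>f\<close> vanishes there. This deals with arrows
  that have several codes.\<close>

lemma rk_consistent:
  assumes f: "f \<in> rk K" and e: "K i i = K j j" "K i j = K j j" "K j i = K j j"
  shows "f i = f j"
proof (cases "i = j")
  case False
  obtain C where b: "kernel_bdd K f C" using f by (rule rkE)
  define N where "N = Suc (max i j)"
  have N: "i < N" "j < N" by (auto simp: N_def)
  define a :: complex where "a = - 1"
  let ?c = "\<lambda>l. unitv i l + a * unitv j l"
  have "sform K N ?c ?c = K i i + a * K i j + cnj a * K j i + cnj a * a * K j j"
    by (simp add: sform_add_left sform_add_right sform_scale_left sform_scale_right sform_unitv N algebra_simps)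
  then have "sform K N ?c ?c = 0" by (simp add: e a_def)
  then have "(\<Sum>l<N. cnj (?c l) * f l) = 0" using kernel_bddD[OF b, of ?c N] by simp
  moreover have "(\<Sum>l<N. cnj (?c l) * f l) = (\<Sum>l<N. cnj (unitv i l) * f l) - (\<Sum>l<N. cnj (unitv j l) * f l)"
    by (simp add: a_def algebra_simps sum_subtractf)
  ultimately show ?thesis using N by (simp add: sum_unitv(2))
qed simp

text \<open>The filter means infinity within \<open>I\<close>. Columns vanish along it, hence so do
  the Gram-Schmidt vectors and their finite combinations. As the diagonal on \<open>I\<close> is at
  most 1, these approximate \<open>f\<close> uniformly on \<open>I\<close>.\<close>

lemma rk_vanish:
  fixes I :: "nat set"
  defines "F \<equiv> inf cofinite (principal I)"
  assumes K: "pd_kernel K" and col: "\<And>j. ((\<lambda>i. K i j) \<longlongrightarrow> 0) F"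
    and diag: "\<And>i. i \<in> I \<Longrightarrow> Re (K i i) \<le> 1" and f: "f \<in> rk K"
  shows "(f \<longlongrightarrow> 0) F"
proof -
  have colm: "((\<lambda>i. kern_n K m i j) \<longlongrightarrow> 0) F" for m j
  proof (induction m arbitrary: j)
    case (Suc m)
    have "((\<lambda>i. kern_n K m i j - kern_n K m i m * (kern_n K m m j / kern_n K m m m)) \<longlongrightarrow> 0 - 0 * (kern_n K m m j / kern_n K m m m)) F"
      by (intro tendsto_intros Suc)
    then show ?case by (simp add: schur_def)
  qed (simp add: col)
  have onvl: "(onv K k \<longlongrightarrow> 0) F" for k
    using tendsto_mult[OF colm[of k k] tendsto_const[of "1 / complex_of_real (pivot K k)"]]
    unfolding onv_def by simp
  have "((\<lambda>i. \<Sum>k<m. coord K f k * onv K k i) \<longlongrightarrow> (\<Sum>k<m. coord K f k * 0)) F" for m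
    by (intro tendsto_intros onvl)
  then have sl: "((\<lambda>i. \<Sum>k<m. coord K f k * onv K k i) \<longlongrightarrow> 0) F" for m by simp
  show ?thesis
  proof (rule tendstoI)
    fix e :: real assume e: "0 < e"
    obtain m where m: "nsq K (\<lambda>i. f i - (\<Sum>k<m. coord K f k * onv K k i)) < (e / 2)\<^sup>2"
      using order_tendstoD(2)[OF nsq_tail[OF K f], of "(e / 2)\<^sup>2"] e by (auto simp: eventually_sequentially)
    let ?s = "\<lambda>i. \<Sum>k<m. coord K f k * onv K k i"
    have s: "(\<lambda>i. f i - ?s i) \<in> rk K" by (intro rk_diff f rk_sum K onv_rk)
    have near: "cmod (f i - ?s i) < e / 2" if "i \<in> I" for i
    proof -
      have "(cmod (f i - ?s i))\<^sup>2 \<le> nsq K (\<lambda>i. f i - ?s i) * Re (K i i)" by (rule nsq_pointwise[OF K s])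
      also have "\<dots> \<le> nsq K (\<lambda>i. f i - ?s i)"
        using diag[OF that] nsq_nonneg[OF K s] by (simp add: mult_left_le)
      also note m
      finally show ?thesis using e by (intro power_less_imp_less_base[of "cmod (f i - ?s i)" 2 "e / 2"]) auto
    qed
    have "\<forall>\<^sub>F i in F. i \<in> I" unfolding F_def by (simp add: eventually_inf_principal)
    moreover have "\<forall>\<^sub>F i in F. dist (?s i) 0 < e / 2" using tendstoD[OF sl[of m], of "e / 2"] e by simp
    ultimately show "\<forall>\<^sub>F i in F. dist (f i) 0 < e"
    proof eventually_elim
      case (elim i)
      have "cmod (f i) \<le> cmod (f i - ?s i) + cmod (?s i)" using norm_triangle_ineq[of "f i - ?s i" "?s i"] by simp
      then show ?case using near[OF elim(1)] elim(2) by simp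
    qed
  qed
qed

section \<open>Countable measured groupoids\<close>

lemma standard_borel_generator:
  assumes "standard_borel M"
  shows "\<exists>B :: nat \<Rightarrow> 'a set. sets M = sigma_sets (space M) (range B) \<and> range B \<subseteq> sets M \<and>
    (\<forall>x\<in>space M. \<forall>y\<in>space M. (\<forall>i. x \<in> B i \<longleftrightarrow> y \<in> B i) \<longrightarrow> x = y)"
proof -
  obtain T where T: "completely_metrizable_space T" "second_countable T" "topspace T = space M"
      "sets M = sigma_sets (topspace T) {U. openin T U}"
    using assms unfolding standard_borel_def by blast
  obtain \<B> where "countable \<B> \<and> (\<forall>V\<in>\<B>. openin T V) \<and>
      (\<forall>U x. openin T U \<and> x \<in> U \<longrightarrow> (\<exists>V\<in>\<B>. x \<in> V \<and> V \<subseteq> U))"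
    using T(2) unfolding second_countable_def ..
  then have B: "countable \<B>" "\<And>V. V \<in> \<B> \<Longrightarrow> openin T V"
      "\<And>U x. openin T U \<Longrightarrow> x \<in> U \<Longrightarrow> \<exists>V\<in>\<B>. x \<in> V \<and> V \<subseteq> U"
    by simp_all
  \<comment> \<open>The empty set is added so that the family is nonempty and
    \<open>from_nat_into\<close> enumerates exactly it.\<close>
  define B where "B = from_nat_into (insert {} \<B>)"
  have rB: "range B = insert {} \<B>"
    unfolding B_def using B(1) by (intro range_from_nat_into) auto
  have op: "{U. openin T U} \<subseteq> sets M" using T(4) by (auto intro: sigma_sets.Basic)
  have sub: "range B \<subseteq> sets M" unfolding rB using B(2) op by auto
  have "sets M = sigma_sets (space M) (range B)"
    unfolding T(4) T(3)
  proof (rule sigma_sets_eqI)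
    fix U assume "U \<in> {U. openin T U}"
    then have "U = \<Union>{V\<in>\<B>. V \<subseteq> U}" using B(3) by blast
    moreover have "\<Union>{V\<in>\<B>. V \<subseteq> U} \<in> sigma_sets (space M) (range B)"
      by (rule sigma_sets_UNION) (use B(1) rB in \<open>auto intro: countable_subset[OF _ B(1)]\<close>)
    ultimately show "U \<in> sigma_sets (space M) (range B)" by simp
  next
    fix b assume "b \<in> range B"
    then show "b \<in> sigma_sets (space M) {U. openin T U}" using sub T(3,4) by auto
  qed
  moreover have "x = y" if xy: "x \<in> space M" "y \<in> space M" "\<forall>i. x \<in> B i \<longleftrightarrow> y \<in> B i" for x y
  proof (rule ccontr)
    assume "x \<noteq> y"
    then obtain U V where U: "openin T U" "x \<in> U" "openin T V" "y \<in> V" "disjnt U V"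
      using metrizable_imp_Hausdorff_space[OF completely_metrizable_imp_metrizable_space[OF T(1)]] xy T(3)
      unfolding Hausdorff_space_def by metis
    then obtain W where "W \<in> \<B>" "x \<in> W" "W \<subseteq> U" using B(3) by blast
    moreover then obtain i where "W = B i" using rB by blast
    ultimately show False using xy(3) U by (auto simp: disjnt_iff)
  qed
  ultimately show ?thesis using sub by blast
qed

lemma finite_separated:
  fixes B :: "nat \<Rightarrow> 'a set"
  assumes sep: "\<And>x y. x \<in> S \<Longrightarrow> y \<in> S \<Longrightarrow> (\<forall>i. x \<in> B i \<longleftrightarrow> y \<in> B i) \<Longrightarrow> x = y" and fin: "finite S"
  shows "\<exists>k. inj_on (\<lambda>a. {i. i < k \<and> a \<in> B i}) S"
proof -
  have "\<forall>p. \<exists>i. p \<in> S \<times> S \<longrightarrow> fst p \<noteq> snd p \<longrightarrow> (fst p \<in> B i) \<noteq> (snd p \<in> B i)" using sep by auto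
  from choice[OF this] obtain I where
    I: "\<forall>p. p \<in> S \<times> S \<longrightarrow> fst p \<noteq> snd p \<longrightarrow> (fst p \<in> B (I p)) \<noteq> (snd p \<in> B (I p))" ..
  define k where "k = Suc (\<Sum>p\<in>S \<times> S. I p)"
  have "inj_on (\<lambda>a. {i. i < k \<and> a \<in> B i}) S"
  proof (rule inj_onI, rule ccontr)
    fix x y assume xy: "x \<in> S" "y \<in> S" "{i. i < k \<and> x \<in> B i} = {i. i < k \<and> y \<in> B i}" "x \<noteq> y"
    have "I (x, y) < k"
      unfolding k_def using member_le_sum[of "(x, y)" "S \<times> S" I] xy fin by (simp add: less_Suc_eq_le)
    then have "(x \<in> B (I (x, y))) = (y \<in> B (I (x, y)))" using xy(3) by blast
    then show False using I xy by auto
  qed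
  then show ?thesis ..
qed

text \<open>Finitely many points are told apart by finitely many of the sets, so the number of
  labels given by the first \<open>k\<close> sets approaches the cardinality. Counting in a fibre
  thus reduces to asking which labelled cells the fibre meets.\<close>

lemma emeasure_count_space_separated:
  fixes B :: "nat \<Rightarrow> 'a set"
  assumes sep: "\<And>x y. x \<in> S \<Longrightarrow> y \<in> S \<Longrightarrow> (\<forall>i. x \<in> B i \<longleftrightarrow> y \<in> B i) \<Longrightarrow> x = y"
  shows "emeasure (count_space UNIV) S = (SUP k. of_nat (card ((\<lambda>a. {i. i < k \<and> a \<in> B i}) ` S)))"
    (is "_ = (SUP k. of_nat (card (?lab k ` S)))")
proof (rule antisym)
  have fl: "finite (?lab k ` A)" for k A
    by (rule finite_subset[of _ "Pow {..<k}"]) auto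
  have big: "of_nat (card A) \<le> (SUP k. of_nat (card (?lab k ` S)) :: ennreal)" if A: "finite A" "A \<subseteq> S" for A
  proof -
    obtain k where "inj_on (?lab k) A" using finite_separated[of A B] sep A by (meson subsetD)
    then have "card A = card (?lab k ` A)" by (simp add: card_image)
    also have "\<dots> \<le> card (?lab k ` S)" using A fl by (intro card_mono image_mono) auto
    finally have "(of_nat (card A) :: ennreal) \<le> of_nat (card (?lab k ` S))" by simp
    then show ?thesis by (meson SUP_upper2 UNIV_I)
  qed
  show "emeasure (count_space UNIV) S \<le> (SUP k. of_nat (card (?lab k ` S)))"
  proof (cases "finite S")
    case True
    then show ?thesis using big[of S] by simp
  next
    case False
    have "of_nat n \<le> (SUP k. of_nat (card (?lab k ` S)) :: ennreal)" for n
    proof -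
      obtain A where "A \<subseteq> S" "finite A" "card A = n" using infinite_arbitrarily_large[OF False] by blast
      then show ?thesis using big by blast
    qed
    then have "(SUP n. of_nat n :: ennreal) \<le> (SUP k. of_nat (card (?lab k ` S)))" by (rule SUP_least)
    then have "(SUP k. of_nat (card (?lab k ` S)) :: ennreal) = \<top>"
      by (simp only: ennreal_SUP_of_nat_eq_top top_unique)
    then show ?thesis by (simp only: top_greatest)
  qed
  show "(SUP k. of_nat (card (?lab k ` S))) \<le> emeasure (count_space UNIV) S"
  proof (cases "finite S")
    case True
    then show ?thesis by (auto intro!: SUP_least card_image_le)
  qed simp
qed

lemma completion_sets_AE:
  fixes Q :: "nat \<Rightarrow> 'a set"
  assumes "\<And>j. Q j \<in> sets (completion M)"
  shows "\<exists>S. (\<forall>j. S j \<in> sets M) \<and> (AE x in M. \<forall>j. x \<in> Q j \<longleftrightarrow> x \<in> S j)"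
proof -
  have "\<exists>S\<in>sets M. AE x in M. x \<in> Q j \<longleftrightarrow> x \<in> S" for j
  proof -
    obtain S N N' where S: "Q j = S \<union> N" "N \<subseteq> N'" "N' \<in> null_sets M" "S \<in> sets M"
      using assms by (rule sets_completionE)
    have "AE x in M. x \<in> Q j \<longleftrightarrow> x \<in> S"
      using AE_not_in[OF S(3)] by eventually_elim (use S(1,2) in auto)
    then show ?thesis using S(4) by blast
  qed
  then obtain S where "\<And>j. S j \<in> sets M" "\<And>j. AE x in M. x \<in> Q j \<longleftrightarrow> x \<in> S j" by metis
  then show ?thesis by (intro exI[of _ S]) (simp add: AE_all_countable)
qed

section \<open>Left quotients in a groupoid\<close>

context groupoid
begin

lemma ginv_ginv:
  assumes a: "a \<in> arrows G" shows "ginv G (ginv G a) = a"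
proof -
  let ?b = "ginv G a" let ?c = "ginv G (ginv G a)"
  have b: "?b \<in> arrows G" and c: "?c \<in> arrows G" using a by (auto intro: inv_closed)
  have comp: "(?c, ?b) \<in> composable G" "(?b, a) \<in> composable G"
    using a b c by (auto simp: composable_def rng_inv src_inv)
  have "?c = gmult G ?c (gmult G ?b a)"
    using mult_src[OF c] a b by (simp add: inv_mult src_inv rng_inv)
  also have "\<dots> = gmult G (gmult G ?c ?b) a" using mult_assoc[OF comp] by simp
  also have "\<dots> = a" using a b by (simp add: inv_mult src_inv mult_rng)
  finally show ?thesis .
qed

lemma composableI: "a \<in> arrows G \<Longrightarrow> b \<in> arrows G \<Longrightarrow> src G a = rng G b \<Longrightarrow> (a, b) \<in> composable G"
  by (simp add: composable_def)

lemma left_quot: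
  assumes "a \<in> arrows G" "b \<in> arrows G" "rng G a = rng G b"
  shows "gmult G (ginv G a) b \<in> arrows G" "rng G (gmult G (ginv G a) b) = src G a"
    "src G (gmult G (ginv G a) b) = src G b"
  using assms composableI[of "ginv G a" b]
  by (auto simp: inv_closed src_inv rng_inv mult_closed rng_mult src_mult)

lemma mult_left_quot:
  assumes a: "a \<in> arrows G" "b \<in> arrows G" "rng G a = rng G b"
  shows "gmult G a (gmult G (ginv G a) b) = b"
proof -
  have c: "(a, ginv G a) \<in> composable G" "(ginv G a, b) \<in> composable G"
    using a by (auto simp: composable_def inv_closed src_inv rng_inv)
  show ?thesis using mult_assoc[OF c] a by (simp add: mult_inv mult_rng)
qed

lemma inv_left_quot:
  assumes a: "a \<in> arrows G" "b \<in> arrows G" "src G a = rng G b"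
  shows "gmult G (ginv G a) (gmult G a b) = b"
proof -
  have c: "(ginv G a, a) \<in> composable G" "(a, b) \<in> composable G"
    using a by (auto simp: composable_def inv_closed src_inv rng_inv)
  show ?thesis using mult_assoc[OF c] a by (simp add: inv_mult mult_rng)
qed

text \<open>This cancellation makes the Gram matrix of the representation invariant under left
  translation.\<close>

lemma left_quot_left_quot:
  assumes a: "a \<in> arrows G" and b: "b \<in> arrows G" "rng G b = rng G a" and c: "c \<in> arrows G" "rng G c = rng G a"
  shows "gmult G (ginv G (gmult G (ginv G a) b)) (gmult G (ginv G a) c) = gmult G (ginv G b) c"
proof -
  let ?p = "gmult G (ginv G a) b" and ?q = "gmult G (ginv G a) c" and ?r = "gmult G (ginv G b) c"
  have p: "?p \<in> arrows G" "rng G ?p = src G a" "src G ?p = src G b" using left_quot[OF a b(1)] b by auto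
  have q: "?q \<in> arrows G" "rng G ?q = src G a" using left_quot[OF a c(1)] c by auto
  have r: "?r \<in> arrows G" "rng G ?r = src G b" using left_quot[OF b(1) c(1)] b c by auto
  have "gmult G ?p ?r = gmult G (ginv G a) (gmult G b ?r)"
    by (rule mult_assoc) (use a b r in \<open>auto intro!: composableI simp: inv_closed src_inv\<close>)
  also have "gmult G b ?r = c" using mult_left_quot[OF b(1) c(1)] b c by simp
  finally have "?q = gmult G ?p ?r" by simp
  then show ?thesis using inv_left_quot[OF p(1) r(1)] p r by simp
qed

lemma inv_left_quot_eq:
  assumes a: "a \<in> arrows G" and b: "b \<in> arrows G" "rng G b = rng G a"
  shows "ginv G (gmult G (ginv G a) b) = gmult G (ginv G b) a"
proof -
  let ?p = "gmult G (ginv G a) b"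
  have p: "?p \<in> arrows G" "rng G ?p = src G a" using left_quot[OF a b(1)] b by auto
  have "gmult G (ginv G b) a = gmult G (ginv G ?p) (gmult G (ginv G a) a)"
    using left_quot_left_quot[OF a b a] by simp
  also have "\<dots> = ginv G ?p" using inv_mult[OF a] mult_src[OF inv_closed[OF p(1)]] src_inv[OF p(1)] p(2) by simp
  finally show ?thesis by simp
qed

lemma mult_inv_left_quot:
  assumes a: "a \<in> arrows G" and b: "b \<in> arrows G" "src G a = rng G b" and c: "c \<in> arrows G" "rng G c = rng G a"
  shows "gmult G (ginv G (gmult G a b)) c = gmult G (ginv G b) (gmult G (ginv G a) c)"
proof -
  let ?q = "gmult G (ginv G a) c" and ?ab = "gmult G a b"
  have q: "?q \<in> arrows G" "rng G ?q = src G a" using left_quot[OF a c(1)] c by auto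
  have ab: "?ab \<in> arrows G" "rng G ?ab = rng G a" "src G ?ab = src G b"
    using mult_closed rng_mult src_mult composableI[OF a b] by auto
  let ?r = "gmult G (ginv G b) ?q"
  have r: "?r \<in> arrows G" "rng G ?r = src G b" using left_quot[OF b(1) q(1)] b q by auto
  have "gmult G ?ab ?r = gmult G a (gmult G b ?r)"
    by (rule mult_assoc) (use a b r in \<open>auto intro!: composableI\<close>)
  also have "\<dots> = c" using mult_left_quot[OF b(1) q(1)] mult_left_quot[OF a c(1)] b c q by simp
  finally have "c = gmult G ?ab ?r" by simp
  then show ?thesis using inv_left_quot[OF ab(1) r(1)] ab r by simp
qed

end

section \<open>The source measure and its null sets\<close>

context countable_measured_groupoid
begin

lemma space_base: "space \<mu> = unit_space G"
  using sets_eq_imp_space_eq[OF sets_base] units_subset by (auto simp: space_restrict_space)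

definition gen :: "nat \<Rightarrow> 'g set" where
  "gen = (SOME B. sets (borel_str G) = sigma_sets (arrows G) (range B) \<and> range B \<subseteq> sets (borel_str G) \<and>
    (\<forall>x\<in>arrows G. \<forall>y\<in>arrows G. (\<forall>i. x \<in> B i \<longleftrightarrow> y \<in> B i) \<longrightarrow> x = y))"

lemma gen: "sets (borel_str G) = sigma_sets (arrows G) (range gen)"
    "gen i \<in> sets (borel_str G)"
    "x \<in> arrows G \<Longrightarrow> y \<in> arrows G \<Longrightarrow> (\<forall>i. x \<in> gen i \<longleftrightarrow> y \<in> gen i) \<Longrightarrow> x = y"
  using someI_ex[OF standard_borel_generator[OF standard], folded gen_def] by auto

text \<open>Two points agree once they lie in the same sets \<open>gen i\<close>, which leaves
  countably many Borel conditions.\<close>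

lemma eq_set_measurable:
  assumes f: "f \<in> N \<rightarrow>\<^sub>M borel_str G" and g: "g \<in> N \<rightarrow>\<^sub>M borel_str G"
  shows "{x \<in> space N. f x = g x} \<in> sets N"
proof -
  have "{x \<in> space N. f x = g x} = {x \<in> space N. \<forall>i. f x \<in> gen i \<longleftrightarrow> g x \<in> gen i}"
    using gen(3) measurable_space[OF f] measurable_space[OF g] by auto
  moreover have "{x \<in> space N. h x \<in> gen i} \<in> sets N" if "h \<in> N \<rightarrow>\<^sub>M borel_str G" for h i
    using measurable_sets[OF that gen(2)[of i]] by (simp add: vimage_def Int_def conj_commute)
  then have "{x \<in> space N. \<forall>i. f x \<in> gen i \<longleftrightarrow> g x \<in> gen i} \<in> sets N"
    unfolding iff_conv_conj_imp using f g by (intro sets.sets_Collect)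
  ultimately show ?thesis by simp
qed

lemma unit_space_sets: "unit_space G \<in> sets (borel_str G)"
proof -
  have "unit_space G = {a \<in> arrows G. rng G a = a}"
    using rng_unit rng_of_unit units_subset by force
  then show ?thesis using eq_set_measurable[OF rng_measurable measurable_ident] by simp
qed

lemma sets_base_iff: "A \<in> sets \<mu> \<longleftrightarrow> A \<in> sets (borel_str G) \<and> A \<subseteq> unit_space G"
  unfolding sets_base using unit_space_sets sets.sets_into_space[OF unit_space_sets]
  by (subst sets_restrict_space_iff) auto

lemma vimage_src: "A \<in> sets (borel_str G) \<Longrightarrow> src G -` A \<inter> arrows G \<in> sets (borel_str G)"
  by (rule measurable_sets[OF src_measurable])

lemma vimage_rng: "A \<in> sets (borel_str G) \<Longrightarrow> rng G -` A \<inter> arrows G \<in> sets (borel_str G)"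
  by (rule measurable_sets[OF rng_measurable])

lemma vimage_inv: "A \<in> sets (borel_str G) \<Longrightarrow> ginv G -` A \<inter> arrows G \<in> sets (borel_str G)"
  by (rule measurable_sets[OF inv_measurable])

lemma image_completion:
  assumes s: "s \<in> borel_str G \<rightarrow>\<^sub>M borel_str G" "\<And>a. a \<in> arrows G \<Longrightarrow> s a \<in> unit_space G"
    and A: "A \<in> sets (borel_str G)"
  shows "s ` A \<in> sets (completion \<mu>)"
proof (rule borel_image_completion[OF finite_measure_axioms standard A])
  show "s ` A \<subseteq> space \<mu>" using s(2) sets.sets_into_space[OF A] space_base by blast
  show "gen i \<inter> unit_space G \<in> sets \<mu>" for i
    unfolding sets_base_iff using gen(2) unit_space_sets by auto
  show "s -` (gen i \<inter> unit_space G) \<inter> arrows G \<in> sets (borel_str G)" for i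
    using measurable_sets[OF s(1), of "gen i \<inter> unit_space G"] gen(2) unit_space_sets by auto
  show "x = y" if "x \<in> space \<mu>" "y \<in> space \<mu>"
    "\<And>i. x \<in> gen i \<inter> unit_space G \<longleftrightarrow> y \<in> gen i \<inter> unit_space G" for x y
    using that units_subset space_base by (intro gen(3)) auto
qed

lemma src_image: "A \<in> sets (borel_str G) \<Longrightarrow> src G ` A \<in> sets (completion \<mu>)"
  by (rule image_completion[OF src_measurable src_unit])

lemma rng_image: "A \<in> sets (borel_str G) \<Longrightarrow> rng G ` A \<in> sets (completion \<mu>)"
  by (rule image_completion[OF rng_measurable rng_unit])

definition cnt :: "'g set \<Rightarrow> 'g \<Rightarrow> ennreal" where
  "cnt A x = emeasure (count_space UNIV) (A \<inter> src_fibre G x)"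

lemma cnt_alt: "(\<integral>\<^sup>+ a. indicator A a \<partial>count_space (src_fibre G x)) = cnt A x"
proof -
  have "(\<integral>\<^sup>+ a. indicator A a \<partial>count_space (src_fibre G x))
    = (\<integral>\<^sup>+ a. indicator (A \<inter> src_fibre G x) a \<partial>count_space UNIV)"
    by (subst nn_integral_count_space_indicator) 
      (auto simp del: nn_integral_indicator intro!: nn_integral_cong split: split_indicator)
  also have "\<dots> = cnt A x" unfolding cnt_def by (rule nn_integral_indicator) simp
  finally show ?thesis .
qed

lemma cell_sets: "{a \<in> arrows G. {i. i < k \<and> a \<in> gen i} = t} \<in> sets (borel_str G)"
proof (cases "t \<subseteq> {..<k}")
  case True
  have *: "{a \<in> arrows G. a \<in> gen i} \<in> sets (borel_str G)" for i
    using gen(2)[of i] sets.sets_into_space[OF gen(2)[of i]] by (simp add: Int_def[symmetric] Int_absorb1)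
  have "{a \<in> arrows G. {i. i < k \<and> a \<in> gen i} = t} = {a \<in> arrows G. \<forall>i. i < k \<longrightarrow> (a \<in> gen i \<longleftrightarrow> i \<in> t)}"
    using True by auto
  also have "\<dots> \<in> sets (borel_str G)"
    unfolding iff_conv_conj_imp by (intro sets.sets_Collect *)
  finally show ?thesis .
next
  case False
  then have e: "{a \<in> arrows G. {i. i < k \<and> a \<in> gen i} = t} = {}" by auto
  show ?thesis unfolding e by (rule sets.empty_sets)
qed

text \<open>A cell of the first \<open>k\<close> generators contributes 1 exactly where
  \<open>x\<close> lies in the source image of its part of \<open>A\<close>. Such images are
  measurable for the completion.\<close>

lemma cnt_measurable:
  assumes A: "A \<in> sets (borel_str G)"
  shows "cnt A \<in> borel_measurable (completion \<mu>)"
proof -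
  define c where "c k t = {a \<in> arrows G. {i. i < k \<and> a \<in> gen i} = t}" for k t
  have c: "c k t \<in> sets (borel_str G)" for k t unfolding c_def by (rule cell_sets)
  have "cnt A x = (SUP k. \<Sum>t\<in>Pow {..<k}. indicator (src G ` (A \<inter> c k t)) x)" for x
  proof -
    let ?S = "A \<inter> src_fibre G x"
    have "cnt A x = (SUP k. of_nat (card ((\<lambda>a. {i. i < k \<and> a \<in> gen i}) ` ?S)))"
      unfolding cnt_def by (rule emeasure_count_space_separated) (auto simp: src_fibre_def intro: gen(3))
    moreover have "of_nat (card ((\<lambda>a. {i. i < k \<and> a \<in> gen i}) ` ?S))
        = (\<Sum>t\<in>Pow {..<k}. indicator (src G ` (A \<inter> c k t)) x :: ennreal)" for k
    proof -
      have "(\<lambda>a. {i. i < k \<and> a \<in> gen i}) ` ?S = {t \<in> Pow {..<k}. x \<in> src G ` (A \<inter> c k t)}"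
        using sets.sets_into_space[OF A] by (auto simp: c_def src_fibre_def)
      moreover have "(\<Sum>t\<in>Pow {..<k}. indicator (src G ` (A \<inter> c k t)) x :: ennreal)
          = (\<Sum>t\<in>Pow {..<k}. if x \<in> src G ` (A \<inter> c k t) then 1 else 0)"
        by (intro sum.cong) (auto simp: indicator_def)
      ultimately show ?thesis by (simp add: sum.If_cases Int_def)
    qed
    ultimately show ?thesis by simp
  qed
  moreover have "(\<lambda>x. SUP k. \<Sum>t\<in>Pow {..<k}. indicator (src G ` (A \<inter> c k t)) x :: ennreal) \<in> borel_measurable (completion \<mu>)"
    by (intro borel_measurable_SUP borel_measurable_sum borel_measurable_indicator src_image sets.Int A c) auto
  ultimately show ?thesis by (simp cong: measurable_cong)
qed

lemma src_measure_eq: "src_measure G \<mu> = measure_of (arrows G) (sets (borel_str G)) (\<lambda>A. \<integral>\<^sup>+ x. cnt A x \<partial>\<mu>)"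
  unfolding src_measure_def cnt_alt ..

lemma sets_src_measure [simp]: "sets (src_measure G \<mu>) = sets (borel_str G)"
  and space_src_measure [simp]: "space (src_measure G \<mu>) = arrows G"
  unfolding src_measure_eq by (auto simp: sets.sigma_sets_eq sets_measure_of[OF sets.space_closed] space_measure_of[OF sets.space_closed])

text \<open>The function \<open>cnt A\<close> is known to be measurable for the completion only.
  Since \<open>nn_integral_completion\<close> identifies the two integrals, countable additivity can
  be checked there.\<close>

lemma emeasure_src_measure:
  assumes A: "A \<in> sets (borel_str G)"
  shows "emeasure (src_measure G \<mu>) A = (\<integral>\<^sup>+ x. cnt A x \<partial>\<mu>)"
proof (rule emeasure_measure_of[OF src_measure_eq])
  show "positive (sets (src_measure G \<mu>)) (\<lambda>A. \<integral>\<^sup>+ x. cnt A x \<partial>\<mu>)"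
    by (simp add: positive_def cnt_def)
  show "countably_additive (sets (src_measure G \<mu>)) (\<lambda>A. \<integral>\<^sup>+ x. cnt A x \<partial>\<mu>)"
  proof (rule countably_additiveI)
    fix B :: "nat \<Rightarrow> 'g set" assume B: "range B \<subseteq> sets (src_measure G \<mu>)" "disjoint_family B"
    have "(\<Sum>i. cnt (B i) x) = cnt (\<Union>i. B i) x" for x
      unfolding cnt_def UN_extend_simps(4)
      by (rule suminf_emeasure) (use B(2) in \<open>auto simp: disjoint_family_on_def\<close>)
    moreover have "(\<Sum>i. \<integral>\<^sup>+ x. cnt (B i) x \<partial>completion \<mu>) = (\<integral>\<^sup>+ x. (\<Sum>i. cnt (B i) x) \<partial>completion \<mu>)"
      by (rule nn_integral_suminf[symmetric]) (use B(1) in \<open>auto intro!: cnt_measurable\<close>)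
    ultimately show "(\<Sum>i. \<integral>\<^sup>+ x. cnt (B i) x \<partial>\<mu>) = (\<integral>\<^sup>+ x. cnt (\<Union>i. B i) x \<partial>\<mu>)"
      by (simp add: nn_integral_completion)
  qed
qed (use A sets.space_closed in auto)

lemma null_src_measure_iff:
  assumes A: "A \<in> sets (borel_str G)"
  shows "A \<in> null_sets (src_measure G \<mu>) \<longleftrightarrow> (AE x in \<mu>. A \<inter> src_fibre G x = {})"
proof -
  have "A \<in> null_sets (src_measure G \<mu>) \<longleftrightarrow> (\<integral>\<^sup>+ x. cnt A x \<partial>completion \<mu>) = 0"
    using A by (simp add: null_sets_def emeasure_src_measure nn_integral_completion)
  also have "\<dots> \<longleftrightarrow> (AE x in \<mu>. cnt A x = 0)"
    by (simp add: nn_integral_0_iff_AE[OF cnt_measurable[OF A]] AE_completion_iff)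
  also have "\<dots> \<longleftrightarrow> (AE x in \<mu>. A \<inter> src_fibre G x = {})"
    by (simp add: cnt_def emeasure_count_space_eq_0)
  finally show ?thesis .
qed

lemma AE_src_fibre:
  assumes "AE a in src_measure G \<mu>. P a"
  shows "AE x in \<mu>. \<forall>a\<in>src_fibre G x. P a"
proof -
  obtain N where N: "\<And>a. a \<in> space (src_measure G \<mu>) - N \<Longrightarrow> P a" "N \<in> null_sets (src_measure G \<mu>)"
    using assms by (rule AE_E3) blast
  then have "N \<in> sets (borel_str G)" by (auto simp: null_sets_def)
  then have "AE x in \<mu>. N \<inter> src_fibre G x = {}" using null_src_measure_iff N(2) by blast
  then show ?thesis by eventually_elim (use N(1) in \<open>auto simp: src_fibre_def\<close>)
qed

lemma vimage_inv_null:
  assumes "N \<in> null_sets (src_measure G \<mu>)"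
  shows "ginv G -` N \<inter> arrows G \<in> null_sets (src_measure G \<mu>)"
proof -
  have m: "ginv G \<in> src_measure G \<mu> \<rightarrow>\<^sub>M borel_str G"
    using inv_measurable by (simp cong: measurable_cong_sets)
  have N: "N \<in> sets (borel_str G)" using assms by (auto simp: null_sets_def)
  have "N \<in> null_sets (distr (src_measure G \<mu>) (borel_str G) (ginv G))"
    using quasi_inv assms unfolding quasi_invariant_def Let_def absolutely_continuous_def by blast
  then show ?thesis using vimage_inv[OF N] N by (auto simp: null_sets_def emeasure_distr[OF m])
qed

lemma AE_inv:
  assumes "AE a in src_measure G \<mu>. P a"
  shows "AE a in src_measure G \<mu>. P (ginv G a)"
proof -
  obtain N where N: "\<And>a. a \<in> space (src_measure G \<mu>) - N \<Longrightarrow> P a" "N \<in> null_sets (src_measure G \<mu>)"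
    using assms by (rule AE_E3) blast
  show ?thesis
    by (rule AE_I'[OF vimage_inv_null[OF N(2)]]) (use N(1) inv_closed in auto)
qed

text \<open>Inversion exchanges range and source fibres, and by quasi-invariance it preserves null
  sets.\<close>

lemma AE_rng_fibre:
  assumes "AE a in src_measure G \<mu>. P a"
  shows "AE x in \<mu>. \<forall>a\<in>rng_fibre G x. P a"
  using AE_src_fibre[OF AE_inv[OF assms]]
proof eventually_elim
  case (elim x)
  show ?case
  proof
    fix a assume "a \<in> rng_fibre G x"
    then have "ginv G a \<in> src_fibre G x" "ginv G (ginv G a) = a"
      by (auto simp: rng_fibre_def src_fibre_def inv_closed src_inv ginv_ginv)
    then show "P a" using elim by metis
  qed
qed

lemma AE_src:
  assumes "AE x in \<mu>. P x"
  shows "AE a in src_measure G \<mu>. P (src G a)"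
proof -
  obtain N where N: "\<And>x. x \<in> space \<mu> - N \<Longrightarrow> P x" "N \<in> null_sets \<mu>"
    using assms by (rule AE_E3) blast
  have Ns: "N \<in> sets (borel_str G)" using N(2) sets_base_iff by (auto simp: null_sets_def)
  have "src G -` N \<inter> arrows G \<in> null_sets (src_measure G \<mu>)"
    unfolding null_src_measure_iff[OF vimage_src[OF Ns]]
    using AE_not_in[OF N(2)] by eventually_elim (auto simp: src_fibre_def)
  then show ?thesis
    by (rule AE_I') (use N(1) src_unit space_base in auto)
qed

lemma AE_fibre_src: "AE x in \<mu>. P x \<Longrightarrow> AE x in \<mu>. \<forall>a\<in>rng_fibre G x. P (src G a)"
  by (rule AE_rng_fibre[OF AE_src])

section \<open>Invariant sets and ergodicity\<close>

lemma invariant_conull: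
  assumes "AE x in \<mu>. P x"
  obtains U where "U \<in> sets \<mu>" "space \<mu> - U \<in> null_sets \<mu>" "\<And>x. x \<in> U \<Longrightarrow> P x"
    "\<And>a. a \<in> arrows G \<Longrightarrow> rng G a \<in> U \<longleftrightarrow> src G a \<in> U"
proof -
  define good where "good V \<longleftrightarrow> V \<in> sets \<mu> \<and> space \<mu> - V \<in> null_sets \<mu>" for V
  have ae: "\<exists>V. good V \<and> (\<forall>x\<in>V. Q x)" if "AE x in \<mu>. Q x" for Q
  proof -
    obtain N where N: "\<And>x. x \<in> space \<mu> - N \<Longrightarrow> Q x" "N \<in> null_sets \<mu>"
      using \<open>AE x in \<mu>. Q x\<close> by (rule AE_E3) blast
    have "space \<mu> - (space \<mu> - N) = N" using N(2) sets.sets_into_space by (auto simp: null_sets_def)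
    then show ?thesis using N by (intro exI[of _ "space \<mu> - N"]) (auto simp: good_def)
  qed
  have goodAE: "AE x in \<mu>. x \<in> V" if "good V" for V
    using that unfolding good_def by (intro AE_I'[of "space \<mu> - V"]) auto
  \<comment> \<open>Saturations are here only known to be Souslin, so none is taken. Instead
    \<open>V (Suc n)\<close> is a conull Borel set of points whose orbits lie in \<open>V n\<close>,
    and the intersection of these sets is invariant.\<close>
  have "\<exists>V. \<forall>n. (good (V n) \<and> (\<forall>x\<in>V n. P x)) \<and> (\<forall>x\<in>V (Suc n). x \<in> V n \<and> (\<forall>a\<in>rng_fibre G x. src G a \<in> V n))"
  proof (rule dependent_nat_choice)
    show "\<exists>V. good V \<and> (\<forall>x\<in>V. P x)" by (rule ae[OF assms])
    fix V and n :: nat assume V: "good V \<and> (\<forall>x\<in>V. P x)"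
    then have "AE x in \<mu>. x \<in> V \<and> (\<forall>a\<in>rng_fibre G x. src G a \<in> V)"
      using AE_fibre_src[OF goodAE, of V] goodAE[of V] by auto
    from ae[OF this] V
    show "\<exists>W. (good W \<and> (\<forall>x\<in>W. P x)) \<and> (\<forall>x\<in>W. x \<in> V \<and> (\<forall>a\<in>rng_fibre G x. src G a \<in> V))" by blast
  qed
  then obtain V where V: "\<And>n. good (V n)" "\<And>n x. x \<in> V n \<Longrightarrow> P x"
    "\<And>n x a. x \<in> V (Suc n) \<Longrightarrow> a \<in> rng_fibre G x \<Longrightarrow> src G a \<in> V n" by blast
  let ?U = "\<Inter>n. V n"
  have inv: "src G a \<in> ?U" if "a \<in> arrows G" "rng G a \<in> ?U" for a
    using V(3)[of "rng G a" _ a] that by (auto simp: rng_fibre_def)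
  show thesis
  proof
    show "?U \<in> sets \<mu>" using V(1) unfolding good_def by auto
    have "space \<mu> - ?U = (\<Union>n. space \<mu> - V n)" by auto
    also have "\<dots> \<in> null_sets \<mu>" using V(1) unfolding good_def by (intro null_sets_UN) auto
    finally show "space \<mu> - ?U \<in> null_sets \<mu>" .
    show "P x" if "x \<in> ?U" for x using V(2)[of x 0] that by auto
    show "rng G a \<in> ?U \<longleftrightarrow> src G a \<in> ?U" if a: "a \<in> arrows G" for a
      using inv[OF a] inv[OF inv_closed[OF a]] a by (auto simp: rng_inv src_inv)
  qed
qed

text \<open>Ergodicity speaks of Borel sets, while the saturation \<open>Q\<close> of
  \<open>A\<close> is only measurable for the completion. On an invariant conull set
  \<open>U\<close> it agrees with a Borel set, and then \<open>Q \<inter> U\<close> is both Borel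
  and invariant.\<close>

lemma ergodic_saturation:
  assumes erg: "ergodic G \<mu>" and A: "A \<in> sets \<mu>" "A \<notin> null_sets \<mu>"
  shows "AE x in \<mu>. \<exists>a\<in>rng_fibre G x. src G a \<in> A"
proof -
  define Q where "Q = src G ` (rng G -` A \<inter> arrows G)"
  have AM: "A \<in> sets (borel_str G)" and AX: "A \<subseteq> unit_space G" using A(1) sets_base_iff by auto
  have "Q \<in> sets (completion \<mu>)" unfolding Q_def by (rule src_image[OF vimage_rng[OF AM]])
  then obtain S' :: "nat \<Rightarrow> 'g set" where S': "\<And>j. S' j \<in> sets \<mu>" "AE x in \<mu>. \<forall>j. x \<in> Q \<longleftrightarrow> x \<in> S' j"
    using completion_sets_AE[of "\<lambda>_. Q" \<mu>] by blast
  define S where "S = S' 0"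
  have S: "S \<in> sets \<mu>" "AE x in \<mu>. x \<in> Q \<longleftrightarrow> x \<in> S"
    using S' by (auto simp: S_def elim: eventually_mono)
  obtain U where U: "U \<in> sets \<mu>" "space \<mu> - U \<in> null_sets \<mu>" "\<And>x. x \<in> U \<Longrightarrow> x \<in> Q \<longleftrightarrow> x \<in> S"
    "\<And>a. a \<in> arrows G \<Longrightarrow> rng G a \<in> U \<longleftrightarrow> src G a \<in> U"
    using invariant_conull[OF S(2)] by blast
  have AQ: "A \<subseteq> Q"
  proof
    fix x assume "x \<in> A"
    then show "x \<in> Q" unfolding Q_def using AX units_subset rng_of_unit[of x] src_of_unit[of x]
      by (intro image_eqI[of x _ x]) auto
  qed
  have Qinv: "src G a \<in> Q" if a: "a \<in> arrows G" "rng G a \<in> Q" for a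
  proof -
    obtain b where b: "b \<in> arrows G" "rng G b \<in> A" "rng G a = src G b" using a(2) unfolding Q_def by auto
    have c: "(b, a) \<in> composable G" using a b by (intro composableI) auto
    then show ?thesis unfolding Q_def
      using b by (intro image_eqI[of _ _ "gmult G b a"]) (auto simp: src_mult rng_mult mult_closed)
  qed
  let ?E = "S \<inter> U"
  have E: "?E \<in> sets \<mu>" using S(1) U(1) by auto
  have EQ: "x \<in> ?E \<longleftrightarrow> x \<in> Q \<and> x \<in> U" for x using U(3) by auto
  have "src G ` {a \<in> arrows G. rng G a \<in> ?E} = ?E"
  proof (intro equalityI subsetI)
    fix x assume "x \<in> src G ` {a \<in> arrows G. rng G a \<in> ?E}"
    then show "x \<in> ?E" using EQ Qinv U(4) by auto
  next
    fix x assume x: "x \<in> ?E"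
    then have "x \<in> unit_space G" using E sets_base_iff[of ?E] by auto
    then show "x \<in> src G ` {a \<in> arrows G. rng G a \<in> ?E}"
      using x units_subset rng_of_unit[of x] src_of_unit[of x] by (intro image_eqI[of x _ x]) auto
  qed
  then have "?E \<in> null_sets \<mu> \<or> space \<mu> - ?E \<in> null_sets \<mu>" using erg E unfolding ergodic_def by blast
  moreover have "?E \<notin> null_sets \<mu>"
  proof
    assume "?E \<in> null_sets \<mu>"
    then have "?E \<union> (space \<mu> - U) \<in> null_sets \<mu>" using U(2) by auto
    moreover have "A \<subseteq> ?E \<union> (space \<mu> - U)" using EQ AQ AX space_base by blast
    ultimately show False using null_sets_subset[of _ \<mu> A] A by blast
  qed
  ultimately have "AE x in \<mu>. x \<in> ?E" by (intro AE_I'[of "space \<mu> - ?E"]) auto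
  then show ?thesis
  proof eventually_elim
    case (elim x)
    then obtain b where b: "b \<in> arrows G" "rng G b \<in> A" "x = src G b" using EQ unfolding Q_def by auto
    then show ?case
      by (intro bexI[of _ "ginv G b"]) (auto simp: rng_fibre_def inv_closed rng_inv src_inv)
  qed
qed

text \<open>A diffuse measure has non-null sets shrinking to a null set. By ergodicity almost every orbit
  meets all of them, hence their intersection, if the orbit meets the first one in a finite set.\<close>

lemma not_AE_finite_return:
  assumes erg: "ergodic G \<mu>" and dif: "diffuse \<mu>" and E: "E \<in> sets \<mu>" "E \<notin> null_sets \<mu>"
  shows "\<not> (AE x in \<mu>. finite {a \<in> rng_fibre G x. src G a \<in> E})"
proof
  assume fin: "AE x in \<mu>. finite {a \<in> rng_fibre G x. src G a \<in> E}"
  define D where "D i = gen i \<inter> unit_space G" for i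
  have D: "D i \<in> sets \<mu>" for i unfolding D_def sets_base_iff using gen(2) unit_space_sets by auto
  \<comment> \<open>At step \<open>n\<close> a non-null piece of \<open>A n\<close> is kept, inside
    or outside \<open>D n\<close>. Points of the final intersection therefore lie in the same
    generators, so there is at most one.\<close>
  have "\<exists>A. \<forall>n. (A n \<in> sets \<mu> \<and> A n \<notin> null_sets \<mu> \<and> A n \<subseteq> E) \<and>
      (A (Suc n) \<subseteq> A n \<and> (A (Suc n) \<subseteq> D n \<or> A (Suc n) \<inter> D n = {}))"
  proof (rule dependent_nat_choice)
    show "\<exists>A. A \<in> sets \<mu> \<and> A \<notin> null_sets \<mu> \<and> A \<subseteq> E" using E by blast
    fix A n assume A: "A \<in> sets \<mu> \<and> A \<notin> null_sets \<mu> \<and> A \<subseteq> E"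
    have "A \<inter> D n \<notin> null_sets \<mu> \<or> A - D n \<notin> null_sets \<mu>"
    proof (rule ccontr)
      assume "\<not> ?thesis"
      then have "(A \<inter> D n) \<union> (A - D n) \<in> null_sets \<mu>" by (intro null_sets.Un) auto
      then show False using A by (simp add: Int_Diff_Un)
    qed
    then show "\<exists>B. (B \<in> sets \<mu> \<and> B \<notin> null_sets \<mu> \<and> B \<subseteq> E) \<and> (B \<subseteq> A \<and> (B \<subseteq> D n \<or> B \<inter> D n = {}))"
    proof
      assume "A \<inter> D n \<notin> null_sets \<mu>"
      then show ?thesis using A D by (intro exI[of _ "A \<inter> D n"]) auto
    next
      assume "A - D n \<notin> null_sets \<mu>"
      then show ?thesis using A D by (intro exI[of _ "A - D n"]) auto
    qed
  qed
  then obtain A where "\<forall>n. (A n \<in> sets \<mu> \<and> A n \<notin> null_sets \<mu> \<and> A n \<subseteq> E) \<and>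
      (A (Suc n) \<subseteq> A n \<and> (A (Suc n) \<subseteq> D n \<or> A (Suc n) \<inter> D n = {}))" ..
  then have A: "\<And>n. A n \<in> sets \<mu>" "\<And>n. A n \<notin> null_sets \<mu>" "\<And>n. A n \<subseteq> E"
    "\<And>n. A (Suc n) \<subseteq> A n" "\<And>n. A (Suc n) \<subseteq> D n \<or> A (Suc n) \<inter> D n = {}" by simp_all
  have dec: "decseq A" using A(4) by (rule decseq_SucI)
  let ?I = "\<Inter>n. A n"
  have I: "?I \<in> sets \<mu>" using A(1) by auto
  have "x = y" if "x \<in> ?I" "y \<in> ?I" for x y
  proof (rule gen(3))
    have xy: "x \<in> unit_space G" "y \<in> unit_space G" using that I sets_base_iff by auto
    then show "x \<in> arrows G" "y \<in> arrows G" using units_subset by auto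
    show "\<forall>i. x \<in> gen i \<longleftrightarrow> y \<in> gen i"
    proof
      fix i show "x \<in> gen i \<longleftrightarrow> y \<in> gen i" using A(5)[of i] that xy unfolding D_def by blast
    qed
  qed
  then have "?I = {} \<or> (\<exists>x. ?I = {x})" by blast
  moreover have "emeasure \<mu> {x} = 0" if "?I = {x}" for x
    using dif sets.sets_into_space[OF I] that unfolding diffuse_def by auto
  ultimately have "emeasure \<mu> ?I = 0" by auto
  then have "AE x in \<mu>. x \<notin> ?I" using I by (intro AE_not_in) (auto simp: null_sets_def)
  then have 1: "AE x in \<mu>. \<forall>a\<in>rng_fibre G x. src G a \<notin> ?I" by (rule AE_fibre_src)
  have 2: "AE x in \<mu>. \<forall>n. \<exists>a\<in>rng_fibre G x. src G a \<in> A n"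
    unfolding AE_all_countable using ergodic_saturation[OF erg A(1,2)] by blast
  have "AE x in \<mu>. False"
    using 1 2 fin
  proof eventually_elim
    case (elim x)
    let ?F = "{a \<in> rng_fibre G x. src G a \<in> E}"
    have "\<forall>a\<in>?F. \<exists>n. src G a \<notin> A n" using elim(1) by auto
    then obtain n where n: "\<And>a. a \<in> ?F \<Longrightarrow> src G a \<notin> A (n a)" by metis
    define m where "m = (\<Sum>a\<in>?F. n a)"
    obtain a where a: "a \<in> rng_fibre G x" "src G a \<in> A m" using elim(2) by blast
    then have aF: "a \<in> ?F" using A(3) by auto
    then have "n a \<le> m" unfolding m_def using elim(3) by (intro member_le_sum) auto
    then have "A m \<subseteq> A (n a)" using dec by (auto simp: decseq_def)
    then show False using n[OF aF] a(2) by blast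
  qed
  then show False by simp
qed

end

section \<open>The representation built from a sequence of positive definite functions\<close>

lemma measurable_cnj:
  assumes "f \<in> borel_measurable N" shows "(\<lambda>x. cnj (f x)) \<in> borel_measurable N"
  by (rule measurable_compose[OF assms borel_measurable_continuous_onI]) (intro continuous_intros)

lemma measurable_kern_n:
  assumes "\<And>i j. (\<lambda>x. K x i j) \<in> borel_measurable N"
  shows "(\<lambda>x. kern_n (K x) m i j) \<in> borel_measurable N"
proof (induction m arbitrary: i j)
  case (Suc m)
  then show ?case by (simp add: schur_def)
qed (simp add: assms)

lemma measurable_vec_n:
  assumes K: "\<And>i j. (\<lambda>x. K x i j) \<in> borel_measurable N" and f: "\<And>i. (\<lambda>x. f x i) \<in> borel_measurable N"
  shows "(\<lambda>x. vec_n (K x) (f x) m i) \<in> borel_measurable N"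
proof (induction m arbitrary: i)
  case (Suc m)
  then show ?case using measurable_kern_n[of K, OF K] by (simp add: schurf_def)
qed (simp add: f)

lemma measurable_pivot:
  assumes K: "\<And>i j. (\<lambda>x. K x i j) \<in> borel_measurable N"
  shows "(\<lambda>x. pivot (K x) m) \<in> borel_measurable N"
  unfolding pivot_def using measurable_kern_n[of K, OF K, of m m m] by simp

lemma measurable_onv:
  assumes K: "\<And>i j. (\<lambda>x. K x i j) \<in> borel_measurable N"
  shows "(\<lambda>x. onv (K x) k i) \<in> borel_measurable N"
  unfolding onv_def using measurable_kern_n[of K, OF K, of k i k] measurable_pivot[of K, OF K, of k] by simp

lemma measurable_coord:
  assumes K: "\<And>i j. (\<lambda>x. K x i j) \<in> borel_measurable N" and f: "\<And>i. (\<lambda>x. f x i) \<in> borel_measurable N"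
  shows "(\<lambda>x. coord (K x) (f x) k) \<in> borel_measurable N"
  unfolding coord_def using measurable_vec_n[of K N f, OF K f, of k k] measurable_pivot[of K, OF K, of k] by simp

lemma measurable_ip:
  assumes K: "\<And>i j. (\<lambda>x. K x i j) \<in> borel_measurable N" and f: "\<And>i. (\<lambda>x. f x i) \<in> borel_measurable N"
    and g: "\<And>i. (\<lambda>x. g x i) \<in> borel_measurable N"
  shows "(\<lambda>x. ip (K x) (f x) (g x)) \<in> borel_measurable N"
  unfolding ip_def
  using measurable_coord[of K N f, OF K f] measurable_coord[of K N g, OF K g]
  by (intro borel_measurable_suminf borel_measurable_times) (auto intro: measurable_cnj)

lemma nsq_col_diff:
  assumes K: "pd_kernel K"
  shows "nsq K (\<lambda>i. K i j - K i l) = Re (K j j) + Re (K l l) - 2 * Re (K j l)"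
proof -
  let ?g = "\<lambda>i. (- 1) * K i l"
  have g: "?g \<in> rk K" by (rule rk_scale[OF col_rk[OF K]])
  have "ip K ?g (\<lambda>i. K i j) = - K j l"
    using ip_scale[OF K col_rk[OF K] col_rk[OF K], of "- 1" l j] ip_col[OF K col_rk[OF K]] by simp
  then have "Re (ip K (\<lambda>i. K i j) ?g) = - Re (K j l)" using ip_cnj[OF K g col_rk[OF K], of j] by simp
  then have "nsq K (\<lambda>i. K i j + ?g i) = Re (K j j) + Re (K l l) - 2 * Re (K j l)"
    unfolding nsq_add[OF K col_rk[OF K] g] nsq_scale[OF K col_rk[OF K]] nsq_col[OF K] by simp
  then show ?thesis by simp
qed

section \<open>Borel enumeration of the range fibres\<close>

context countable_measured_groupoid
begin

lemma gmult_measurable: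
  assumes f: "f \<in> N \<rightarrow>\<^sub>M borel_str G" and g: "g \<in> N \<rightarrow>\<^sub>M borel_str G"
    and c: "\<And>x. x \<in> space N \<Longrightarrow> src G (f x) = rng G (g x)"
  shows "(\<lambda>x. gmult G (f x) (g x)) \<in> N \<rightarrow>\<^sub>M borel_str G"
proof -
  have "(\<lambda>x. (f x, g x)) \<in> N \<rightarrow>\<^sub>M restrict_space (borel_str G \<Otimes>\<^sub>M borel_str G) (composable G)"
    using f g c measurable_space[OF f] measurable_space[OF g]
    by (intro measurable_restrict_space2 measurable_Pair) (auto simp: composable_def)
  from measurable_compose[OF this mult_measurable] show ?thesis by simp
qed

lemma AE_finite_src_fibre:
  assumes A: "A \<in> sets (borel_str G)" and f: "emeasure (src_measure G \<mu>) A < \<infinity>"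
  shows "AE x in \<mu>. finite (A \<inter> src_fibre G x)"
proof -
  have "(\<integral>\<^sup>+ x. cnt A x \<partial>completion \<mu>) \<noteq> \<infinity>"
    using f by (simp add: emeasure_src_measure[OF A] nn_integral_completion)
  then have "AE x in completion \<mu>. cnt A x \<noteq> \<infinity>"
    by (rule nn_integral_noteq_infinite[OF cnt_measurable[OF A]])
  then show ?thesis unfolding AE_completion_iff
    by eventually_elim (auto simp: cnt_def emeasure_count_space split: if_splits)
qed

text \<open>Where \<open>P p\<close> meets a fibre in exactly one arrow, that arrow is selected,
  elsewhere the unit; index 0 is reserved for the unit. By \<open>iso\<close> every arrow of almost
  every fibre is reached. The maps are first measurable for the completion, and become Borel on an
  invariant conull set.\<close>

lemma borel_sections:
  fixes P :: "nat \<Rightarrow> 'g set"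
  assumes P: "\<And>p. P p \<in> sets (borel_str G)"
    and iso: "AE x in \<mu>. \<forall>a\<in>rng_fibre G x. \<exists>p. a \<in> P p \<and> (\<forall>b\<in>rng_fibre G x. b \<in> P p \<longrightarrow> b = a)"
    and Q: "AE x in \<mu>. Q x"
  obtains U sel where "U \<in> sets \<mu>" "space \<mu> - U \<in> null_sets \<mu>" "\<And>x. x \<in> U \<Longrightarrow> Q x"
    "\<And>a. a \<in> arrows G \<Longrightarrow> rng G a \<in> U \<longleftrightarrow> src G a \<in> U"
    "\<And>m. sel m \<in> restrict_space (borel_str G) U \<rightarrow>\<^sub>M borel_str G"
    "\<And>m x. x \<in> U \<Longrightarrow> sel m x \<in> rng_fibre G x" "\<And>x. x \<in> U \<Longrightarrow> sel 0 x = x"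
    "\<And>x a. x \<in> U \<Longrightarrow> a \<in> rng_fibre G x \<Longrightarrow> \<exists>m. sel (m::nat) x = a"
proof -
  define uniq where "uniq p x \<longleftrightarrow> (\<exists>!a. a \<in> P p \<and> a \<in> rng_fibre G x)" for p x
  define sel where "sel m x = (case m of 0 \<Rightarrow> x | Suc p \<Rightarrow>
      if uniq p x then (THE a. a \<in> P p \<and> a \<in> rng_fibre G x) else x)" for m x
  have Psub: "P p \<subseteq> arrows G" for p by (rule sets.sets_into_space[OF P])
  have selu: "sel (Suc p) x = a" if "uniq p x" "a \<in> P p" "a \<in> rng_fibre G x" for p x a
    using that unfolding sel_def uniq_def by (auto intro: the1_equality)
  have unit: "x \<in> rng_fibre G x" if "x \<in> unit_space G" for x
    using that units_subset rng_of_unit by (auto simp: rng_fibre_def)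
  have selin: "sel m x \<in> rng_fibre G x" if "x \<in> unit_space G" for m x
  proof (cases m)
    case 0
    then show ?thesis using unit[OF that] by (simp add: sel_def)
  next
    case (Suc p)
    show ?thesis
    proof (cases "uniq p x")
      case True
      then obtain a where "a \<in> P p" "a \<in> rng_fibre G x" unfolding uniq_def by blast
      then show ?thesis using selu[OF True] Suc by simp
    qed (use unit[OF that] Suc in \<open>simp add: sel_def\<close>)
  qed
  have one: "{x. uniq p x} \<in> sets (completion \<mu>)" for p
  proof -
    \<comment> \<open>Uniqueness means that no generator separates two arrows of \<open>P p\<close>
      over \<open>x\<close>; so phrased, only images of Borel sets under \<open>rng G\<close>
      occur.\<close>
    have "{x. uniq p x} = rng G ` P p - (\<Union>i. rng G ` (P p \<inter> gen i) \<inter> rng G ` (P p - gen i))" (is "_ = ?R")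
    proof (intro Set.set_eqI iffI)
      fix x assume "x \<in> {x. uniq p x}"
      then obtain a where a: "a \<in> P p" "a \<in> rng_fibre G x" "\<And>b. b \<in> P p \<Longrightarrow> b \<in> rng_fibre G x \<Longrightarrow> b = a"
        unfolding uniq_def by blast
      show "x \<in> ?R"
      proof (intro DiffI notI)
        show "x \<in> rng G ` P p" using a(1,2) by (auto simp: rng_fibre_def)
        assume "x \<in> (\<Union>i. rng G ` (P p \<inter> gen i) \<inter> rng G ` (P p - gen i))"
        then obtain i b c where "b \<in> P p \<inter> gen i" "c \<in> P p - gen i" "rng G b = x" "rng G c = x" by auto
        moreover then have "b = a" "c = a" using a(3) Psub by (auto simp: rng_fibre_def)
        ultimately show False by auto
      qed
    next
      fix x assume x: "x \<in> ?R"
      then obtain a where a: "a \<in> P p" "rng G a = x" by auto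
      have "b = a" if b: "b \<in> P p" "b \<in> rng_fibre G x" for b
      proof (rule gen(3))
        show "b \<in> arrows G" "a \<in> arrows G" using a b Psub by auto
        show "\<forall>i. b \<in> gen i \<longleftrightarrow> a \<in> gen i"
        proof (rule ccontr)
          assume "\<not> ?thesis"
          then obtain i where "(b \<in> gen i) \<noteq> (a \<in> gen i)" by blast
          moreover have "x = rng G b" "x = rng G a" using a b by (auto simp: rng_fibre_def)
          ultimately have "x \<in> rng G ` (P p \<inter> gen i) \<inter> rng G ` (P p - gen i)"
            using a(1) b(1) by (metis DiffI IntI image_eqI)
          then show False using x by blast
        qed
      qed
      moreover have "a \<in> rng_fibre G x" using a Psub by (auto simp: rng_fibre_def)
      ultimately show "x \<in> {x. uniq p x}" using a(1) unfolding uniq_def by blast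
    qed
    also have "\<dots> \<in> sets (completion \<mu>)"
      using P gen(2) by (intro sets.Diff sets.countable_UN) (auto intro!: sets.Int sets.Diff rng_image)
    finally show ?thesis .
  qed
  \<comment> \<open>The preimages of all generators under all sections form a single sequence, so
    one null set corrects them simultaneously.\<close>
  define W where "W n = (case prod_decode n of (p, j) \<Rightarrow> {x \<in> unit_space G. sel (Suc p) x \<in> gen j})" for n
  have "W n \<in> sets (completion \<mu>)" for n
  proof -
    obtain p j where n: "prod_decode n = (p, j)" by fastforce
    have "W n = ({x. uniq p x} \<inter> rng G ` (P p \<inter> gen j)) \<union> ((unit_space G - {x. uniq p x}) \<inter> gen j)" (is "_ = ?R")
    proof (intro Set.set_eqI)
      fix x
      show "x \<in> W n \<longleftrightarrow> x \<in> ?R"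
      proof (cases "uniq p x")
        case True
        then obtain a where a: "a \<in> P p" "a \<in> rng_fibre G x" "\<And>b. b \<in> P p \<Longrightarrow> b \<in> rng_fibre G x \<Longrightarrow> b = a"
          unfolding uniq_def by blast
        have "x \<in> unit_space G" using a(2) rng_unit by (auto simp: rng_fibre_def)
        moreover have "x \<in> rng G ` (P p \<inter> gen j) \<longleftrightarrow> a \<in> gen j"
        proof
          assume "x \<in> rng G ` (P p \<inter> gen j)"
          then obtain b where b: "b \<in> P p" "b \<in> gen j" "x = rng G b" by blast
          then have "b \<in> rng_fibre G x" using Psub by (auto simp: rng_fibre_def)
          then show "a \<in> gen j" using a(3) b by blast
        next
          assume "a \<in> gen j"
          moreover have "x = rng G a" using a(2) by (simp add: rng_fibre_def)
          ultimately show "x \<in> rng G ` (P p \<inter> gen j)" using a(1) by blast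
        qed
        ultimately show ?thesis using True selu[OF True a(1,2)] by (simp add: W_def n)
      next
        case False
        then show ?thesis by (auto simp: W_def n sel_def)
      qed
    qed
    also have "\<dots> \<in> sets (completion \<mu>)"
    proof -
      have "(unit_space G - {x. uniq p x}) \<inter> gen j = (unit_space G \<inter> gen j) - {x. uniq p x}" by auto
      moreover have "unit_space G \<inter> gen j \<in> sets \<mu>" using unit_space_sets gen(2) unfolding sets_base_iff by auto
      ultimately have "(unit_space G - {x. uniq p x}) \<inter> gen j \<in> sets (completion \<mu>)"
        using sets.Diff[OF sets_completionI_sets one] by simp
      moreover have "{x. uniq p x} \<inter> rng G ` (P p \<inter> gen j) \<in> sets (completion \<mu>)"
        by (intro sets.Int one rng_image P gen(2))
      ultimately show ?thesis by (intro sets.Un)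
    qed
    finally show ?thesis .
  qed
  then obtain S where S: "\<forall>n. S n \<in> sets \<mu>" "AE x in \<mu>. \<forall>n. x \<in> W n \<longleftrightarrow> x \<in> S n"
    using completion_sets_AE[of W \<mu>] by blast
  have "AE x in \<mu>. (\<forall>n. x \<in> W n \<longleftrightarrow> x \<in> S n) \<and> Q x \<and>
      (\<forall>a\<in>rng_fibre G x. \<exists>p. a \<in> P p \<and> (\<forall>b\<in>rng_fibre G x. b \<in> P p \<longrightarrow> b = a))"
    using S(2) Q iso by eventually_elim blast
  then obtain U where U: "U \<in> sets \<mu>" "space \<mu> - U \<in> null_sets \<mu>"
    "\<And>x. x \<in> U \<Longrightarrow> (\<forall>n. x \<in> W n \<longleftrightarrow> x \<in> S n) \<and> Q x \<and>
      (\<forall>a\<in>rng_fibre G x. \<exists>p. a \<in> P p \<and> (\<forall>b\<in>rng_fibre G x. b \<in> P p \<longrightarrow> b = a))"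
    "\<And>a. a \<in> arrows G \<Longrightarrow> rng G a \<in> U \<longleftrightarrow> src G a \<in> U"
    by (rule invariant_conull) blast
  have UX: "U \<subseteq> unit_space G" "U \<in> sets (borel_str G)" "U \<subseteq> arrows G"
    using U(1) sets_base_iff units_subset by auto
  show thesis
  proof
    show "sel m \<in> restrict_space (borel_str G) U \<rightarrow>\<^sub>M borel_str G" for m
    proof (cases m)
      case 0
      have "(\<lambda>x. x) \<in> restrict_space (borel_str G) U \<rightarrow>\<^sub>M borel_str G"
        by (intro measurable_restrict_space1 measurable_ident_sets refl)
      then show ?thesis using 0 by (simp add: sel_def[abs_def])
    next
      case (Suc p)
      show ?thesis
      proof (rule measurable_sigma_sets[OF gen(1)])
        show "range gen \<subseteq> Pow (arrows G)" using sets.sets_into_space[OF gen(2)] by blast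
        show "sel m \<in> space (restrict_space (borel_str G) U) \<rightarrow> arrows G"
          using selin UX by (auto simp: space_restrict_space rng_fibre_def)
        fix B assume "B \<in> range gen"
        then obtain j where j: "B = gen j" by blast
        have "sel m -` B \<inter> space (restrict_space (borel_str G) U) = S (prod_encode (p, j)) \<inter> U"
        proof (intro Set.set_eqI)
          fix x
          have "x \<in> W (prod_encode (p, j)) \<longleftrightarrow> x \<in> unit_space G \<and> sel m x \<in> gen j" by (simp add: W_def Suc)
          then show "x \<in> sel m -` B \<inter> space (restrict_space (borel_str G) U) \<longleftrightarrow> x \<in> S (prod_encode (p, j)) \<inter> U"
            using U(3)[of x] UX j by (auto simp: space_restrict_space)
        qed
        then show "sel m -` B \<inter> space (restrict_space (borel_str G) U) \<in> sets (restrict_space (borel_str G) U)"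
          using S(1) UX sets_base_iff by (subst sets_restrict_space_iff) auto
      qed
    qed
    show "sel m x \<in> rng_fibre G x" if "x \<in> U" for m x using selin that UX by blast
    show "sel 0 x = x" for x by (simp add: sel_def)
    show "\<exists>m. sel m x = a" if x: "x \<in> U" and a: "a \<in> rng_fibre G x" for x a
    proof -
      obtain p where p: "a \<in> P p" "\<forall>b\<in>rng_fibre G x. b \<in> P p \<longrightarrow> b = a" using U(3)[OF x] a by blast
      then have "uniq p x" using a unfolding uniq_def by blast
      then show ?thesis using selu p a by blast
    qed
  qed (use U in blast)+
qed

end

section \<open>Coding pairs of a function and an arrow; translation of codes\<close>

locale positive_definite_sequence = countable_measured_groupoid G \<mu>
  for G :: "'g groupoid" and \<mu> :: "'g measure" +
  fixes F :: "nat \<Rightarrow> 'g \<Rightarrow> complex" and U :: "'g set" and sel :: "nat \<Rightarrow> 'g \<Rightarrow> 'g"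
  assumes U_sets: "U \<in> sets \<mu>" and U_conull: "space \<mu> - U \<in> null_sets \<mu>"
    and U_inv: "a \<in> arrows G \<Longrightarrow> rng G a \<in> U \<longleftrightarrow> src G a \<in> U"
    and sel_measurable: "sel m \<in> restrict_space (borel_str G) U \<rightarrow>\<^sub>M borel_str G"
    and sel_fibre: "x \<in> U \<Longrightarrow> sel m x \<in> rng_fibre G x"
    and sel_0: "x \<in> U \<Longrightarrow> sel 0 x = x"
    and sel_onto: "x \<in> U \<Longrightarrow> a \<in> rng_fibre G x \<Longrightarrow> \<exists>m. sel m x = a"
    and F_measurable: "F n \<in> borel_measurable (borel_str G)"
    and F_psd: "x \<in> U \<Longrightarrow> (\<And>i. i < k \<Longrightarrow> g i \<in> rng_fibre G x) \<Longrightarrow>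
       psd_matrix k (\<lambda>i j. F n (gmult G (ginv G (g i)) (g j)))"
    and F_unit: "x \<in> U \<Longrightarrow> F n x = 1"
    and F_finite: "x \<in> U \<Longrightarrow> 0 < e \<Longrightarrow> finite {b \<in> src_fibre G x. e < cmod (F n b)}"
    and F_lim: "AE a in src_measure G \<mu>. (\<lambda>n. F n a) \<longlonglongrightarrow> 1"
begin

abbreviation MU :: "'g measure" where "MU \<equiv> restrict_space (borel_str G) U"

lemma U_sub: "U \<subseteq> unit_space G" "U \<in> sets (borel_str G)" "U \<subseteq> arrows G"
  using U_sets sets_base_iff units_subset by auto

lemma space_MU: "space MU = U" using U_sub by (auto simp: space_restrict_space)

lemma sel_arrow: "x \<in> U \<Longrightarrow> sel m x \<in> arrows G" "x \<in> U \<Longrightarrow> rng G (sel m x) = x"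
  using sel_fibre by (auto simp: rng_fibre_def)

text \<open>Since \<open>sel\<close> may list an arrow repeatedly, a canonical index is needed; the
  least one depends measurably on the arrow.\<close>

definition idx :: "'g \<Rightarrow> nat" where
  "idx a = (LEAST m. sel m (rng G a) = a)"

lemma sel_idx: "a \<in> arrows G \<Longrightarrow> rng G a \<in> U \<Longrightarrow> sel (idx a) (rng G a) = a"
proof -
  assume "a \<in> arrows G" "rng G a \<in> U"
  then have "\<exists>m. sel m (rng G a) = a" by (intro sel_onto) (simp_all add: rng_fibre_def)
  then show ?thesis unfolding idx_def by (rule LeastI_ex)
qed

lemma idx_unit: "x \<in> U \<Longrightarrow> idx x = 0"
  unfolding idx_def using sel_0 U_sub rng_of_unit by (intro Least_eq_0) auto

definition lv :: "nat \<Rightarrow> nat" where "lv i = fst (prod_decode i)"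
definition ar :: "'g \<Rightarrow> nat \<Rightarrow> 'g" where "ar x i = sel (snd (prod_decode i)) x"

lemma lv_encode [simp]: "lv (prod_encode (n, m)) = n" by (simp add: lv_def)
lemma ar_encode [simp]: "ar x (prod_encode (n, m)) = sel m x" by (simp add: ar_def)

lemma ar_arrow: "x \<in> U \<Longrightarrow> ar x i \<in> arrows G" "x \<in> U \<Longrightarrow> rng G (ar x i) = x"
  unfolding ar_def using sel_arrow by auto

text \<open>The Gram matrix of the vectors \<open>\<pi>\<^sub>n(a) \<xi>\<^sub>n(s(a))\<close>, \<open>r(a) = x\<close>, in the direct sum of the GNS
  spaces of the functions \<open>F n\<close>. The pair of \<open>n\<close> and the arrow \<open>a\<close> is coded by a natural number.\<close>

definition ker :: "'g \<Rightarrow> nat \<Rightarrow> nat \<Rightarrow> complex" where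
  "ker x i j = (if lv i = lv j then F (lv i) (gmult G (ginv G (ar x i)) (ar x j)) else 0)"

text \<open>Different levels are orthogonal, so the form splits into finitely many blocks
  \<open>q n\<close>, each a form of \<open>F n\<close> on the fibre.\<close>

lemma pd_ker:
  assumes x: "x \<in> U" shows "pd_kernel (ker x)"
  unfolding pd_kernel_def psd_matrix_def Let_def
proof (intro allI)
  fix k and c :: "nat \<Rightarrow> complex"
  define N where "N = Suc (\<Sum>i<k. lv i)"
  have N: "lv i < N" if "i < k" for i
    unfolding N_def using member_le_sum[of i "{..<k}" lv] that by (simp add: less_Suc_eq_le)
  define d where "d n i = (if lv i = n then c i else 0)" for n i
  define q where "q n = (\<Sum>i<k. \<Sum>j<k. cnj (d n i) * F n (gmult G (ginv G (ar x i)) (ar x j)) * d n j)" for n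
  have q: "Im (q n) = 0" "0 \<le> Re (q n)" for n
    using F_psd[OF x, of k "ar x" n] ar_arrow[OF x] unfolding psd_matrix_def q_def Let_def
    by (auto simp: rng_fibre_def)
  have "(\<Sum>i<k. \<Sum>j<k. cnj (c i) * ker x i j * c j)
    = (\<Sum>i<k. \<Sum>j<k. \<Sum>n<N. cnj (d n i) * F n (gmult G (ginv G (ar x i)) (ar x j)) * d n j)"
  proof (intro sum.cong refl)
    fix i j assume "i \<in> {..<k}"
    then have i: "lv i < N" using N by simp
    have "(\<Sum>n<N. cnj (d n i) * F n (gmult G (ginv G (ar x i)) (ar x j)) * d n j)
      = (\<Sum>n<N. if n = lv i then cnj (c i) * ker x i j * c j else 0)"
      by (intro sum.cong) (auto simp: d_def ker_def)
    then show "cnj (c i) * ker x i j * c j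
        = (\<Sum>n<N. cnj (d n i) * F n (gmult G (ginv G (ar x i)) (ar x j)) * d n j)"
      using i by simp
  qed
  also have "\<dots> = (\<Sum>i<k. \<Sum>n<N. \<Sum>j<k. cnj (d n i) * F n (gmult G (ginv G (ar x i)) (ar x j)) * d n j)"
    by (intro sum.cong refl sum.swap)
  also have "\<dots> = (\<Sum>n<N. q n)" unfolding q_def by (rule sum.swap)
  finally show "Im (\<Sum>i<k. \<Sum>j<k. cnj (c i) * ker x i j * c j) = 0 \<and>
      0 \<le> Re (\<Sum>i<k. \<Sum>j<k. cnj (c i) * ker x i j * c j)"
    using q by (simp add: sum_nonneg)
qed

lemma ker_diag: "x \<in> U \<Longrightarrow> ker x i i = 1"
  using ar_arrow[of x i] U_inv[of "ar x i"] by (simp add: ker_def inv_mult F_unit)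

lemma rk_idx:
  assumes x: "x \<in> U" and f: "f \<in> rk (ker x)"
  shows "f (prod_encode (n, idx (sel m x))) = f (prod_encode (n, m))"
proof -
  have "sel (idx (sel m x)) x = sel m x" using sel_idx[of "sel m x"] sel_arrow[OF x] x by simp
  then show ?thesis by (intro rk_consistent[OF f]) (simp_all add: ker_def)
qed

text \<open>Left translation by the inverse of \<open>a\<close>, carried out on codes with the level
  kept. Composing with it is the left regular action, whose value at an arrow \<open>b\<close> is
  the value at \<open>gmult G (ginv G a) b\<close>.\<close>

definition shift :: "'g \<Rightarrow> nat \<Rightarrow> nat" where
  "shift a i = prod_encode (lv i, idx (gmult G (ginv G a) (ar (rng G a) i)))"

lemma lv_shift [simp]: "lv (shift a i) = lv i" by (simp add: shift_def)

lemma ar_shift: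
  assumes a: "a \<in> arrows G" "rng G a \<in> U"
  shows "ar (src G a) (shift a i) = gmult G (ginv G a) (ar (rng G a) i)"
  using sel_idx[of "gmult G (ginv G a) (ar (rng G a) i)"] left_quot[OF a(1), of "ar (rng G a) i"]
    ar_arrow[OF a(2)] U_inv[OF a(1)] a
  by (simp add: shift_def)

lemma ker_shift:
  assumes a: "a \<in> arrows G" "rng G a \<in> U"
  shows "ker (src G a) (shift a i) (shift a j) = ker (rng G a) i j"
  unfolding ker_def ar_shift[OF a] using ar_arrow[OF a(2)] by (simp add: left_quot_left_quot a)

text \<open>On codes the composition leads only to the least code of the same arrow, which
  \<open>rk_idx\<close> shows to be invisible to functions of the space.\<close>

lemma shift_shift_inv:
  assumes a: "a \<in> arrows G" "rng G a \<in> U" and f: "f \<in> rk (ker (src G a))"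
  shows "f (shift a (shift (ginv G a) i)) = f i"
proof -
  have x: "src G a \<in> U" using U_inv a by simp
  obtain n m where i: "i = prod_encode (n, m)" by (metis prod_decode_inverse surj_pair)
  have "ar (rng G a) (shift (ginv G a) i) = gmult G a (sel m (src G a))"
    using ar_shift[of "ginv G a" i] a x by (simp add: inv_closed rng_inv src_inv ginv_ginv i)
  then have "shift a (shift (ginv G a) i) = prod_encode (n, idx (sel m (src G a)))"
    unfolding shift_def[of a] using inv_left_quot[OF a(1), of "sel m (src G a)"] sel_arrow[OF x]
    by (simp add: i)
  then show ?thesis using rk_idx[OF x f] i by simp
qed

lemma act_unitary:
  assumes a: "a \<in> arrows G" "rng G a \<in> U"
  shows "unitary (rkhs (ker (src G a))) (rkhs (ker (rng G a))) (\<lambda>f i. f (shift a i))"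
proof (rule rkhs_reindex_unitary[where \<tau> = "shift (ginv G a)"])
  have x: "src G a \<in> U" using U_inv a by simp
  show "pd_kernel (ker (src G a))" "pd_kernel (ker (rng G a))" using pd_ker x a by auto
  show "ker (src G a) (shift a i) (shift a j) = ker (rng G a) i j" for i j by (rule ker_shift[OF a])
  show "ker (rng G a) (shift (ginv G a) i) (shift (ginv G a) j) = ker (src G a) i j" for i j
    using ker_shift[of "ginv G a" i j] a x by (simp add: inv_closed rng_inv src_inv)
  show "f (shift a (shift (ginv G a) i)) = f i" if "f \<in> rk (ker (src G a))" for f i
    by (rule shift_shift_inv[OF a that])
  show "f (shift (ginv G a) (shift a i)) = f i" if "f \<in> rk (ker (rng G a))" for f i
    using shift_shift_inv[of "ginv G a" f i] a x that by (simp add: inv_closed rng_inv src_inv ginv_ginv)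
qed

text \<open>Here equality holds on the codes themselves: a shifted code is determined by a level and
  an arrow, so a repeated code cannot interfere.\<close>

lemma shift_mult:
  assumes a: "a \<in> arrows G" "rng G a \<in> U" and b: "b \<in> arrows G" "src G a = rng G b"
  shows "shift (gmult G a b) i = shift b (shift a i)"
  unfolding shift_def[of "gmult G a b"] shift_def[of b]
  using mult_inv_left_quot[OF a(1) b, of "ar (rng G a) i"] ar_arrow[OF a(2)] ar_shift[OF a, of i]
  by (simp add: rng_mult[OF composableI[OF a(1) b]] b(2)[symmetric])

section \<open>The representation and its almost invariant sections\<close>

definition rep :: "('g, nat \<Rightarrow> complex) groupoid_rep" where
  "rep = \<lparr>base = U, fibre = (\<lambda>x. rkhs (ker x)),
     sections = {\<xi>. (\<forall>x\<in>U. \<xi> x \<in> rk (ker x)) \<and> (\<forall>i. (\<lambda>x. \<xi> x i) \<in> borel_measurable MU)},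
     act = (\<lambda>a f i. f (shift a i))\<rparr>"

lemma rep_simps [simp]:
  "base rep = U" "fibre rep x = rkhs (ker x)" "act rep a = (\<lambda>f i. f (shift a i))"
  "\<xi> \<in> sections rep \<longleftrightarrow> (\<forall>x\<in>U. \<xi> x \<in> rk (ker x)) \<and> (\<forall>i. (\<lambda>x. \<xi> x i) \<in> borel_measurable MU)"
  by (simp_all add: rep_def)

lemma ker_measurable: "(\<lambda>x. ker x i j) \<in> borel_measurable MU"
proof -
  have ar: "(\<lambda>x. ar x i) \<in> MU \<rightarrow>\<^sub>M borel_str G" for i unfolding ar_def using sel_measurable by simp
  have "(\<lambda>x. gmult G (ginv G (ar x i)) (ar x j)) \<in> MU \<rightarrow>\<^sub>M borel_str G"
    by (rule gmult_measurable[OF measurable_compose[OF ar inv_measurable] ar])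
      (simp add: space_MU ar_arrow src_inv)
  from measurable_compose[OF this F_measurable[of "lv i"]] show ?thesis unfolding ker_def by simp
qed

lemma rep_measurable_field: "measurable_field MU (fibre rep) (sections rep)"
  unfolding measurable_field_def space_MU
proof (intro conjI ballI allI impI)
  note ks = ker_measurable
  show "complex_hilbert_space (fibre rep x)" if "x \<in> U" for x
    using rkhs_complex_hilbert_space[OF pd_ker[OF that]] by simp
  show "sections rep \<subseteq> (\<Pi> x\<in>U. carrier (fibre rep x))" by auto
  show "(\<lambda>x. \<zero>\<^bsub>fibre rep x\<^esub>) \<in> sections rep" by (simp add: rk_zero pd_ker)
  show "(\<lambda>x. \<xi> x \<oplus>\<^bsub>fibre rep x\<^esub> \<eta> x) \<in> sections rep" if "\<xi> \<in> sections rep" "\<eta> \<in> sections rep" for \<xi> \<eta>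
    using that by (auto intro!: rk_add borel_measurable_add)
  show "(\<lambda>x. c \<odot>\<^bsub>fibre rep x\<^esub> \<xi> x) \<in> sections rep" if "\<xi> \<in> sections rep" for c \<xi>
    using that by (auto intro!: rk_scale borel_measurable_times)
  show "(\<lambda>x. hnorm (fibre rep x) (\<xi> x)) \<in> borel_measurable MU" if "\<xi> \<in> sections rep" for \<xi>
    unfolding hnorm_def using measurable_ip[of ker MU \<xi> \<xi>, OF ks] that by simp
  show "\<eta> \<in> sections rep" if eta: "\<eta> \<in> (\<Pi> x\<in>U. carrier (fibre rep x))"
    and test: "\<forall>\<xi>\<in>sections rep. (\<lambda>x. cinner (fibre rep x) (\<xi> x) (\<eta> x)) \<in> borel_measurable MU" for \<eta>
  proof -
    have er: "\<eta> x \<in> rk (ker x)" if "x \<in> U" for x using eta that by auto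
    have "(\<lambda>x. \<eta> x j) \<in> borel_measurable MU" for j
    proof -
      \<comment> \<open>Evaluation at \<open>j\<close> is the inner product with column
        \<open>j\<close>, so testing against the sections of columns recovers every coordinate of
        \<open>\<eta>\<close>.\<close>
      have "(\<lambda>x i. ker x i j) \<in> sections rep" using ks by (auto intro: col_rk pd_ker)
      with test have "(\<lambda>x. ip (ker x) (\<lambda>i. ker x i j) (\<eta> x)) \<in> borel_measurable MU" by auto
      then have "(\<lambda>x. cnj (ip (ker x) (\<lambda>i. ker x i j) (\<eta> x))) \<in> borel_measurable MU"
        by (rule measurable_cnj)
      moreover have "cnj (ip (ker x) (\<lambda>i. ker x i j) (\<eta> x)) = \<eta> x j" if "x \<in> space MU" for x
      proof -
        have x: "x \<in> U" using that by (simp only: space_MU)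
        note K = pd_ker[OF x]
        show ?thesis using ip_cnj[OF K col_rk[OF K] er[OF x], of j] ip_col[OF K er[OF x], of j] by simp
      qed
      ultimately show ?thesis by (simp cong: measurable_cong)
    qed
    then show ?thesis using er by simp
  qed
  show "\<exists>f. (\<forall>n. f n \<in> sections rep) \<and> (\<forall>x\<in>U. total_sequence (fibre rep x) (\<lambda>n. f n x))"
    using measurable_onv[of ker MU, OF ks] total_sequence_onv[OF pd_ker]
    by (intro exI[of _ "\<lambda>n x. onv (ker x) n"]) (auto intro: onv_rk pd_ker)
qed

lemma reduction_U: "reduction G U = {a \<in> arrows G. rng G a \<in> U}"
  unfolding reduction_def using U_inv by auto

lemma reduction_sets: "reduction G U \<in> sets (borel_str G)"
proof -
  have "reduction G U = rng G -` U \<inter> arrows G" unfolding reduction_U by auto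
  then show ?thesis using vimage_rng[OF U_sub(2)] by simp
qed

abbreviation MR :: "'g measure" where "MR \<equiv> restrict_space (borel_str G) (reduction G U)"

lemma space_MR: "space MR = reduction G U"
  using sets.sets_into_space[OF reduction_sets] by (auto simp: space_restrict_space)

lemma rng_MR: "rng G \<in> MR \<rightarrow>\<^sub>M MU"
  by (rule measurable_restrict_space2[OF _ measurable_restrict_space1[OF rng_measurable]])
    (unfold space_MR, simp add: reduction_def)

lemma src_MR: "src G \<in> MR \<rightarrow>\<^sub>M MU"
  by (rule measurable_restrict_space2[OF _ measurable_restrict_space1[OF src_measurable]])
    (unfold space_MR, simp add: reduction_def)

text \<open>The index is the least solution of an equation between Borel maps. As codes range over a
  countable set, this allows \<open>rep_representation\<close> to compose the coordinates of a
  section with the shift.\<close>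

lemma shift_measurable: "(\<lambda>a. shift a i) \<in> MR \<rightarrow>\<^sub>M count_space UNIV"
proof -
  let ?q = "\<lambda>a. gmult G (ginv G a) (ar (rng G a) i)"
  have id: "(\<lambda>a. a) \<in> MR \<rightarrow>\<^sub>M borel_str G"
    by (intro measurable_restrict_space1 measurable_ident_sets refl)
  have sel: "(\<lambda>a. sel m (rng G a)) \<in> MR \<rightarrow>\<^sub>M borel_str G" for m
    by (rule measurable_compose[OF rng_MR sel_measurable])
  have q: "?q \<in> MR \<rightarrow>\<^sub>M borel_str G"
  proof (rule gmult_measurable)
    show "(\<lambda>a. ginv G a) \<in> MR \<rightarrow>\<^sub>M borel_str G" by (rule measurable_compose[OF id inv_measurable])
    show "(\<lambda>a. ar (rng G a) i) \<in> MR \<rightarrow>\<^sub>M borel_str G" unfolding ar_def by (rule sel)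
  qed (unfold space_MR, simp add: reduction_U ar_arrow src_inv)
  have rq: "rng G (?q a) = src G a" if "a \<in> reduction G U" for a
    using that left_quot(2)[of a "ar (rng G a) i"] ar_arrow[of "rng G a" i] by (simp add: reduction_U)
  have "Measurable.pred MR (\<lambda>a. sel m (src G a) = ?q a)" for m
    using eq_set_measurable[OF measurable_compose[OF src_MR sel_measurable[of m]] q]
    by (simp add: pred_def)
  then have "(\<lambda>a. LEAST m. sel m (src G a) = ?q a) \<in> MR \<rightarrow>\<^sub>M count_space UNIV" by (rule measurable_Least)
  then have "(\<lambda>a. prod_encode (lv i, LEAST m. sel m (src G a) = ?q a)) \<in> MR \<rightarrow>\<^sub>M count_space UNIV"
    by (rule measurable_compose) simp
  moreover have "shift a i = prod_encode (lv i, LEAST m. sel m (src G a) = ?q a)" if "a \<in> space MR" for a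
    using rq that by (simp add: space_MR shift_def idx_def)
  ultimately show ?thesis by (simp cong: measurable_cong)
qed

lemma rep_representation: "representation G \<mu> rep"
  unfolding representation_def
proof (intro conjI ballI impI allI)
  show "base rep \<in> sets \<mu>" "space \<mu> - base rep \<in> null_sets \<mu>" using U_sets U_conull by simp_all
  show "measurable_field (restrict_space (borel_str G) (base rep)) (fibre rep) (sections rep)"
    using rep_measurable_field by simp
  show "unitary (fibre rep (src G a)) (fibre rep (rng G a)) (act rep a)" if "a \<in> reduction G (base rep)" for a
    using act_unitary[of a] that by (simp add: reduction_U)
  show "act rep (gmult G a b) v = act rep a (act rep b v)"
    if "a \<in> reduction G (base rep)" "b \<in> reduction G (base rep)" "src G a = rng G b" for a b v
    using that by (simp add: reduction_U shift_mult)
  fix \<xi> \<eta> assume xi: "\<xi> \<in> sections rep" and eta: "\<eta> \<in> sections rep"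
  have "(\<lambda>a. ip (ker (rng G a)) (\<lambda>i. \<xi> (src G a) (shift a i)) (\<eta> (rng G a))) \<in> borel_measurable MR"
  proof (rule measurable_ip[of "\<lambda>a. ker (rng G a)" MR "\<lambda>a i. \<xi> (src G a) (shift a i)" "\<lambda>a. \<eta> (rng G a)"])
    show "(\<lambda>a. ker (rng G a) i j) \<in> borel_measurable MR" for i j
      by (rule measurable_compose[OF rng_MR ker_measurable])
    show "(\<lambda>a. \<eta> (rng G a) i) \<in> borel_measurable MR" for i
      using eta by (intro measurable_compose[OF rng_MR, of "\<lambda>x. \<eta> x i"]) simp
    have "(\<lambda>a. \<xi> (src G a) j) \<in> borel_measurable MR" for j
      using xi by (intro measurable_compose[OF src_MR, of "\<lambda>x. \<xi> x j"]) simp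
    then show "(\<lambda>a. \<xi> (src G a) (shift a i)) \<in> borel_measurable MR" for i
      by (rule measurable_compose_countable[OF _ shift_measurable])
  qed
  then show "(\<lambda>a. cinner (fibre rep (rng G a)) (act rep a (\<xi> (src G a))) (\<eta> (rng G a)))
      \<in> borel_measurable (restrict_space (borel_str G) (reduction G (base rep)))"
    by simp
qed

lemma rep_almost_invariant: "almost_unit_invariant G \<mu> rep"
  unfolding almost_unit_invariant_def
proof (intro exI conjI allI)
  \<comment> \<open>The code \<open>(n, 0)\<close> belongs to the unit \<open>x\<close> because
    \<open>sel 0 x = x\<close>; so this is the cyclic section of \<open>F n\<close>.\<close>
  let ?\<xi> = "\<lambda>n x i. ker x i (prod_encode (n, 0))"
  show "unit_section \<mu> rep (?\<xi> n)" for n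
    unfolding unit_section_def using ker_measurable
    by (auto intro!: AE_I2 col_rk pd_ker simp: hnorm_rkhs[OF pd_ker col_rk[OF pd_ker]] nsq_col[OF pd_ker] ker_diag)
  show "AE a in src_measure G \<mu>. a \<in> reduction G (base rep) \<longrightarrow>
      (\<lambda>n. hnorm (fibre rep (rng G a)) (act rep a (?\<xi> n (src G a)) \<ominus>\<^bsub>fibre rep (rng G a)\<^esub> ?\<xi> n (rng G a))) \<longlonglongrightarrow> 0"
    using AE_inv[OF F_lim]
  proof eventually_elim
    case (elim a)
    show ?case
    proof
      assume "a \<in> reduction G (base rep)"
      then have a: "a \<in> arrows G" "rng G a \<in> U" by (auto simp: reduction_U)
      then have x: "src G a \<in> U" using U_inv by simp
      note K = pd_ker[OF a(2)]
      \<comment> \<open>Translation by \<open>a\<close> moves the cyclic vector to the column of the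
        code of \<open>a\<close>. The squared distance of two unit vectors is 2 minus twice the real
        part of their inner product, here \<open>F n\<close> at the inverse of \<open>a\<close>;
        hence the use of \<open>AE_inv\<close>.\<close>
      have "hnorm (fibre rep (rng G a)) (act rep a (?\<xi> n (src G a)) \<ominus>\<^bsub>fibre rep (rng G a)\<^esub> ?\<xi> n (rng G a))
        = sqrt (2 - 2 * Re (F n (ginv G a)))" for n
      proof -
        let ?j = "prod_encode (n, idx a)" and ?l = "prod_encode (n, 0)"
        have "shift a ?j = ?l"
          using sel_idx[OF a] inv_mult[OF a(1)] idx_unit[OF x] by (simp add: shift_def)
        then have e: "act rep a (?\<xi> n (src G a)) = (\<lambda>i. ker (rng G a) i ?j)"
          using ker_shift[OF a, of _ ?j] by (simp add: fun_eq_iff)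
        have "ker (rng G a) ?j ?l = F n (ginv G a)"
          using sel_idx[OF a] sel_0[OF a(2)] mult_src[OF inv_closed[OF a(1)]] src_inv[OF a(1)] by (simp add: ker_def)
        then have "nsq (ker (rng G a)) (\<lambda>i. ker (rng G a) i ?j - ker (rng G a) i ?l) = 2 - 2 * Re (F n (ginv G a))"
          unfolding nsq_col_diff[OF K] ker_diag[OF a(2)] by simp
        then show ?thesis
          unfolding e using rkhs_minus[OF K col_rk[OF K] col_rk[OF K]] hnorm_rkhs[OF K rk_diff[OF col_rk[OF K] col_rk[OF K]]]
          by simp
      qed
      moreover have "(\<lambda>n. sqrt (2 - 2 * Re (F n (ginv G a)))) \<longlonglongrightarrow> sqrt (2 - 2 * Re 1)"
        by (intro tendsto_intros elim)
      ultimately show "(\<lambda>n. hnorm (fibre rep (rng G a)) (act rep a (?\<xi> n (src G a)) \<ominus>\<^bsub>fibre rep (rng G a)\<^esub> ?\<xi> n (rng G a))) \<longlonglongrightarrow> 0"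
        by simp
    qed
  qed
qed

section \<open>Decay of coefficients and the contradiction with property (T)\<close>

lemma finite_large_coefficients:
  assumes x: "x \<in> U" and f: "f \<in> rk (ker x)" and e: "0 < e"
  shows "finite {a \<in> rng_fibre G x. e \<le> cmod (f (prod_encode (n, idx a)))}"
proof -
  define I where "I = (\<lambda>a. prod_encode (n, idx a)) ` rng_fibre G x"
  have arr: "a \<in> arrows G" "rng G a = x" if "a \<in> rng_fibre G x" for a using that by (auto simp: rng_fibre_def)
  have sel: "sel (idx a) x = a" if "a \<in> rng_fibre G x" for a using sel_idx[of a] arr[OF that] x by simp
  \<comment> \<open>At the code of \<open>a\<close>, column \<open>j\<close> is 0 or the value of
    \<open>F n\<close> at the quotient of \<open>a\<close> and \<open>ar x j\<close>. These
    quotients are distinct arrows of one source fibre, where \<open>F n\<close> is large only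
    finitely often.\<close>
  have lim: "((\<lambda>i. ker x i j) \<longlongrightarrow> 0) (inf cofinite (principal I))" for j
  proof (rule tendstoI)
    fix e :: real assume e: "0 < e"
    let ?g = "ar x j" and ?h = "\<lambda>a. gmult G (ginv G a) (ar x j)"
    have g: "?g \<in> arrows G" "rng G ?g = x" using ar_arrow[OF x] by auto
    then have y: "src G ?g \<in> U" using U_inv x by metis
    \<comment> \<open>Half of \<open>e\<close>, because \<open>F_finite\<close> counts strict
      inequalities whereas failure of the limit gives
      \<open>e \<le> cmod (ker x i j)\<close>.\<close>
    have "finite {a \<in> rng_fibre G x. e / 2 < cmod (F n (?h a))}" (is "finite ?A")
    proof (rule finite_imageD)
      have "?h ` ?A \<subseteq> {b \<in> src_fibre G (src G ?g). e / 2 < cmod (F n b)}"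
        using left_quot[OF _ g(1)] arr g by (auto simp: src_fibre_def)
      then show "finite (?h ` ?A)" using F_finite[OF y, of "e / 2"] e by (auto intro: finite_subset)
      show "inj_on ?h ?A"
      proof (rule inj_onI)
        fix a b assume ab: "a \<in> ?A" "b \<in> ?A" "?h a = ?h b"
        have eq: "gmult G ?g (ginv G (?h a)) = a" if "a \<in> ?A" for a
          using that arr[of a] g mult_left_quot[OF g(1), of a] inv_left_quot_eq[of a ?g] by simp
        have "a = gmult G ?g (ginv G (?h a))" by (rule eq[OF ab(1), symmetric])
        also have "\<dots> = b" unfolding ab(3) by (rule eq[OF ab(2)])
        finally show "a = b" .
      qed
    qed
    moreover have "{i. \<not> (i \<in> I \<longrightarrow> dist (ker x i j) 0 < e)} \<subseteq> (\<lambda>a. prod_encode (n, idx a)) ` ?A"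
    proof
      fix i assume "i \<in> {i. \<not> (i \<in> I \<longrightarrow> dist (ker x i j) 0 < e)}"
      then obtain a where a: "a \<in> rng_fibre G x" "i = prod_encode (n, idx a)" "e \<le> cmod (ker x i j)"
        by (auto simp: I_def)
      then have "lv j = n" using e by (auto simp: ker_def split: if_splits)
      then have "ker x i j = F n (?h a)" using a sel[OF a(1)] by (simp add: ker_def)
      then show "i \<in> (\<lambda>a. prod_encode (n, idx a)) ` ?A" using a e by auto
    qed
    ultimately show "\<forall>\<^sub>F i in inf cofinite (principal I). dist (ker x i j) 0 < e"
      unfolding eventually_inf_principal eventually_cofinite by (meson finite_imageI finite_subset)
  qed
  have "(f \<longlongrightarrow> 0) (inf cofinite (principal I))"
    by (rule rk_vanish[OF pd_ker[OF x] lim _ f]) (simp add: ker_diag[OF x])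
  from tendstoD[OF this e] have "finite {i. \<not> (i \<in> I \<longrightarrow> dist (f i) 0 < e)}"
    unfolding eventually_inf_principal eventually_cofinite .
  then have fin: "finite {i \<in> I. e \<le> cmod (f i)}" by (rule rev_finite_subset) auto
  show ?thesis
  proof (rule finite_imageD)
    show "finite ((\<lambda>a. prod_encode (n, idx a)) ` {a \<in> rng_fibre G x. e \<le> cmod (f (prod_encode (n, idx a)))})"
      by (rule finite_subset[OF _ fin]) (auto simp: I_def)
    show "inj_on (\<lambda>a. prod_encode (n, idx a)) {a \<in> rng_fibre G x. e \<le> cmod (f (prod_encode (n, idx a)))}"
    proof (rule inj_onI)
      fix a b assume ab: "a \<in> {a \<in> rng_fibre G x. e \<le> cmod (f (prod_encode (n, idx a)))}"
        "b \<in> {a \<in> rng_fibre G x. e \<le> cmod (f (prod_encode (n, idx a)))}"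
        "prod_encode (n, idx a) = prod_encode (n, idx b)"
      have "a = sel (idx a) x" using sel ab(1) by simp
      also have "idx a = idx b" using ab(3) by simp
      also have "sel (idx b) x = b" using sel ab(2) by simp
      finally show "a = b" .
    qed
  qed
qed

lemma AE_U: "AE x in \<mu>. x \<in> U"
  using U_conull by (intro AE_I'[of "space \<mu> - U"]) auto

lemma not_property_T:
  assumes erg: "ergodic G \<mu>" and dif: "diffuse \<mu>"
  shows "\<not> property_T G \<mu>"
proof
  assume "property_T G \<mu>"
  then obtain \<eta> where unit: "unit_section \<mu> rep \<eta>" and inv: "invariant_section G \<mu> rep \<eta>"
    unfolding property_T_def using rep_representation rep_almost_invariant by blast
  have sec: "\<And>x. x \<in> U \<Longrightarrow> \<eta> x \<in> rk (ker x)" "\<And>i. (\<lambda>x. \<eta> x i) \<in> borel_measurable MU"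
    using unit unfolding unit_section_def by auto
  have norm: "AE x in \<mu>. x \<in> U \<longrightarrow> nsq (ker x) (\<eta> x) = 1"
  proof -
    have "AE x in \<mu>. x \<in> U \<longrightarrow> hnorm (rkhs (ker x)) (\<eta> x) = 1" using unit unfolding unit_section_def by simp
    then show ?thesis by eventually_elim (simp add: hnorm_rkhs[OF pd_ker sec(1)])
  qed
  have coef: "AE x in \<mu>. x \<in> U \<longrightarrow> (\<forall>a\<in>rng_fibre G x. \<forall>n.
      \<eta> x (prod_encode (n, idx a)) = \<eta> (src G a) (prod_encode (n, 0)))"
    using AE_rng_fibre[OF inv[unfolded invariant_section_def]]
  proof eventually_elim
    case (elim x)
    show ?case
    proof (intro impI ballI allI)
      fix a n assume x: "x \<in> U" and "a \<in> rng_fibre G x"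
      then have a: "a \<in> arrows G" "rng G a \<in> U" "rng G a = x" by (auto simp: rng_fibre_def)
      then have y: "src G a \<in> U" using U_inv[OF a(1)] by blast
      \<comment> \<open>Invariance is evaluated at the code of \<open>a\<close>, which the shift by
        \<open>a\<close> sends to the code of the unit \<open>src G a\<close>.\<close>
      have "act rep a (\<eta> (src G a)) = \<eta> (rng G a)"
        using elim \<open>a \<in> rng_fibre G x\<close> a by (simp add: reduction_U)
      then have "\<eta> (src G a) (shift a (prod_encode (n, idx a))) = \<eta> x (prod_encode (n, idx a))"
        using a(3) by (metis rep_simps(3))
      moreover have "shift a (prod_encode (n, idx a)) = prod_encode (n, 0)"
        using sel_idx[OF a(1,2)] inv_mult[OF a(1)] idx_unit[OF y] by (simp add: shift_def)
      ultimately show "\<eta> x (prod_encode (n, idx a)) = \<eta> (src G a) (prod_encode (n, 0))" by simp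
    qed
  qed
  define E where "E n k = {y \<in> U. 1 / Suc k \<le> cmod (\<eta> y (prod_encode (n, 0)))}" for n k
  have E: "E n k \<in> sets \<mu>" for n k
  proof -
    have "{y \<in> space MU. 1 / Suc k \<le> cmod (\<eta> y (prod_encode (n, 0)))} \<in> sets MU"
      using sec(2) by measurable
    then have "E n k \<in> sets MU" unfolding E_def space_MU .
    then show ?thesis using U_sub by (subst (asm) sets_restrict_space_iff) (auto simp: sets_base_iff)
  qed
  \<comment> \<open>Otherwise \<open>\<eta>\<close> is almost everywhere orthogonal to all cyclic
    sections, and by invariance to their translates. Its values are these inner products, so
    \<open>\<eta> x = 0\<close>, against norm 1.\<close>
  have "\<exists>n k. E n k \<notin> null_sets \<mu>"
  proof (rule ccontr)
    assume "\<not> ?thesis"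
    then have "AE x in \<mu>. \<forall>n k. x \<notin> E n k" unfolding AE_all_countable by (blast intro: AE_not_in)
    then have "AE x in \<mu>. \<forall>n. x \<in> U \<longrightarrow> \<eta> x (prod_encode (n, 0)) = 0"
    proof eventually_elim
      case (elim x)
      show ?case
      proof (intro allI impI, rule ccontr)
        fix n assume "x \<in> U" "\<eta> x (prod_encode (n, 0)) \<noteq> 0"
        moreover then obtain k where "1 / Suc k < cmod (\<eta> x (prod_encode (n, 0)))"
          using nat_approx_posE by (metis of_nat_Suc zero_less_norm_iff)
        ultimately have "x \<in> E n k" by (simp add: E_def less_imp_le)
        then show False using elim by blast
      qed
    qed
    from AE_fibre_src[OF this] norm coef AE_U
    have "AE x in \<mu>. False"
    proof eventually_elim
      case (elim x)
      have "\<eta> x i = 0" for i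
      proof -
        obtain n m where i: "i = prod_encode (n, m)" by (metis prod_decode_inverse surj_pair)
        have a: "sel m x \<in> rng_fibre G x" by (rule sel_fibre[OF elim(4)])
        have "src G (sel m x) \<in> U" using U_inv[of "sel m x"] sel_arrow[OF elim(4), of m] elim(4) by simp
        then have "\<eta> x (prod_encode (n, idx (sel m x))) = 0" using elim a by auto
        then show ?thesis using rk_idx[OF elim(4) sec(1)[OF elim(4)]] i by simp
      qed
      then have "\<eta> x = (\<lambda>i. 0 * \<eta> x i)" by auto
      then have "nsq (ker x) (\<eta> x) = 0"
        using nsq_scale[OF pd_ker[OF elim(4)] sec(1)[OF elim(4)], of 0] by simp
      then show False using elim by simp
    qed
    then show False by simp
  qed
  then obtain n k where nk: "E n k \<notin> null_sets \<mu>" by blast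
  have "AE x in \<mu>. finite {a \<in> rng_fibre G x. src G a \<in> E n k}"
    using coef AE_U
  proof eventually_elim
    case (elim x)
    have "{a \<in> rng_fibre G x. src G a \<in> E n k} \<subseteq> {a \<in> rng_fibre G x. 1 / Suc k \<le> cmod (\<eta> x (prod_encode (n, idx a)))}"
      using elim by (auto simp: E_def)
    then show ?case
      using finite_large_coefficients[OF elim(2) sec(1)[OF elim(2)], of "1 / Suc k" n] by (auto intro: finite_subset)
  qed
  then show False using not_AE_finite_return[OF erg dif E nk] by blast
qed

end

section \<open>From property (H) to the enumerated situation\<close>

context countable_measured_groupoid
begin

lemma not_T_and_H:
  assumes erg: "ergodic G \<mu>" and dif: "diffuse \<mu>" and H: "property_H G \<mu>"
  shows "\<not> property_T G \<mu>"
proof -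
  obtain F :: "nat \<Rightarrow> 'g \<Rightarrow> complex" where pd: "\<And>n. positive_definite_on G \<mu> (F n)"
    and F1: "\<And>n. AE x in \<mu>. F n x = 1"
    and Ff: "\<And>n e. 0 < e \<Longrightarrow> emeasure (src_measure G \<mu>) {a \<in> arrows G. cmod (F n a) > e} < \<infinity>"
    and Fl: "AE a in src_measure G \<mu>. (\<lambda>n. F n a) \<longlonglongrightarrow> 1"
    using H unfolding property_H_def by blast
  have Fm: "F n \<in> borel_measurable (borel_str G)" for n using pd unfolding positive_definite_on_def by blast
  have Fsets: "{a \<in> arrows G. cmod (F n a) > e} \<in> sets (borel_str G)" for n e
    using Fm[of n] by measurable
  have fin: "AE x in \<mu>. \<forall>n k. finite {b \<in> src_fibre G x. 1 / Suc k < cmod (F n b)}"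
    unfolding AE_all_countable
  proof (intro allI)
    fix n k
    have "AE x in \<mu>. finite ({a \<in> arrows G. cmod (F n a) > 1 / Suc k} \<inter> src_fibre G x)"
      by (rule AE_finite_src_fibre[OF Fsets Ff]) simp
    then show "AE x in \<mu>. finite {b \<in> src_fibre G x. 1 / Suc k < cmod (F n b)}"
      by eventually_elim (erule rev_finite_subset, auto simp: src_fibre_def)
  qed
  \<comment> \<open>Only \<open>n\<close> has to be moved inside the almost-everywhere quantifier;
    the uncountably many \<open>g\<close> are inside it by definition.\<close>
  have psd: "AE x in \<mu>. \<forall>n k (g :: nat \<Rightarrow> 'g). (\<forall>i<k. g i \<in> rng_fibre G x) \<longrightarrow>
        psd_matrix k (\<lambda>i j. F n (gmult G (ginv G (g i)) (g j)))"
    by (subst AE_all_countable) (use pd in \<open>unfold positive_definite_on_def, blast\<close>)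
  have one: "AE x in \<mu>. \<forall>n. F n x = 1" unfolding AE_all_countable using F1 by blast
  \<comment> \<open>Finiteness is known on source fibres but range fibres are enumerated, hence the
    inverse. Finitely many arrows are isolated by cells of the first \<open>k\<close> generators;
    \<open>t\<close> lists the generators containing the arrow, which keeps the index set
    countable.\<close>
  define P where "P p = (case from_nat p of (n, k, t) \<Rightarrow>
     {a \<in> arrows G. 1 / 2 < cmod (F n (ginv G a))} \<inter> {a \<in> arrows G. {i. i < k \<and> a \<in> gen i} = set t})"
    for p
  have P: "P p \<in> sets (borel_str G)" for p
  proof -
    have "{a \<in> arrows G. 1 / 2 < cmod (F n (ginv G a))} \<in> sets (borel_str G)" for n
      using measurable_compose[OF inv_measurable Fm[of n]] by measurable
    then show ?thesis unfolding P_def using cell_sets by (auto split: prod.split)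
  qed
  have iso: "AE x in \<mu>. \<forall>a\<in>rng_fibre G x. \<exists>p. a \<in> P p \<and> (\<forall>b\<in>rng_fibre G x. b \<in> P p \<longrightarrow> b = a)"
    using fin AE_src_fibre[OF Fl]
  proof eventually_elim
    case (elim x)
    show ?case
    proof
      fix a assume a: "a \<in> rng_fibre G x"
      have inv: "ginv G b \<in> src_fibre G x" "ginv G (ginv G b) = b" if "b \<in> rng_fibre G x" for b
        using that by (auto simp: rng_fibre_def src_fibre_def inv_closed src_inv ginv_ginv)
      have "(\<lambda>n. cmod (F n (ginv G a))) \<longlonglongrightarrow> cmod 1"
        using elim(2) inv(1)[OF a] by (intro tendsto_norm) blast
      then have "\<forall>\<^sub>F n in sequentially. 1 / 2 < cmod (F n (ginv G a))" by (rule order_tendstoD) simp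
      then obtain n where n: "1 / 2 < cmod (F n (ginv G a))" by (auto simp: eventually_sequentially)
      define S where "S = {b \<in> rng_fibre G x. 1 / 2 < cmod (F n (ginv G b))}"
      \<comment> \<open>The index 1 in \<open>elim(1)\<close> is the threshold
        \<open>1 / Suc 1 = 1 / 2\<close>.\<close>
      have "finite (ginv G ` S)"
        by (rule finite_subset[OF _ elim(1)[rule_format, of 1 n]]) (auto simp: S_def inv)
      moreover have "inj_on (ginv G) S" by (rule inj_onI) (metis (no_types, lifting) S_def inv(2) mem_Collect_eq)
      ultimately have "finite S" by (rule finite_imageD)
      moreover have "S \<subseteq> arrows G" by (auto simp: S_def rng_fibre_def)
      ultimately obtain k where k: "inj_on (\<lambda>b. {i. i < k \<and> b \<in> gen i}) S"
        using finite_separated[of S gen] gen(3) by (meson subsetD)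
      obtain t where t: "set t = {i. i < k \<and> a \<in> gen i}" using finite_list[of "{i. i < k \<and> a \<in> gen i}"] by auto
      have Pn: "b \<in> P (to_nat (n, k, t)) \<longleftrightarrow> b \<in> S \<and> {i. i < k \<and> b \<in> gen i} = {i. i < k \<and> a \<in> gen i}"
        if "b \<in> rng_fibre G x" for b
        using that by (auto simp: P_def S_def t rng_fibre_def)
      have "a \<in> S" using a n by (simp add: S_def)
      then show "\<exists>p. a \<in> P p \<and> (\<forall>b\<in>rng_fibre G x. b \<in> P p \<longrightarrow> b = a)"
        using Pn a k by (intro exI[of _ "to_nat (n, k, t)"]) (auto dest: inj_onD)
    qed
  qed
  have Q: "AE x in \<mu>. (\<forall>n k. finite {b \<in> src_fibre G x. 1 / Suc k < cmod (F n b)}) \<and> (\<forall>n. F n x = 1) \<and>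
      (\<forall>n k (g :: nat \<Rightarrow> 'g). (\<forall>i<k. g i \<in> rng_fibre G x) \<longrightarrow>
        psd_matrix k (\<lambda>i j. F n (gmult G (ginv G (g i)) (g j))))"
    using fin one psd by eventually_elim blast
  obtain U sel where U: "U \<in> sets \<mu>" "space \<mu> - U \<in> null_sets \<mu>"
    "\<And>x. x \<in> U \<Longrightarrow> (\<forall>n k. finite {b \<in> src_fibre G x. 1 / Suc k < cmod (F n b)}) \<and> (\<forall>n. F n x = 1) \<and>
      (\<forall>n k (g :: nat \<Rightarrow> 'g). (\<forall>i<k. g i \<in> rng_fibre G x) \<longrightarrow>
        psd_matrix k (\<lambda>i j. F n (gmult G (ginv G (g i)) (g j))))"
    "\<And>a. a \<in> arrows G \<Longrightarrow> rng G a \<in> U \<longleftrightarrow> src G a \<in> U"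
    "\<And>m. sel m \<in> restrict_space (borel_str G) U \<rightarrow>\<^sub>M borel_str G"
    "\<And>m x. x \<in> U \<Longrightarrow> sel m x \<in> rng_fibre G x" "\<And>x. x \<in> U \<Longrightarrow> sel 0 x = x"
    "\<And>x a. x \<in> U \<Longrightarrow> a \<in> rng_fibre G x \<Longrightarrow> \<exists>m. sel (m::nat) x = a"
    by (rule borel_sections[OF P iso Q]) blast
  interpret positive_definite_sequence G \<mu> F U sel
  proof
    show "finite {b \<in> src_fibre G x. e < cmod (F n b)}" if x: "x \<in> U" and e: "0 < e" for x e n
    proof -
      obtain k where "1 / Suc k < e" using nat_approx_posE[OF e] by (metis of_nat_Suc)
      then have "{b \<in> src_fibre G x. e < cmod (F n b)} \<subseteq> {b \<in> src_fibre G x. 1 / Suc k < cmod (F n b)}" by auto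
      then show ?thesis using U(3)[OF x] by (blast intro: finite_subset)
    qed
  qed (use U Fm Fl in \<open>blast+\<close>)
  show ?thesis by (rule not_property_T[OF erg dif])
qed

end

theorem theorem9p2:
  fixes G :: "'g groupoid" and \<mu> :: "'g measure"
  assumes "countable_measured_groupoid G \<mu>"
    and "ergodic G \<mu>"
    and "diffuse \<mu>"
  shows "\<not> (property_T G \<mu> \<and> property_H G \<mu>)"
  using countable_measured_groupoid.not_T_and_H[OF assms] by blast

end
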